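(* The coefficients of the volume polynomials of maximal $3$-dimensional polytropes reflect the combinatorics of the corresponding regular central subdivision of $FP_4$, in the following way. Let $\mathbf c\in\mathbb R^{12}$ (coordinates $c_{ij}$, $i\neq j\in[4]$) define a maximal $3$-dimensional polytrope $P(\mathbf c)$, let $\mathcal T$ be the corresponding regular central triangulation of the fundamental polytope $FP_4$, and let $$\operatorname{Vol}(\mathbf a)=\sum_{\mathbf v}\alpha_{\mathbf v}\,\mathbf a^{\mathbf v},\qquad \mathbf v\in\mathbb N^{12},\ \sum_{i\ne j} v_{ij}=3,$$ be the normalized volume polynomial of the tropical type of $P(\mathbf c)$. (1) If $\mathbf a^{\mathbf v}=a_{ij}a_{kl}a_{st}$ with $i\ne j$, $k\neq l$, $s\neq t$ and the pairs $(i,j),(k,l),(s,t)$ pairwise distinct, then $\alpha_{\mathbf v}=6$ if $\mathbf e_i-\mathbf e_j,\ \mathbf e_k-\mathbf e_l,\ \mathbf e_s-\mathbf e_t$ form a $2$-dimensional simplex in $\mathcal T$, and $\alpha_{\mathbf v}=0$ otherwise. (2) If $\mathbf a^{\mathbf v}=a_{ij}^2a_{kl}$ with $i\neq j$, $k\neq l$ and $(i,j)\neq(k,l)$, then $\alpha_{\mathbf v}$ is nonzero only if $\mathbf e_i-\mathbf e_j$ and $\mathbf e_k-\mathbf e_l$ are adjacent vertices of $FP_4$. In that case, it is determined by the square facet $S$ of $FP_4$ containing $\mathbf e_i-\mathbf e_j$ and $\mathbf e_k-\mathbf e_l$: $\alpha_{\mathbf v}=-3$ if $\mathbf e_k-\mathbf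 e_l$ is incident to the triangulating edge of $S$, and $\alpha_{\mathbf v}=0$ otherwise. (3) If $\mathbf a^{\mathbf v}=a_{ij}^3$ with $i\neq j$, then $\alpha_{\mathbf v}=7-\deg(\mathbf e_i-\mathbf e_j)$, where $\deg(\mathbf e_i-\mathbf e_j)$ is the number of edges incident to the vertex $\mathbf e_i-\mathbf e_j$ in $\mathcal T$.
   Context: Write $[n]=\{1,\dots,n\}$. A vector $\mathbf c=(c_{ij})_{i\neq j\in[n]}\in\mathbb R^{n^2-n}$ is regarded as an $n\times n$ matrix with zero diagonal, i.e. as edge weights on the complete directed graph on $[n]$. The polytrope region $\mathcal Pol_n\subset\mathbb R^{n^2-n}$ is the set of $\mathbf c$ such that the weighted graph has no negative cycle and $c_{ij}$ equals the lowest weight of a path from $i$ to $j$ for all $i\neq j$. For $\mathbf c\in\mathcal Pol_n$ the associated polytrope is $P(\mathbf c)=\{\mathbf y\in\mathbb R^n\mid y_i-y_j\le c_{ij}\ (i\ne j),\ y_n=0\}$, viewed in $\mathbb R^{n-1}$ by forgetting the last coordinate. It is maximal if it has dimension $n-1$ and $\binom{2n-2}{n-1}$ vertices. Two maximal polytropes $P(\mathbf c)$, $P(\mathbf c')$ have the same tropical type if $in_{\mathbf c}(I)=in_{\mathbf c'}(I)$ (equivalently, they have the same normal fan), where $I=\langle x_{ij}x_{ji}-1,\ x_{ij}x_{jk}-x_{ik}\mid i,j,k\in[n]\text{ pairwise distinct}\rangle$ in the polynomial ring in the variables $x_{ij}$, $i\neq j\in[n]$, and $in_{\mathbf c}(I)$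 is the ideal generated by the initial forms of elements of $I$, the initial form of $f$ being the sum of the terms of $f$ whose exponent vector has maximal dot product with $\mathbf c$. The normalized volume polynomial of a maximal tropical type is the (unique) polynomial $\operatorname{Vol}(\mathbf a)$ in variables $a_{ij}$ ($i\neq j\in[n]$) such that $\operatorname{Vol}(\mathbf c)=(n-1)!\,\operatorname{vol}(P(\mathbf c))$ for every $\mathbf c$ whose polytrope has that type, where $\operatorname{vol}$ is the Euclidean volume in $\mathbb R^{n-1}$. It is homogeneous of degree $n-1$. The fundamental polytope is $FP_n=\operatorname{conv}\{\mathbf e_i-\mathbf e_j\mid i\neq j\in[n]\}$, where $\mathbf e_i$ are the standard basis vectors; its unique relative interior lattice point is $\mathbf 0$. The polytope $FP_4$ has $12$ vertices and six square facets (its other facets are triangles). A regular central subdivision of $FP_n$ is a regular subdivision (projection of the lower hull of a lifting of the points $\mathbf e_i-\mathbf e_j$ and $\mathbf 0$) in which $\mathbf 0$ is lifted to height $0$ and is a vertex of each maximal cell. The regular central subdivision corresponding to $P(\mathbf c)$ is the one obtained by lifting $\mathbf e_i-\mathbf e_j$ to height $c_{ij}$ and $\mathbf 0$ to height $0$; for a maximal polytrope it is a triangulation. For $n=4$, such a triangulation is determined by the choice, in each of the six square facets $S$ of $FP_4$, of one diagonal of $S$ subdividing $S$ into two triangles; this diagonal is called the triangulating edge of $S$.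
   Formalization: In (2), "adjacent vertices of FP_4" is taken to mean joined by an edge of the triangulation T (an edge of FP_4 or a triangulating diagonal); with edges of FP_4 only, the claim fails, since the two endpoints of a triangulating edge also give coefficient -3. *)

theory Defs
  imports "HOL-Analysis.Analysis" "HOL-Library.Poly_Mapping" "Graph_Theory.Shortest_Path"
begin

text \<open>
  The set $[4]$ is the type \<^typ>\<open>4\<close>; its numeral \<open>4\<close> (which equals \<open>0\<close> in this type) is the
  last coordinate $n = 4$. The index set $\{(i,j) \mid i \neq j \in [4]\}$ is a type of its own,
  so that \<open>real ^ offdiag\<close> is $\mathbb{R}^{12}$ and the polynomial rings below have exactly the
  variables $x_{ij}$ with $i \neq j$.
\<close>

typedef offdiag = "{(i :: 4, j :: 4). i \<noteq> j}"
  by (rule exI [of _ "(1, 2)"]) simp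

instance offdiag :: finite
proof
  have "UNIV = Abs_offdiag ` {(i, j). i \<noteq> j}"
    by (metis type_definition.Abs_image type_definition_offdiag)
  then show "finite (UNIV :: offdiag set)"
    by (metis finite finite_imageI)
qed

definition src :: "offdiag \<Rightarrow> 4" where
  "src e = fst (Rep_offdiag e)"

definition tgt :: "offdiag \<Rightarrow> 4" where
  "tgt e = snd (Rep_offdiag e)"


section \<open>Polytropes\<close>

definition K4 :: "(4, offdiag) pre_digraph" where
  "K4 = \<lparr>verts = UNIV, arcs = UNIV, tail = src, head = tgt\<rparr>"

interpretation K4: wf_digraph K4
  by unfold_locales (simp_all add: K4_def)

definition polytrope_region :: "(real ^ offdiag) set" where
  "polytrope_region = {c.
     (\<forall>p. K4.cycle p \<longrightarrow> K4.awalk_cost (($) c) p \<ge> 0) \<and>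
     (\<forall>e. K4.\<mu> (($) c) (src e) (tgt e) = ereal (c $ e))}"

definition polytrope :: "real ^ offdiag \<Rightarrow> (real ^ 4) set" where
  "polytrope c = {y. (\<forall>e. y $ src e - y $ tgt e \<le> c $ e) \<and> y $ 4 = 0}"

text \<open>Euclidean volume after forgetting the last coordinate:\<close>

definition polytrope_volume :: "real ^ offdiag \<Rightarrow> real" where
  "polytrope_volume c =
     measure lebesgue ((\<lambda>y. vector [y $ 1, y $ 2, y $ 3] :: real ^ 3) ` polytrope c)"

definition maximal_polytrope :: "real ^ offdiag \<Rightarrow> bool" where
  "maximal_polytrope c \<longleftrightarrow>
     c \<in> polytrope_region \<and> aff_dim (polytrope c) = 3 \<and>
     card {v. v extreme_point_of polytrope c} = (6 choose 3)"


section \<open>Polynomials and tropical types\<close>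

type_synonym monom = "offdiag \<Rightarrow>\<^sub>0 nat"
type_synonym mpoly = "monom \<Rightarrow>\<^sub>0 real"

definition eval_mpoly :: "mpoly \<Rightarrow> real ^ offdiag \<Rightarrow> real" where
  "eval_mpoly f a = (\<Sum>m\<in>Poly_Mapping.keys f.
     Poly_Mapping.lookup f m * (\<Prod>e\<in>UNIV. (a $ e) ^ Poly_Mapping.lookup m e))"

definition var :: "4 \<Rightarrow> 4 \<Rightarrow> mpoly" where
  "var i j = Poly_Mapping.single (Poly_Mapping.single (Abs_offdiag (i, j)) 1) 1"

text \<open>Ideals are the submodules of the ring, regarded as a module over itself.\<close>

definition ideal_generated :: "mpoly set \<Rightarrow> mpoly set" where
  "ideal_generated B = module.span (*) B"

definition polytrope_ideal :: "mpoly set" where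
  "polytrope_ideal = ideal_generated
     ({var i j * var j i - 1 | i j. i \<noteq> j} \<union>
      {var i j * var j k - var i k | i j k. i \<noteq> j \<and> j \<noteq> k \<and> i \<noteq> k})"

definition weight :: "real ^ offdiag \<Rightarrow> monom \<Rightarrow> real" where
  "weight c m = (\<Sum>e\<in>UNIV. c $ e * real (Poly_Mapping.lookup m e))"

definition initial_form :: "real ^ offdiag \<Rightarrow> mpoly \<Rightarrow> mpoly" where
  "initial_form c f =
     (\<Sum>m\<in>{m \<in> Poly_Mapping.keys f. \<forall>m'\<in>Poly_Mapping.keys f. weight c m' \<le> weight c m}.
        Poly_Mapping.single m (Poly_Mapping.lookup f m))"

definition initial_ideal :: "real ^ offdiag \<Rightarrow> mpoly set \<Rightarrow> mpoly set" where
  "initial_ideal c J = ideal_generated (initial_form c ` J)"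

definition same_tropical_type :: "real ^ offdiag \<Rightarrow> real ^ offdiag \<Rightarrow> bool" where
  "same_tropical_type c c' \<longleftrightarrow>
     maximal_polytrope c \<and> maximal_polytrope c' \<and>
     initial_ideal c polytrope_ideal = initial_ideal c' polytrope_ideal"

definition is_volume_polynomial :: "real ^ offdiag \<Rightarrow> mpoly \<Rightarrow> bool" where
  "is_volume_polynomial c f \<longleftrightarrow>
     (\<forall>c'. same_tropical_type c c' \<longrightarrow> eval_mpoly f c' = fact 3 * polytrope_volume c')"

definition volume_polynomial :: "real ^ offdiag \<Rightarrow> mpoly" where
  "volume_polynomial c = (THE f. is_volume_polynomial c f)"


section \<open>The fundamental polytope and its central subdivisions\<close>

definition root_vec :: "offdiag \<Rightarrow> real ^ 4" where
  "root_vec e = axis (src e) 1 - axis (tgt e) 1"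

definition FP4 :: "(real ^ 4) set" where
  "FP4 = convex hull (range root_vec)"

text \<open>The facets of \<^const>\<open>FP4\<close> are triangles and squares.\<close>

definition square_facet :: "(real ^ 4) set \<Rightarrow> bool" where
  "square_facet S \<longleftrightarrow> S facet_of FP4 \<and> card {v. v extreme_point_of S} = 4"

definition lifted_polytope :: "real ^ offdiag \<Rightarrow> ((real ^ 4) \<times> real) set" where
  "lifted_polytope c = convex hull (insert (0, 0) (range (\<lambda>e. (root_vec e, c $ e))))"

definition lower_hull :: "((real ^ 4) \<times> real) set \<Rightarrow> ((real ^ 4) \<times> real) set" where
  "lower_hull Q = {(x, h). (x, h) \<in> Q \<and> (\<forall>h'. (x, h') \<in> Q \<longrightarrow> h \<le> h')}"

text \<open>
  The set of all nonempty cells, of every dimension, of the regular central subdivision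
  corresponding to \<^term>\<open>polytrope c\<close>. Cells through the origin are included, in particular
  the edges from the origin to the vertices of \<^const>\<open>FP4\<close>.
\<close>

definition central_subdivision :: "real ^ offdiag \<Rightarrow> (real ^ 4) set set" where
  "central_subdivision c =
     {fst ` F | F. F face_of lifted_polytope c \<and> F \<noteq> {} \<and> F \<subseteq> lower_hull (lifted_polytope c)}"

text \<open>
  Two vertices of \<^const>\<open>FP4\<close> are adjacent if the segment between them is an edge of the
  triangulation. These segments are the edges of \<^const>\<open>FP4\<close> and the triangulating edges. The
  latter cannot be left out: if $a$ and $b$ are the endpoints of a triangulating edge, then the
  two monomials formed from the square of the variable of one and the variable of the other
  both have coefficient $-3$ in the volume polynomial.
\<close>

definition adjacent :: "(real ^ 4) set set \<Rightarrow> real ^ 4 \<Rightarrow> real ^ 4 \<Rightarrow> bool" where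
  "adjacent T p q \<longleftrightarrow> p \<noteq> q \<and> closed_segment p q \<in> T"

text \<open>The cell \<open>E\<close> of \<open>T\<close> is a diagonal of the square \<open>S\<close>:\<close>

definition triangulating_edge :: "(real ^ 4) set set \<Rightarrow> (real ^ 4) set \<Rightarrow> (real ^ 4) set \<Rightarrow> bool" where
  "triangulating_edge T S E \<longleftrightarrow>
     E \<in> T \<and>
     (\<exists>p q. p extreme_point_of S \<and> q extreme_point_of S \<and> p \<noteq> q \<and>
            E = closed_segment p q \<and> \<not> E edge_of S)"

text \<open>
  The edge from the origin to the vertex counts towards its degree. So the degree is $5$ plus
  the number of triangulating edges at the vertex, as there are four edges of \<^const>\<open>FP4\<close> at it.
\<close>

definition deg :: "(real ^ 4) set set \<Rightarrow> real ^ 4 \<Rightarrow> nat" where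
  "deg T p = card {E \<in> T. aff_dim E = 1 \<and> p extreme_point_of E}"

end

theory Submission
  imports Defs "HOL-Real_Asymp.Real_Asymp"
begin

text \<open>
  Write a pair of edges as $e = (i,j)$, $f = (k,l)$ with $i \neq k$ and $j \neq l$, and put
  $c_{ii} = 0$. The polytrope is maximal exactly if the triangle inequalities hold and
  $c_{ij} + c_{kl} \neq c_{il} + c_{kj}$ for all such pairs; call $e, f$ noncrossing if the left
  side is the smaller one. All combinatorial data are read off this relation: the cells of the
  triangulation are spanned by the sets of pairwise noncrossing edges, the vertices of the
  polytrope correspond to the maximal such sets, and the initial ideal is generated by the
  monomials whose support is not such a set. So the tropical type is an open condition, and the
  volume polynomial is determined by its values.

  The volume is computed by cutting the box $-c_{4i} \leq y_i \leq c_{i4}$ by the inequalities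
  $y_i - y_j \leq c_{ij}$ with $i, j \neq 4$. The set of inequalities violated at a point of the
  box is a strict partial order on three elements, and inclusion-exclusion leaves only prisms
  and the corners where two violated inequalities share an index. The volume of such a corner is
  a cubic that depends on one sign, the diagonal of one square facet, and the sum of all terms
  can be compared with the polynomial that has the asserted coefficients.
\<close>

section \<open>Weights and the polytrope region\<close>

text \<open>A single kind of relation links the three objects: (e_i - e_j) + (e_k - e_l) = (e_i -
  e_l) + (e_k - e_j), where a vector with equal indices is the origin. It is at once a binomial of
  the ideal, an exchange of lifted vertices in the triangulation, and a comparison of two pairs of
  inequalities of the polytrope. On four vertices the maximal noncrossing sets are trees that can be
  listed, which replaces general theory of regular triangulations and Groebner bases: solving the
  equations of a tree gives a vertex of the polytrope, and that vertex supplies both the supporting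
  hyperplane of a cell and a zero of the initial ideal. The delicate direction leads from maximality
  to strict inequalities, because vertices have to be counted while ties are still possible. In the
  volume the choice of diagonals enters through minima of two numbers; encoding each choice by an
  indicator with values 0 and 1 turns the final comparison into one polynomial identity that covers
  all types at once.\<close>

definition edge :: "4 \<Rightarrow> 4 \<Rightarrow> offdiag" where
  "edge i j = Abs_offdiag (i, j)"

lemma src_edge [simp]: "i \<noteq> j \<Longrightarrow> src (edge i j) = i"
  and tgt_edge [simp]: "i \<noteq> j \<Longrightarrow> tgt (edge i j) = j"
  by (simp_all add: edge_def src_def tgt_def Abs_offdiag_inverse)

lemma src_neq_tgt [simp]: "src e \<noteq> tgt e" "tgt e \<noteq> src e"
  using Rep_offdiag [of e] by (auto simp: src_def tgt_def)

lemma edge_src_tgt [simp]: "edge (src e) (tgt e) = e"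
  by (simp add: edge_def src_def tgt_def Rep_offdiag_inverse)

lemma offdiag_eq_iff: "e = f \<longleftrightarrow> src e = src f \<and> tgt e = tgt f"
  by (metis edge_src_tgt)

lemma edge_eq_iff: "i \<noteq> j \<Longrightarrow> k \<noteq> l \<Longrightarrow> edge i j = edge k l \<longleftrightarrow> i = k \<and> j = l"
  by (metis src_edge tgt_edge)

text \<open>The zero diagonal lets one triangle inequality express both conditions of the region:
  its case i = k is the nonnegativity of two-cycles. It also covers swapped pairs in which an edge
  degenerates to a loop.\<close>

definition wt :: "real ^ offdiag \<Rightarrow> 4 \<Rightarrow> 4 \<Rightarrow> real" where
  "wt c i j = (if i = j then 0 else c $ edge i j)"

lemma wt_refl [simp]: "wt c i i = 0"
  by (simp add: wt_def)

lemma wt_src_tgt [simp]: "wt c (src e) (tgt e) = c $ e"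
  by (simp add: wt_def)

lemma forall_edge: "(\<forall>e. P e) \<longleftrightarrow> (\<forall>i j. i \<noteq> j \<longrightarrow> P (edge i j))"
  by (metis edge_src_tgt src_neq_tgt(1))

lemma distinct_cases_4:
  fixes i j k l :: 4
  assumes "distinct [i, j, k, l]"
  shows "UNIV = {i, j, k, l}"
proof -
  have "card {i, j, k, l} = card (UNIV :: 4 set)"
    using assms by simp
  then show ?thesis
    using card_subset_eq [OF finite subset_UNIV, of "{i, j, k, l}"] by simp
qed

lemma ex_fourth:
  fixes i j k :: 4
  shows "\<exists>l. l \<notin> {i, j, k}"
proof (rule ccontr)
  assume "\<not> ?thesis"
  then have "{i, j, k} = UNIV"
    by blast
  then have "card {i, j, k} = card (UNIV :: 4 set)"
    by (rule arg_cong)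
  moreover have "card {i, j, k} \<le> 3"
    using card_length [of "[i, j, k]"] by simp
  ultimately show False by simp
qed

section \<open>The polytrope region and triangle inequalities\<close>

lemma polytrope_iff:
  "y \<in> polytrope c \<longleftrightarrow> (\<forall>i j. y $ i - y $ j \<le> wt c i j) \<and> y $ 4 = 0"
  unfolding polytrope_def mem_Collect_eq forall_edge by (auto simp: wt_def)

definition triangle_ineqs :: "real ^ offdiag \<Rightarrow> bool" where
  "triangle_ineqs c \<longleftrightarrow> (\<forall>i j k. wt c i k \<le> wt c i j + wt c j k)"

lemma K4_awalk_Nil [simp]: "K4.awalk u [] v \<longleftrightarrow> u = v"
  unfolding K4.awalk_Nil_iff by (auto simp: K4_def)

lemma K4_awalk_Cons [simp]: "K4.awalk u (e # p) v \<longleftrightarrow> u = src e \<and> K4.awalk (tgt e) p v"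
  unfolding K4.awalk_Cons_iff by (auto simp: K4_def)

lemma triangle_ineqs_awalk:
  assumes "triangle_ineqs c" "K4.awalk u p v"
  shows "wt c u v \<le> K4.awalk_cost (($) c) p"
  using assms(2)
proof (induction p arbitrary: u)
  case (Cons e p)
  have "wt c u v \<le> wt c u (tgt e) + wt c (tgt e) v"
    using assms(1) by (simp add: triangle_ineqs_def)
  then show ?case
    using Cons.IH [of "tgt e"] Cons.prems wt_src_tgt [of c e] by auto
qed (simp add: wt_def)

text \<open>Triangle inequalities propagate along walks, which bounds cycles below by zero and makes
  single edges shortest. Conversely, a walk of two edges competes with the direct edge.\<close>

lemma polytrope_region_iff: "c \<in> polytrope_region \<longleftrightarrow> triangle_ineqs c"
proof
  assume "triangle_ineqs c"
  show "c \<in> polytrope_region"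
    unfolding polytrope_region_def mem_Collect_eq
  proof (intro conjI allI impI)
    fix p assume "K4.cycle p"
    then obtain u where "K4.awalk u p u"
      by (auto simp: K4.cycle_def)
    then show "K4.awalk_cost (($) c) p \<ge> 0"
      using triangle_ineqs_awalk [OF \<open>triangle_ineqs c\<close>, of u p u] by simp
  next
    fix e
    have "K4.\<mu> (($) c) (src e) (tgt e) \<le> ereal (K4.awalk_cost (($) c) [e])"
      by (rule K4.min_cost_le_walk_cost) simp
    moreover have "ereal (c $ e) \<le> K4.\<mu> (($) c) (src e) (tgt e)"
      unfolding K4.\<mu>_def
      by (rule INF_greatest) (use triangle_ineqs_awalk [OF \<open>triangle_ineqs c\<close>, of "src e" _ "tgt e"] in auto)
    ultimately show "K4.\<mu> (($) c) (src e) (tgt e) = ereal (c $ e)"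
      by (simp add: antisym)
  qed
next
  assume c: "c \<in> polytrope_region"
  have mu: "c $ edge i j \<le> K4.awalk_cost (($) c) p"
    if "i \<noteq> j" "K4.awalk i p j" for i j p
  proof -
    have "K4.\<mu> (($) c) i j = ereal (c $ edge i j)"
      using c spec [of "\<lambda>e. K4.\<mu> (($) c) (src e) (tgt e) = ereal (c $ e)" "edge i j"] that
      by (simp add: polytrope_region_def)
    then show ?thesis
      using K4.min_cost_le_walk_cost [OF that(2), of "($) c"] by simp
  qed
  have tri: "c $ edge i k \<le> c $ edge i j + c $ edge j k" if "i \<noteq> j" "j \<noteq> k" "i \<noteq> k" for i j k
    using mu [of i k "[edge i j, edge j k]"] that by simp
  \<comment> \<open>A detour over a third vertex k: adding c_ki \<le> c_kj + c_ji and c_kj \<le>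
    c_ki + c_ij leaves the claim.\<close>
  have two: "0 \<le> c $ edge i j + c $ edge j i" if "i \<noteq> j" for i j
  proof -
    obtain k where "k \<notin> {i, j, j}"
      using ex_fourth by blast
    then show ?thesis
      using tri [of k j i] tri [of k i j] that by (auto)
  qed
  show "triangle_ineqs c"
    unfolding triangle_ineqs_def
  proof (intro allI)
    fix i j k :: 4
    consider "i = j \<or> j = k" | "i \<noteq> j" "j \<noteq> k" "i = k" | "i \<noteq> j" "j \<noteq> k" "i \<noteq> k"
      by blast
    then show "wt c i k \<le> wt c i j + wt c j k"
      using tri [of i j k] two [of i j] by cases (auto simp: wt_def)
  qed
qed

section \<open>Trees of tight edges\<close>

text \<open>
  The edges of a pair may share vertices: for a path from \<open>i\<close> over \<open>j\<close> to \<open>k\<close> the swapped pair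
  has weight \<open>c_ik + 0\<close>, so by the triangle inequality a path is never noncrossing.
\<close>

definition opp :: "offdiag \<Rightarrow> offdiag \<Rightarrow> bool" where
  "opp e f \<longleftrightarrow> src e \<noteq> src f \<and> tgt e \<noteq> tgt f"

definition swap_wt :: "real ^ offdiag \<Rightarrow> offdiag \<Rightarrow> offdiag \<Rightarrow> real" where
  "swap_wt c e f = wt c (src e) (tgt f) + wt c (src f) (tgt e)"

text \<open>Edges with a common tail or a common head count as noncrossing, because swapping their
  heads returns the same pair.\<close>

definition noncrossing :: "real ^ offdiag \<Rightarrow> offdiag \<Rightarrow> offdiag \<Rightarrow> bool" where
  "noncrossing c e f \<longleftrightarrow> (opp e f \<longrightarrow> c $ e + c $ f < swap_wt c e f)"

definition clique :: "real ^ offdiag \<Rightarrow> offdiag set \<Rightarrow> bool" where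
  "clique c X \<longleftrightarrow> (\<forall>e\<in>X. \<forall>f\<in>X. noncrossing c e f)"

definition generic :: "real ^ offdiag \<Rightarrow> bool" where
  "generic c \<longleftrightarrow> triangle_ineqs c \<and> (\<forall>e f. opp e f \<longrightarrow> c $ e + c $ f \<noteq> swap_wt c e f)"

definition tight :: "real ^ offdiag \<Rightarrow> real ^ 4 \<Rightarrow> offdiag set" where
  "tight c y = {e. y $ src e - y $ tgt e = c $ e}"

definition outstar :: "4 \<Rightarrow> offdiag set" where
  "outstar i = {e. src e = i}"

definition instar :: "4 \<Rightarrow> offdiag set" where
  "instar i = {e. tgt e = i}"

definition zpath :: "4 \<Rightarrow> 4 \<Rightarrow> 4 \<Rightarrow> 4 \<Rightarrow> offdiag set" where
  "zpath i j k l = {edge i k, edge i l, edge j k}"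

text \<open>These are the spanning trees in which each vertex is only a tail or only a head. A class
  with one vertex gives a star; two classes with two vertices each give an alternating path l <- i
  -> k <- j.\<close>

definition tree :: "offdiag set \<Rightarrow> bool" where
  "tree \<tau> \<longleftrightarrow> (\<exists>i. \<tau> = outstar i) \<or> (\<exists>i. \<tau> = instar i) \<or>
     (\<exists>i j k l. distinct [i, j, k, l] \<and> \<tau> = zpath i j k l)"

lemma tree_cases [consumes 1, case_names outstar instar zpath]:
  assumes "tree \<tau>"
  obtains i where "\<tau> = outstar i"
    | i where "\<tau> = instar i"
    | i j k l where "distinct [i, j, k, l]" "\<tau> = zpath i j k l"
  using assms by (auto simp: tree_def)

lemma genericD: "generic c \<Longrightarrow> opp e f \<Longrightarrow> c $ e + c $ f \<noteq> swap_wt c e f"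
  by (simp add: generic_def)

lemma generic_triangle: "generic c \<Longrightarrow> triangle_ineqs c"
  by (simp add: generic_def)

lemma triangleD: "triangle_ineqs c \<Longrightarrow> wt c i k \<le> wt c i j + wt c j k"
  by (simp add: triangle_ineqs_def)

lemma noncrossing_sym: "noncrossing c e f \<longleftrightarrow> noncrossing c f e"
  by (auto simp: noncrossing_def opp_def swap_wt_def add.commute)

lemma noncrossing_refl [simp]: "noncrossing c e e"
  by (simp add: noncrossing_def opp_def)

lemma noncrossing_no_path:
  assumes "triangle_ineqs c" "noncrossing c e f"
  shows "tgt e \<noteq> src f"
proof
  assume eq: "tgt e = src f"
  then have "opp e f"
    unfolding opp_def by (metis src_neq_tgt(1))
  then have "c $ e + c $ f < wt c (src e) (tgt f)"
    using assms(2) eq by (simp add: noncrossing_def swap_wt_def)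
  then show False
    using triangleD [OF assms(1), of "src e" "tgt f" "src f"] wt_src_tgt [of c e]
      by (simp add: eq)
qed

lemma cliqueD: "clique c X \<Longrightarrow> e \<in> X \<Longrightarrow> f \<in> X \<Longrightarrow> opp e f \<Longrightarrow> c $ e + c $ f < swap_wt c e f"
  by (auto simp: clique_def noncrossing_def)

lemma tree_outstar [simp]: "tree (outstar i)"
  and tree_instar [simp]: "tree (instar i)"
  and tree_zpath: "distinct [i, j, k, l] \<Longrightarrow> tree (zpath i j k l)"
  unfolding tree_def by blast+

lemma card_tree:
  assumes "tree \<tau>"
  shows "card \<tau> = 3"
  using assms
proof (cases rule: tree_cases)
  case (outstar i)
  have "bij_betw tgt (outstar i) (- {i})"
    by (rule bij_betw_byWitness [of _ "edge i"]) (auto simp: outstar_def)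
  moreover have "card (- {i}) = 3"
    by (simp add: Compl_eq_Diff_UNIV)
  ultimately show ?thesis
    using outstar by (simp add: bij_betw_same_card)
next
  case (instar i)
  have "bij_betw src (instar i) (- {i})"
    by (rule bij_betw_byWitness [of _ "\<lambda>j. edge j i"]) (auto simp: instar_def)
  moreover have "card (- {i}) = 3"
    by (simp add: Compl_eq_Diff_UNIV)
  ultimately show ?thesis
    using instar by (simp add: bij_betw_same_card)
next
  case (zpath i j k l)
  then show ?thesis
    by (auto simp: zpath_def edge_eq_iff)
qed

text \<open>A tree has no cycle, so differences along its edges are unconstrained. This yields the
  vertices of the polytrope, the dual bases to the roots of a tree, and arbitrary positive
  coordinates for limit points.\<close>

lemma tree_free:
  fixes w :: "offdiag \<Rightarrow> real"
  assumes "tree \<tau>"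
  obtains u :: "real ^ 4" where "u $ 4 = 0" "\<And>e. e \<in> \<tau> \<Longrightarrow> u $ src e - u $ tgt e = w e"
proof -
  have "\<exists>u :: real ^ 4. \<forall>e\<in>\<tau>. u $ src e - u $ tgt e = w e"
    using assms
  proof (cases rule: tree_cases)
    case (outstar i)
    show ?thesis
      by (rule exI [of _ "\<chi> j. if j = i then 0 else - w (edge i j)"])
        (auto simp: outstar outstar_def)
  next
    case (instar i)
    show ?thesis
      by (rule exI [of _ "\<chi> j. if j = i then 0 else w (edge j i)"])
        (auto simp: instar instar_def)
  next
    case (zpath i j k l)
    show ?thesis
      by (rule exI [of _ "\<chi> p. if p = i then 0 else if p = k then - w (edge i k)
           else if p = l then - w (edge i l) else w (edge j k) - w (edge i k)"])
        (use zpath(1) in \<open>auto simp: zpath zpath_def\<close>)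
  qed
  then obtain u :: "real ^ 4" where u: "\<forall>e\<in>\<tau>. u $ src e - u $ tgt e = w e"
    by blast
  show thesis
    by (rule that [of "\<chi> p. u $ p - u $ 4"]) (use u in auto)
qed

lemma tree_rigid:
  fixes u :: "real ^ 4"
  assumes "tree \<tau>" "\<And>e. e \<in> \<tau> \<Longrightarrow> u $ src e = u $ tgt e" "u $ 4 = 0"
  shows "u = 0"
proof -
  have "\<exists>i. \<forall>j. u $ i = u $ j"
    using assms(1)
  proof (cases rule: tree_cases)
    case (outstar i)
    then have "u $ i = u $ j" for j
      using assms(2) [of "edge i j"] by (cases "i = j") (auto simp: outstar_def)
    then show ?thesis by blast
  next
    case (instar i)
    then have "u $ i = u $ j" for j
      using assms(2) [of "edge j i"] by (cases "i = j") (auto simp: instar_def)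
    then show ?thesis by blast
  next
    case (zpath i j k l)
    have "u $ i = u $ k" "u $ i = u $ l" "u $ j = u $ k"
      using assms(2) [of "edge i k"] assms(2) [of "edge i l"] assms(2) [of "edge j k"] zpath
      by (auto simp: zpath_def)
    then have "u $ i = u $ p" for p
      using distinct_cases_4 [OF zpath(1)] by (metis UNIV_I insertE singletonD)
    then show ?thesis by blast
  qed
  then show ?thesis
    using assms(3) by (metis vec_eq_iff zero_index)
qed

lemma tree_feasible:
  assumes "triangle_ineqs c" "tree \<tau>" "clique c \<tau>"
  obtains y where "y \<in> polytrope c" "\<tau> \<subseteq> tight c y"
proof -
  obtain y :: "real ^ 4" where y4: "y $ 4 = 0" and y: "\<And>e. e \<in> \<tau> \<Longrightarrow> y $ src e - y $ tgt e = c $ e"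
    using tree_free [OF assms(2), of "($) c"] by blast
  note tri = triangleD [OF assms(1)]
  have "y $ p - y $ q \<le> wt c p q" for p q
    using assms(2)
  proof (cases rule: tree_cases)
    case (outstar i)
    have "y $ i - y $ p = wt c i p" for p
      using y [of "edge i p"] outstar by (cases "i = p") (auto simp: outstar_def wt_def)
    from this [of p] this [of q] tri [of i q p] show ?thesis
      by linarith
  next
    case (instar i)
    have "y $ p - y $ i = wt c p i" for p
      using y [of "edge p i"] instar by (cases "i = p") (auto simp: instar_def wt_def)
    from this [of p] this [of q] tri [of p i q] show ?thesis
      by linarith
  next
    case (zpath i j k l)
    have e: "y $ i - y $ k = wt c i k" "y $ i - y $ l = wt c i l" "y $ j - y $ k = wt c j k"
      using y [of "edge i k"] y [of "edge i l"] y [of "edge j k"] zpath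
      by (auto simp: zpath_def wt_def)
    \<comment> \<open>On the path y_j - y_l = c_jk - c_ik + c_il, so this is the inequality of the
      edge from j to l. All others follow from triangle inequalities.\<close>
    have d: "wt c i l + wt c j k < wt c i k + wt c j l"
      using zpath assms(3)
      by (auto simp: clique_def zpath_def noncrossing_def opp_def swap_wt_def wt_def)
    have "p \<in> {i, j, k, l}" "q \<in> {i, j, k, l}"
      using distinct_cases_4 [OF zpath(1)] by auto
    with e d show ?thesis
      using tri [of i k j] tri [of j k i] tri [of i l k] tri [of i k l] tri [of i i k] tri [of i i l]
        tri [of j j k] tri [of l k j]
      by auto
  qed
  then have "y \<in> polytrope c"
    using y4 by (simp add: polytrope_iff)
  moreover have "\<tau> \<subseteq> tight c y"
    using y by (auto simp: tight_def)
  ultimately show thesis ..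
qed

lemma clique_outstar [simp]: "clique c (outstar i)"
  and clique_instar [simp]: "clique c (instar i)"
  by (auto simp: clique_def outstar_def instar_def noncrossing_def opp_def)

lemma clique_zpath:
  assumes "distinct [i, j, k, l]" "wt c i l + wt c j k < wt c i k + wt c j l"
  shows "clique c (zpath i j k l)"
  using assms by (auto simp: clique_def zpath_def noncrossing_def opp_def swap_wt_def wt_def)

text \<open>The pair (i,k), (j,l) is the heavier one and crosses, so the clique omits one of its two
  edges. The other three edges of the square form a path.\<close>

lemma clique_zpath_exists:
  assumes "distinct [i, j, k, l]" "wt c i l + wt c j k < wt c i k + wt c j l" "clique c X"
    and X: "\<And>e. e \<in> X \<Longrightarrow> src e \<in> {i, j} \<and> tgt e \<in> {k, l}"
  obtains \<tau> where "tree \<tau>" "clique c \<tau>" "X \<subseteq> \<tau>"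
proof -
  have X': "X \<subseteq> {edge i k, edge i l, edge j k, edge j l}"
    using X by (fastforce simp: offdiag_eq_iff) 
  have "\<not> (edge i k \<in> X \<and> edge j l \<in> X)"
    using assms(1,2) cliqueD [OF assms(3), of "edge i k" "edge j l"]
    by (auto simp: opp_def swap_wt_def wt_def)
  then consider "X \<subseteq> zpath i j k l" | "X \<subseteq> zpath j i l k"
    using X' by (auto simp: zpath_def)
  then show thesis
  proof cases
    case 1
    then show thesis
      using that [of "zpath i j k l"] clique_zpath [OF assms(1,2)] tree_zpath [OF assms(1)] by blast
  next
    case 2
    have "clique c (zpath j i l k)"
      by (rule clique_zpath) (use assms in auto)
    with 2 show thesis
      using that [of "zpath j i l k"] tree_zpath [of j i l k] assms(1) by auto
  qed
qed

text \<open>A clique contains no path of two edges, so its tails and heads are disjoint. If it is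
  not part of a star, it has two tails and two heads, which exhaust the four vertices and place it
  in one square.\<close>

lemma clique_tree:
  assumes "generic c" "clique c X"
  obtains \<tau> where "tree \<tau>" "clique c \<tau>" "X \<subseteq> \<tau>"
proof -
  have disj: "tgt e \<noteq> src f" if "e \<in> X" "f \<in> X" for e f
    using that assms noncrossing_no_path [OF generic_triangle] by (auto simp: clique_def)
  consider i where "X \<subseteq> outstar i" | i where "X \<subseteq> instar i"
    | e f g h where "e \<in> X" "f \<in> X" "src e \<noteq> src f" "g \<in> X" "h \<in> X" "tgt g \<noteq> tgt h"
    unfolding outstar_def instar_def by blast
  then show thesis
  proof cases
    case (1 i)
    then show thesis using that [of "outstar i"] by simp
  next
    case (2 i)
    then show thesis using that [of "instar i"] by simp
  next
    case 3
    define i j k l where "i = src e" "j = src f" "k = tgt g" "l = tgt h"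
    have dist: "distinct [i, j, k, l]"
      using 3 disj by (auto simp: i_j_k_l_def) metis+
    have X: "src e \<in> {i, j} \<and> tgt e \<in> {k, l}" if "e \<in> X" for e
      using distinct_cases_4 [OF dist] disj that 3 unfolding i_j_k_l_def
      by (metis UNIV_I insertE insertI1 insertI2 singletonD)
    have "wt c i l + wt c j k \<noteq> wt c i k + wt c j l"
      using genericD [OF assms(1), of "edge i l" "edge j k"] dist
      by (auto simp: opp_def swap_wt_def wt_def)
    then consider "wt c i l + wt c j k < wt c i k + wt c j l" | "wt c i k + wt c j l < wt c i l + wt c j k"
      by linarith
    then show thesis
    proof cases
      case 1
      show thesis
        by (rule clique_zpath_exists [OF dist 1 assms(2) X]) (use that in auto)
    next
      case 2
      show thesis
        by (rule clique_zpath_exists [of i j l k, OF _ 2 assms(2)]) (use that dist X in auto)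
    qed
  qed
qed

section \<open>Vertices of the polytrope\<close>

text \<open>A direction that preserves all tight equations can be followed a little both ways
  without leaving the polytrope, which would make y a midpoint.\<close>

lemma extreme_tight_rigid:
  fixes u :: "real ^ 4"
  assumes y: "y extreme_point_of polytrope c"
    and u: "\<And>e. e \<in> tight c y \<Longrightarrow> u $ src e = u $ tgt e" "u $ 4 = 0"
  shows "u = 0"
proof -
  have yP: "y \<in> polytrope c"
    using y by (simp add: extreme_point_of_def)
  have "\<forall>\<^sub>F t in at 0. y $ src e - y $ tgt e + t * (u $ src e - u $ tgt e) \<le> c $ e" for e
  proof (cases "e \<in> tight c y")
    case True
    then show ?thesis
      using u(1) by (simp add: tight_def)
  next
    case False
    then have "y $ src e - y $ tgt e < c $ e"
      using yP by (fastforce simp: tight_def polytrope_def less_le)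
    moreover have tend: "((\<lambda>t. y $ src e - y $ tgt e + t * (u $ src e - u $ tgt e))
        \<longlongrightarrow> y $ src e - y $ tgt e) (at 0)"
      by (auto intro!: tendsto_eq_intros)
    ultimately have "\<forall>\<^sub>F t in at 0. y $ src e - y $ tgt e + t * (u $ src e - u $ tgt e) < c $ e"
      by (simp add: order_tendstoD(2) [OF tend])
    then show ?thesis
      by (rule eventually_mono) simp
  qed
  then have "\<forall>\<^sub>F t in at 0. \<forall>e. y $ src e - y $ tgt e + t * (u $ src e - u $ tgt e) \<le> c $ e"
    by (rule eventually_all_finite)
  then obtain d where "d > 0" and d: "\<And>t e. t \<noteq> 0 \<Longrightarrow> \<bar>t\<bar> < d \<Longrightarrow>
      y $ src e - y $ tgt e + t * (u $ src e - u $ tgt e) \<le> c $ e"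
    unfolding eventually_at by (auto simp: dist_real_def)
  have "y + t *\<^sub>R u \<in> polytrope c" if "t \<noteq> 0" "\<bar>t\<bar> < d" for t
    using d [OF that] yP u(2) by (auto simp: polytrope_def algebra_simps)
  from this [of "d / 2"] this [of "- (d / 2)"] \<open>d > 0\<close>
  have "y + (d / 2) *\<^sub>R u \<in> polytrope c" "y - (d / 2) *\<^sub>R u \<in> polytrope c"
    by auto
  moreover have "y = midpoint (y + (d / 2) *\<^sub>R u) (y - (d / 2) *\<^sub>R u)"
    by (simp add: midpoint_def vec_eq_iff)
  moreover have "y \<notin> open_segment a b" if "a \<in> polytrope c" "b \<in> polytrope c" for a b
    using y that by (simp add: extreme_point_of_def)
  ultimately have eq: "y + (d / 2) *\<^sub>R u = y - (d / 2) *\<^sub>R u"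
    using midpoint_in_open_segment [of "y + (d / 2) *\<^sub>R u" "y - (d / 2) *\<^sub>R u"] by metis
  have "u $ i = 0" for i
    using arg_cong [OF eq, of "\<lambda>v. v $ i"] \<open>d > 0\<close> by simp
  then show ?thesis
    by (simp add: vec_eq_iff)
qed

lemma tree_point_unique:
  assumes "tree \<tau>" "y \<in> polytrope c" "z \<in> polytrope c" "\<tau> \<subseteq> tight c y" "\<tau> \<subseteq> tight c z"
  shows "y = z"
proof -
  have "y - z = 0"
  proof (rule tree_rigid [OF assms(1)])
    fix e assume "e \<in> \<tau>"
    then have "y $ src e - y $ tgt e = c $ e" "z $ src e - z $ tgt e = c $ e"
      using assms by (auto simp: tight_def)
    then show "(y - z) $ src e = (y - z) $ tgt e"
      by (simp add: algebra_simps)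
  qed (use assms in \<open>auto simp: polytrope_def\<close>)
  then show ?thesis by simp
qed

text \<open>An inequality that is tight at an inner point of a segment is tight at both ends. So
  both ends solve the equations of the tree and coincide.\<close>

lemma tree_point_extreme:
  assumes "tree \<tau>" "y \<in> polytrope c" "\<tau> \<subseteq> tight c y"
  shows "y extreme_point_of polytrope c"
  unfolding extreme_point_of_def
proof (intro conjI ballI notI)
  fix a b assume ab: "a \<in> polytrope c" "b \<in> polytrope c" "y \<in> open_segment a b"
  then obtain s where s: "0 < s" "s < 1" "y = (1 - s) *\<^sub>R a + s *\<^sub>R b" "a \<noteq> b"
    by (auto simp: in_segment)
  have "\<tau> \<subseteq> tight c a \<and> \<tau> \<subseteq> tight c b"
  proof -
    have "a $ src e - a $ tgt e = c $ e \<and> b $ src e - b $ tgt e = c $ e" if "e \<in> \<tau>" for e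
    proof -
      let ?p = "c $ e - (a $ src e - a $ tgt e)" and ?q = "c $ e - (b $ src e - b $ tgt e)"
      have "?p \<ge> 0" "?q \<ge> 0"
        using ab by (auto simp: polytrope_def)
      moreover have "(1 - s) * ?p + s * ?q = 0"
        using assms(3) that s(3) by (auto simp: tight_def subset_iff algebra_simps)
      ultimately have "(1 - s) * ?p = 0" "s * ?q = 0"
        using s by (auto simp: add_nonneg_eq_0_iff)
      then show ?thesis
        using s by auto
    qed
    then show ?thesis by (auto simp: tight_def)
  qed
  then show False
    using tree_point_unique [OF assms(1) ab(1,2)] s by blast
qed (use assms in auto)

text \<open>For tight edges the sum c_e + c_f regroups into the differences of the swapped pair,
  hence is at most its weight; genericity excludes equality.\<close>

lemma tight_clique:
  assumes "generic c" "y \<in> polytrope c"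
  shows "clique c (tight c y)"
  unfolding clique_def noncrossing_def
proof (intro ballI impI)
  fix e f assume "e \<in> tight c y" "f \<in> tight c y" "opp e f"
  moreover have "y $ src e - y $ tgt f \<le> wt c (src e) (tgt f)" "y $ src f - y $ tgt e \<le> wt c (src f) (tgt e)"
    using assms(2) by (auto simp: polytrope_iff)
  ultimately show "c $ e + c $ f < swap_wt c e f"
    using genericD [OF assms(1), of e f] by (auto simp: tight_def swap_wt_def)
qed

text \<open>All trees have three edges, so a clique that contains a tree cannot be larger than that
  tree.\<close>

lemma tight_tree_eq:
  assumes "generic c" "y \<in> polytrope c" "tree \<tau>" "\<tau> \<subseteq> tight c y"
  shows "tight c y = \<tau>"
proof -
  obtain \<sigma> where "tree \<sigma>" "tight c y \<subseteq> \<sigma>"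
    using clique_tree [OF assms(1) tight_clique [OF assms(1,2)]] by metis
  moreover have "\<tau> = \<sigma>"
    using calculation assms card_tree by (intro card_subset_eq) auto
  ultimately show ?thesis
    using assms by blast
qed

text \<open>The tight edges extend to a tree. If an edge of it were slack, the vector with
  difference 1 on that edge and 0 on the rest of the tree would contradict rigidity.\<close>

lemma extreme_tree:
  assumes "generic c" "y extreme_point_of polytrope c"
  shows "tree (tight c y)"
proof -
  have yP: "y \<in> polytrope c"
    using assms by (simp add: extreme_point_of_def)
  obtain \<tau> where \<tau>: "tree \<tau>" "clique c \<tau>" "tight c y \<subseteq> \<tau>"
    by (rule clique_tree [OF assms(1) tight_clique [OF assms(1) yP]])
  have "e \<in> tight c y" if "e \<in> \<tau>" for e
  proof (rule ccontr)
    assume e: "e \<notin> tight c y"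
    obtain u :: "real ^ 4" where u: "u $ 4 = 0"
      "\<And>f. f \<in> \<tau> \<Longrightarrow> u $ src f - u $ tgt f = (if f = e then 1 else 0)"
      by (rule tree_free [OF \<tau>(1), of "\<lambda>f. if f = e then 1 else 0"]) (rule that)
    have "u = 0"
    proof (rule extreme_tight_rigid [OF assms(2) _ u(1)])
      fix f assume "f \<in> tight c y"
      then have "f \<in> \<tau>" "f \<noteq> e"
        using e \<tau>(3) by auto
      then show "u $ src f = u $ tgt f"
        using u(2) [of f] by simp
    qed
    then show False
      using u(2) [OF that] by simp
  qed
  with \<tau>(3) have "tight c y = \<tau>"
    by blast
  with \<tau>(1) show ?thesis
    by simp
qed

text \<open>The right-hand set depends on c through the noncrossing relation only, hence so does the
  number of vertices.\<close>

lemma bij_betw_extreme_trees: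
  assumes "generic c"
  shows "bij_betw (tight c) {y. y extreme_point_of polytrope c} {\<tau>. tree \<tau> \<and> clique c \<tau>}"
  unfolding bij_betw_def
proof
  show "inj_on (tight c) {y. y extreme_point_of polytrope c}"
    using extreme_tree [OF assms] tree_point_unique
    by (auto simp: inj_on_def extreme_point_of_def) (metis order_refl)
  show "tight c ` {y. y extreme_point_of polytrope c} = {\<tau>. tree \<tau> \<and> clique c \<tau>}"
  proof safe
    fix \<tau> assume \<tau>: "tree \<tau>" "clique c \<tau>"
    then obtain y where "y \<in> polytrope c" "\<tau> \<subseteq> tight c y"
      using tree_feasible [OF generic_triangle [OF assms]] by blast
    then show "\<tau> \<in> tight c ` {y. y extreme_point_of polytrope c}"
      using tree_point_extreme tight_tree_eq assms \<tau> by blast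
  next
    fix y assume "y extreme_point_of polytrope c"
    then show "tree (tight c y)" "clique c (tight c y)"
      using extreme_tree tight_clique assms by (auto simp: extreme_point_of_def)
  qed
qed

text \<open>The mean of the four points at which an outstar is tight is a relative interior point:
  the inequality of e is slack at the point that belongs to the head of e.\<close>

lemma aff_dim_generic:
  assumes "generic c"
  shows "aff_dim (polytrope c) = 3"
proof -
  have "\<exists>y. y \<in> polytrope c \<and> tight c y = outstar i" for i
    using tree_feasible [OF generic_triangle [OF assms], of "outstar i"] tight_tree_eq [OF assms]
    by (metis clique_outstar tree_outstar)
  then obtain Y where Y: "\<And>i. Y i \<in> polytrope c" "\<And>i. tight c (Y i) = outstar i"
    by metis
  define z where "z = (\<Sum>i\<in>UNIV. (1 / 4) *\<^sub>R Y i)"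
  define U where "U = {y :: real ^ 4. \<forall>e. y $ src e - y $ tgt e < c $ e}"
  define H where "H = {y :: real ^ 4. axis 4 1 \<bullet> y = 0}"
  have H: "y \<in> H \<longleftrightarrow> y $ 4 = 0" for y
    by (simp add: H_def inner_axis')
  have z_nth: "z $ p = (\<Sum>i\<in>UNIV. (1 / 4) * Y i $ p)" for p
    by (simp add: z_def)
  have "z $ src e - z $ tgt e < c $ e" for e
  proof -
    have "z $ src e - z $ tgt e = (\<Sum>i\<in>UNIV. (1 / 4) * (Y i $ src e - Y i $ tgt e))"
      unfolding z_nth right_diff_distrib sum_subtractf ..
    also have "\<dots> < (\<Sum>i\<in>(UNIV :: 4 set). (1 / 4) * c $ e)"
    proof (rule sum_strict_mono_ex1)
      have "e \<notin> tight c (Y (tgt e))"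
        by (simp add: Y outstar_def)
      then have "Y (tgt e) $ src e - Y (tgt e) $ tgt e < c $ e"
        using Y(1) by (fastforce simp: tight_def polytrope_def less_le)
      then show "\<exists>i\<in>UNIV. (1 / 4) * (Y i $ src e - Y i $ tgt e) < (1 / 4) * c $ e"
        by (intro bexI [of _ "tgt e"]) simp_all
    next
      show "\<forall>i\<in>UNIV. (1 / 4) * (Y i $ src e - Y i $ tgt e) \<le> (1 / 4) * c $ e"
        by (intro ballI mult_left_mono) (use Y(1) in \<open>auto simp: polytrope_def\<close>)
    qed simp
    finally show ?thesis by simp
  qed
  then have "z \<in> H \<inter> U"
    using Y(1) by (simp add: U_def H z_nth polytrope_def)
  moreover have "convex H"
    unfolding H_def by (rule convex_hyperplane)
  moreover have "open U"
  proof -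
    have "open (\<Inter>e\<in>UNIV. {y :: real ^ 4. y $ src e - y $ tgt e < c $ e})"
      by (intro open_INT ballI open_Collect_less continuous_intros) simp
    then show ?thesis
      by (simp add: U_def Collect_all_eq)
  qed
  ultimately have "aff_dim (H \<inter> U) = aff_dim H"
    by (intro aff_dim_convex_Int_open) auto
  moreover have "aff_dim H = 3"
    unfolding H_def by (subst aff_dim_hyperplane) auto
  moreover have "H \<inter> U \<subseteq> polytrope c"
    by (auto simp: U_def H polytrope_def less_imp_le)
  moreover have "polytrope c \<subseteq> H"
    by (auto simp: H polytrope_def)
  ultimately show ?thesis
    by (metis aff_dim_subset antisym)
qed

text \<open>Start from a maximal i. If i does not dominate everything, connectedness gives an
  element p below i and below a second, incomparable maximal j. The fourth vertex lies below i or j,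
  which completes a path, or it can be connected only through p, which then lies below all.\<close>

lemma preorder_4_tree:
  fixes R :: "4 \<Rightarrow> 4 \<Rightarrow> bool"
  assumes refl: "\<And>i. R i i"
    and trans: "\<And>i j k. R i j \<Longrightarrow> R j k \<Longrightarrow> R i k"
    and conn: "\<And>A. A \<noteq> {} \<Longrightarrow> 4 \<notin> A \<Longrightarrow> \<exists>i\<in>A. \<exists>j\<in>- A. R i j \<or> R j i"
  shows "(\<exists>i. \<forall>j. R i j) \<or> (\<exists>i. \<forall>j. R j i) \<or>
    (\<exists>i j k l. distinct [i, j, k, l] \<and> R i k \<and> R i l \<and> R j k)"
proof -
  have conn': "\<exists>i\<in>A. \<exists>j\<in>- A. R i j \<or> R j i" if "A \<noteq> {}" "A \<noteq> UNIV" for A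
  proof (cases "4 \<in> A")
    case True
    have "- A \<noteq> {}" "4 \<notin> - A"
      using that(2) True by auto
    from conn [OF this] obtain i j where "i \<in> - A" "j \<in> A" "R j i \<or> R i j"
      by auto
    then show ?thesis
      by (intro bexI [of _ j] bexI [of _ i])
  next
    case False
    show ?thesis using conn [OF that(1) False] .
  qed
  define D where "D i = {j. R i j}" for i
  have D_mono: "D j \<subseteq> D i" if "R i j" for i j
    using trans [OF that] by (simp add: D_def subset_iff)
  have max: "\<exists>j. R j q \<and> (\<forall>m. R m j \<longrightarrow> R j m)" for q
  proof -
    obtain j where j: "D q \<subseteq> D j" "\<And>m. D j \<subseteq> D m \<Longrightarrow> D j = D m"
      using finite_has_maximal2 [of "range D" "D q"] by auto
    then have "R j q"
      using refl by (auto simp: D_def)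
    moreover have "R j m" if "R m j" for m
      using j(2) [OF D_mono [OF that]] refl [of m] by (auto simp: D_def)
    ultimately show ?thesis by metis
  qed
  obtain i where i: "\<And>m. R m i \<Longrightarrow> R i m"
    using max [of 1] by blast
  show ?thesis
  proof (cases "D i = UNIV")
    case True
    then have "\<forall>j. R i j"
      unfolding D_def by blast
    then show ?thesis by (intro disjI1 exI)
  next
    case False
    moreover have "D i \<noteq> {}"
      using refl [of i] by (auto simp: D_def)
    ultimately obtain p q where "R i p" "\<not> R i q" "R p q \<or> R q p"
      using conn' [of "D i"] unfolding D_def by blast
    then have pq: "R i p" "\<not> R i q" "R q p"
      using trans [of i p q] by auto
    obtain j where j: "R j q" "\<And>m. R m j \<Longrightarrow> R j m"
      using max [of q] by blast
    have ij: "\<not> R i j" "\<not> R j i" "R j p"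
      using i [of j] j(1) pq trans [of i j q] trans [of j q p] by auto
    then have ne: "i \<noteq> j" "p \<noteq> i" "p \<noteq> j"
      using refl pq(1) by auto
    obtain m where m: "m \<notin> {i, j, p}"
      using ex_fourth by blast
    have "distinct [i, j, p, m]"
      using ne m by auto
    then have U: "UNIV = {i, j, p, m}"
      by (rule distinct_cases_4)
    consider "R i m" | "R j m" | "\<not> R i m" "\<not> R j m"
      by fast
    then show ?thesis
    proof cases
      case 1
      have "distinct [i, j, p, m]"
        using ne m by auto
      with 1 pq(1) ij(3) show ?thesis
        by (intro disjI2 exI [of _ i] exI [of _ j] exI [of _ p] exI [of _ m]) simp
    next
      case 2
      have "distinct [j, i, p, m]"
        using ne m by auto
      with 2 pq(1) ij(3) show ?thesis
        by (intro disjI2 exI [of _ j] exI [of _ i] exI [of _ p] exI [of _ m]) simp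
    next
      case 3
      have "\<not> R m i"
        using 3 i [of m] by blast
      moreover have "\<not> R m j"
        using 3 j(2) [of m] by blast
      moreover have "\<not> R p m"
        using 3 trans [OF pq(1), of m] by blast
      moreover obtain x where "x \<noteq> m" "R m x \<or> R x m"
      proof -
        have "i \<in> UNIV - {m}"
          using m by auto
        then have "{m} \<noteq> UNIV"
          by auto
        with conn' [of "{m}"] that show thesis by auto
      qed
      moreover have "x \<in> {i, j, p, m}"
        unfolding U [symmetric] by simp
      ultimately have "R m p"
        using 3 by auto
      then have "R x p" for x
        using UNIV_I [of x, unfolded U] pq(1) ij(3) refl [of p] by auto
      then show ?thesis by (intro disjI2 disjI1 exI allI)
    qed
  qed
qed

section \<open>Maximal polytropes are generic\<close>

text \<open>The weights may be degenerate, so the tight edges need not form a clique. What remains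
  is that equality in the triangle inequality composes; this gives a preorder, and rigidity of the
  vertex makes it connected.\<close>

lemma extreme_contains_tree:
  assumes "triangle_ineqs c" "y extreme_point_of polytrope c"
  obtains \<tau> where "tree \<tau>" "\<tau> \<subseteq> tight c y"
proof -
  define R where "R i j \<longleftrightarrow> y $ i - y $ j = wt c i j" for i j
  have yP: "y \<in> polytrope c"
    using assms(2) by (simp add: extreme_point_of_def)
  then have y: "y $ i - y $ j \<le> wt c i j" for i j
    by (simp add: polytrope_iff)
  have tight: "e \<in> tight c y \<longleftrightarrow> R (src e) (tgt e)" for e
    by (simp add: tight_def R_def)
  have "(\<exists>i. \<forall>j. R i j) \<or> (\<exists>i. \<forall>j. R j i) \<or>
    (\<exists>i j k l. distinct [i, j, k, l] \<and> R i k \<and> R i l \<and> R j k)"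
  proof (rule preorder_4_tree)
    show "R i i" for i
      by (simp add: R_def)
    show "R i k" if "R i j" "R j k" for i j k
      using that y [of i k] triangleD [OF assms(1), of i k j] by (simp add: R_def)
    show "\<exists>i\<in>A. \<exists>j\<in>- A. R i j \<or> R j i" if A: "A \<noteq> {}" "4 \<notin> A" for A
    proof (rule ccontr)
      assume no: "\<not> ?thesis"
      \<comment> \<open>The indicator vector of a set without tight pairs to its complement is a
        direction that keeps all tight equations. It is normalized because 4 lies outside the
        set.\<close>
      have "(\<chi> i. if i \<in> A then 1 else (0 :: real)) = (0 :: real ^ 4)"
      proof (rule extreme_tight_rigid [OF assms(2)])
        fix e assume "e \<in> tight c y"
        then have "R (src e) (tgt e)"
          by (simp add: tight)
        then have "src e \<in> A \<longleftrightarrow> tgt e \<in> A"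
          using no by blast
        then show "(\<chi> i. if i \<in> A then 1 else (0 :: real)) $ src e = (\<chi> i. if i \<in> A then 1 else (0 :: real)) $ tgt e"
          by simp
      qed (use A in simp)
      then show False
        using A(1) by (auto simp: vec_eq_iff split: if_splits)
    qed
  qed
  then consider i where "\<forall>j. R i j" | i where "\<forall>j. R j i"
    | i j k l where "distinct [i, j, k, l]" "R i k" "R i l" "R j k"
    by blast
  then show thesis
  proof cases
    case (1 i)
    then show thesis
      by (intro that [OF tree_outstar [of i]]) (auto simp: outstar_def tight)
  next
    case (2 i)
    then show thesis
      by (intro that [OF tree_instar [of i]]) (auto simp: instar_def tight)
  next
    case (3 i j k l)
    then show thesis
      by (intro that [OF tree_zpath [OF 3(1)]]) (auto simp: zpath_def tight)
  qed
qed

section \<open>Counting candidate vertices without genericity\<close>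

abbreviation vertices :: "real ^ offdiag \<Rightarrow> (real ^ 4) set" where
  "vertices c \<equiv> {y. y extreme_point_of polytrope c}"

definition pts :: "real ^ offdiag \<Rightarrow> offdiag set \<Rightarrow> (real ^ 4) set" where
  "pts c \<tau> = {y \<in> polytrope c. \<tau> \<subseteq> tight c y}"

text \<open>The set A of tails fixes the square, and the tuples run over the four alternating paths
  in it. Grouping by squares matters because the four paths together admit at most two
  points.\<close>

definition sq_pts :: "real ^ offdiag \<Rightarrow> 4 set \<Rightarrow> (real ^ 4) set" where
  "sq_pts c A = (\<Union>(i, j, k, l)\<in>{(i, j, k, l). distinct [i, j, k, l] \<and> A = {i, j}}. pts c (zpath i j k l))"

lemma pts_tree:
  assumes "tree \<tau>"
  shows "finite (pts c \<tau>)" "card (pts c \<tau>) \<le> 1"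
proof -
  have "y = z" if "y \<in> pts c \<tau>" "z \<in> pts c \<tau>" for y z
    using tree_point_unique [OF assms, of y c z] that by (simp add: pts_def)
  then have "pts c \<tau> = {} \<or> (\<exists>y. pts c \<tau> = {y})"
    by blast
  then show "finite (pts c \<tau>)" "card (pts c \<tau>) \<le> 1"
    by auto
qed

lemma pts_zpath_iff:
  assumes "distinct [i, j, k, l]"
  shows "y \<in> pts c (zpath i j k l) \<longleftrightarrow> y \<in> polytrope c \<and> y $ i - y $ k = wt c i k \<and>
    y $ i - y $ l = wt c i l \<and> y $ j - y $ k = wt c j k"
  using assms by (auto simp: pts_def zpath_def tight_def wt_def)

lemma sq_pts_subset:
  assumes d: "distinct [i, j, k, l]"
  shows "sq_pts c {i, j} \<subseteq> pts c (zpath i j k l) \<union> pts c (zpath j i k l) \<union>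
    pts c (zpath i j l k) \<union> pts c (zpath j i l k)"
proof
  fix y assume "y \<in> sq_pts c {i, j}"
  then obtain i' j' k' l' where d': "distinct [i', j', k', l']" "{i, j} = {i', j'}"
    and y: "y \<in> pts c (zpath i' j' k' l')"
    by (auto simp: sq_pts_def)
  have "- {i, j} = {k, l}" "- {i', j'} = {k', l'}"
    using distinct_cases_4 [OF d] distinct_cases_4 [OF d'(1)] d d'(1) by auto
  then have "{k, l} = {k', l'}"
    using d'(2) by simp
  with d'(2) y show "y \<in> pts c (zpath i j k l) \<union> pts c (zpath j i k l) \<union>
      pts c (zpath i j l k) \<union> pts c (zpath j i l k)"
    by (auto simp: doubleton_eq_iff)
qed

text \<open>A path with both edges of the heavier pair would violate an inequality of the lighter
  pair. This leaves two of the four paths.\<close>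

lemma sq_pts_card_aux:
  assumes d: "distinct [i, j, k, l]" and less: "wt c i l + wt c j k < wt c i k + wt c j l"
  shows "card (sq_pts c {i, j}) \<le> 2"
proof -
  have "pts c (zpath j i k l) = {}" "pts c (zpath i j l k) = {}"
  proof -
    have "y \<notin> pts c (zpath j i k l) \<and> y \<notin> pts c (zpath i j l k)" for y
    proof (cases "y \<in> polytrope c")
      case True
      then have "y $ i - y $ l \<le> wt c i l" "y $ j - y $ k \<le> wt c j k"
        by (auto simp: polytrope_iff)
      moreover have "distinct [j, i, k, l]" "distinct [i, j, l, k]"
        using d by auto
      ultimately show ?thesis
        using less by (simp add: pts_zpath_iff)
    qed (auto simp: pts_def)
    then show "pts c (zpath j i k l) = {}" "pts c (zpath i j l k) = {}"
      by blast+
  qed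
  then have "sq_pts c {i, j} \<subseteq> pts c (zpath i j k l) \<union> pts c (zpath j i l k)"
    using sq_pts_subset [OF d, of c] by blast
  moreover have t: "tree (zpath i j k l)" "tree (zpath j i l k)"
    using d by (auto intro!: tree_zpath)
  ultimately have "card (sq_pts c {i, j}) \<le> card (pts c (zpath i j k l) \<union> pts c (zpath j i l k))"
    by (intro card_mono finite_UnI pts_tree)
  also have "\<dots> \<le> 1 + 1"
    by (rule order_trans [OF card_Un_le add_mono]) (rule pts_tree t)+
  finally show ?thesis by simp
qed

text \<open>If both pairs weigh the same, three tight edges of the square force the fourth, so the
  four paths share a single point.\<close>

lemma sq_pts_card_eq:
  assumes d: "distinct [i, j, k, l]" and eq: "wt c i l + wt c j k = wt c i k + wt c j l"
  shows "card (sq_pts c {i, j}) \<le> 1"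
proof -
  have d': "distinct [j, i, k, l]" "distinct [i, j, l, k]" "distinct [j, i, l, k]"
    using d by auto
  have "sq_pts c {i, j} \<subseteq> pts c (zpath i j k l)"
    using sq_pts_subset [OF d, of c] eq by (auto simp: pts_zpath_iff [OF d] pts_zpath_iff [OF d'(1)]
        pts_zpath_iff [OF d'(2)] pts_zpath_iff [OF d'(3)])
  then have "card (sq_pts c {i, j}) \<le> card (pts c (zpath i j k l))"
    by (intro card_mono pts_tree tree_zpath d)
  also have "\<dots> \<le> 1"
    by (intro pts_tree tree_zpath d)
  finally show ?thesis .
qed

lemma sq_pts_card:
  assumes "card A = 2"
  shows "finite (sq_pts c A)" "card (sq_pts c A) \<le> 2"
proof -
  obtain i j where ij: "A = {i, j}" "i \<noteq> j"
    using assms by (auto simp: card_2_iff)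
  have "card (- A) = 2"
    using assms by (simp add: Compl_eq_Diff_UNIV card_Diff_subset)
  then obtain k l where kl: "- A = {k, l}" "k \<noteq> l"
    by (auto simp: card_2_iff)
  have d: "distinct [i, j, k, l]"
    using ij kl by auto
  have "finite (pts c (zpath i j k l) \<union> pts c (zpath j i k l) \<union> pts c (zpath i j l k) \<union> pts c (zpath j i l k))"
    using d by (intro finite_UnI pts_tree tree_zpath) auto
  then show "finite (sq_pts c A)"
    using finite_subset [OF sq_pts_subset [OF d]] ij(1) by simp
  consider "wt c i l + wt c j k < wt c i k + wt c j l" | "wt c i l + wt c j k = wt c i k + wt c j l"
    | "wt c i k + wt c j l < wt c i l + wt c j k"
    by linarith
  then show "card (sq_pts c A) \<le> 2"
  proof cases
    case 1
    then show ?thesis using sq_pts_card_aux [OF d] ij(1) by simp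
  next
    case 2
    then show ?thesis using sq_pts_card_eq [OF d, of c] ij(1) by simp
  next
    case 3
    then show ?thesis using sq_pts_card_aux [of i j l k c] d ij(1) by auto
  qed
qed

lemma card_extreme_le:
  assumes "vertices c \<subseteq>
    (\<Union>i\<in>I. pts c (outstar i)) \<union> (\<Union>i. pts c (instar i)) \<union> (\<Union>A\<in>{A. card A = 2}. sq_pts c A)"
  shows "card (vertices c) \<le> card I + 4 + (\<Sum>A\<in>{A. card A = 2}. card (sq_pts c A))"
proof -
  have "card (vertices c) \<le>
      card ((\<Union>i\<in>I. pts c (outstar i)) \<union> (\<Union>i. pts c (instar i)) \<union> (\<Union>A\<in>{A. card A = 2}. sq_pts c A))"
    by (rule card_mono [OF _ assms]) (auto simp: pts_tree sq_pts_card)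
  also have "\<dots> \<le> card (\<Union>i\<in>I. pts c (outstar i)) + card (\<Union>i. pts c (instar i)) +
      card (\<Union>A\<in>{A. card A = 2}. sq_pts c A)"
    by (intro order_trans [OF card_Un_le] add_mono card_Un_le order_refl)
  also have "\<dots> \<le> (\<Sum>i\<in>I. card (pts c (outstar i))) + (\<Sum>i\<in>UNIV. card (pts c (instar i))) +
      (\<Sum>A\<in>{A. card A = 2}. card (sq_pts c A))"
    by (intro add_mono card_UN_le) auto
  also have "(\<Sum>i\<in>I. card (pts c (outstar i))) \<le> card I"
    using sum_bounded_above [of I "\<lambda>i. card (pts c (outstar i))" 1] pts_tree by simp
  also have "(\<Sum>i\<in>(UNIV :: 4 set). card (pts c (instar i))) \<le> 4"
    using sum_bounded_above [of "UNIV :: 4 set" "\<lambda>i. card (pts c (instar i))" 1] pts_tree by simp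
  finally show ?thesis
    by simp
qed

lemma extreme_subset:
  assumes "triangle_ineqs c"
  shows "vertices c \<subseteq>
    (\<Union>i. pts c (outstar i)) \<union> (\<Union>i. pts c (instar i)) \<union> (\<Union>A\<in>{A. card A = 2}. sq_pts c A)"
proof
  fix y assume "y \<in> vertices c"
  then have y: "y extreme_point_of polytrope c" "y \<in> polytrope c"
    by (auto simp: extreme_point_of_def)
  obtain \<tau> where \<tau>: "tree \<tau>" "\<tau> \<subseteq> tight c y"
    by (rule extreme_contains_tree [OF assms y(1)])
  then have yt: "y \<in> pts c \<tau>"
    using y by (simp add: pts_def)
  show "y \<in> (\<Union>i. pts c (outstar i)) \<union> (\<Union>i. pts c (instar i)) \<union> (\<Union>A\<in>{A. card A = 2}. sq_pts c A)"
    using \<tau>(1)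
  proof (cases rule: tree_cases)
    case (zpath i j k l)
    then have "y \<in> sq_pts c {i, j}"
      using yt by (auto simp: sq_pts_def)
    moreover have "card {i, j} = 2"
      using zpath(1) by simp
    ultimately show ?thesis by blast
  qed (use yt in auto)
qed

text \<open>
  A vertex is determined by an outstar, an instar or a path in one of the six squares, with at
  most two vertices for each square. So $20 = 4 + 4 + 6 \cdot 2$ is an upper bound, which
  is not attained if some inequality degenerates.
\<close>

lemma maximal_generic:
  assumes "maximal_polytrope c"
  shows "generic c"
proof -
  let ?E = "vertices c"
  let ?S = "\<lambda>A. card (sq_pts c A)"
  have tri: "triangle_ineqs c" and E: "card ?E = 20"
    using assms by (auto simp: maximal_polytrope_def polytrope_region_iff numeral_eq_Suc)
  have six: "card {A :: 4 set. card A = 2} = 6"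
    using n_subsets [of "UNIV :: 4 set" 2] by (simp add: numeral_eq_Suc)
  have le12: "(\<Sum>A\<in>{A. card A = 2}. ?S A) \<le> 12"
    using sum_bounded_above [of "{A :: 4 set. card A = 2}" ?S 2] six by (simp add: sq_pts_card)
  \<comment> \<open>A tie in one square costs a vertex: 4 + 4 + 1 + 10 = 19.\<close>
  have sq: "wt c i l + wt c j k \<noteq> wt c i k + wt c j l" if d: "distinct [i, j, k, l]" for i j k l
  proof
    assume eq: "wt c i l + wt c j k = wt c i k + wt c j l"
    have "(\<Sum>A\<in>{A. card A = 2}. ?S A) = ?S {i, j} + (\<Sum>A\<in>{A. card A = 2} - {{i, j}}. ?S A)"
      using d by (intro sum.remove) auto
    also have "?S {i, j} \<le> 1"
      by (rule sq_pts_card_eq [OF d eq])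
    also have "(\<Sum>A\<in>{A. card A = 2} - {{i, j}}. ?S A) \<le> 10"
      using sum_bounded_above [of "{A :: 4 set. card A = 2} - {{i, j}}" ?S 2] six d
      by (simp add: sq_pts_card)
    finally show False
      using card_extreme_le [OF extreme_subset [OF tri]] E by simp
  qed
  \<comment> \<open>If the point of one outstar is counted elsewhere already, the bound falls to 3 +
    4 + 12 = 19.\<close>
  have out: False if "pts c (outstar i) \<subseteq> (\<Union>j\<in>- {i}. pts c (outstar j)) \<union> (\<Union>A\<in>{A. card A = 2}. sq_pts c A)" for i
  proof -
    have "?E \<subseteq> (\<Union>j\<in>- {i}. pts c (outstar j)) \<union> (\<Union>i. pts c (instar i)) \<union> (\<Union>A\<in>{A. card A = 2}. sq_pts c A)"
    proof -
      have aux: "E \<subseteq> X' \<union> Y \<union> Z" if "E \<subseteq> X \<union> Y \<union> Z" "X \<subseteq> x \<union> X'" "x \<subseteq> X' \<union> Z"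
        for E X X' Y Z x :: "(real ^ 4) set"
        using that by blast
      show ?thesis
        by (rule aux [OF extreme_subset [OF tri] _ that]) auto
    qed
    from card_extreme_le [OF this] show False
      using E le12 by (simp add: Compl_eq_Diff_UNIV)
  qed
  have outD: "y $ i - y $ j = wt c i j" if "y \<in> pts c (outstar i)" for y i j
  proof (cases "i = j")
    case False
    then have "edge i j \<in> tight c y"
      using that by (auto simp: pts_def outstar_def)
    then show ?thesis
      using False by (simp add: tight_def wt_def)
  qed simp
  have strict: "wt c i k \<noteq> wt c i j + wt c j k" if "i \<noteq> j" "j \<noteq> k" for i j k
  proof
    assume eq: "wt c i k = wt c i j + wt c j k"
    show False
    proof (cases "i = k")
      case True
      \<comment> \<open>Here c_ij + c_ji = 0. On the star at i this gives y_j - y_p = c_ip - c_ij =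
        c_ip + c_ji \<ge> c_jp, so the star at j is tight as well.\<close>
      have "pts c (outstar i) \<subseteq> pts c (outstar j)"
      proof
        fix y assume y: "y \<in> pts c (outstar i)"
        then have yP: "y \<in> polytrope c"
          by (simp add: pts_def)
        have "y $ j - y $ p = wt c j p" for p
        proof -
          have "y $ j - y $ p \<le> wt c j p"
            using yP by (simp add: polytrope_iff)
          moreover have "y $ j - y $ p = wt c i p - wt c i j"
            using outD [OF y, of p] outD [OF y, of j] by simp
          ultimately show ?thesis
            using triangleD [OF tri, of j p i] eq True by simp
        qed
        then show "y \<in> pts c (outstar j)"
          using yP by (auto simp: pts_def outstar_def tight_def)
      qed
      moreover have "pts c (outstar j) \<subseteq> (\<Union>j\<in>- {i}. pts c (outstar j))"
        using that(1) by (intro UN_upper) simp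
      ultimately show False
        using out [of i] by (meson le_supI1 subset_trans)
    next
      case False
      obtain l where "l \<notin> {i, j, k}"
        using ex_fourth by blast
      then have d: "distinct [i, j, k, l]"
        using that False by auto
      \<comment> \<open>With c_ik = c_ij + c_jk, tightness of (i,j) and (i,k) forces tightness of
        (j,k), so the point of the star also belongs to a path.\<close>
      have "pts c (outstar i) \<subseteq> sq_pts c {i, j}"
      proof
        fix y assume y: "y \<in> pts c (outstar i)"
        then have "y \<in> pts c (zpath i j k l)"
          unfolding pts_zpath_iff [OF d] using outD [OF y, of k] outD [OF y, of l] outD [OF y, of j] eq
          by (auto simp: pts_def)
        then show "y \<in> sq_pts c {i, j}"
          using d by (auto simp: sq_pts_def)
      qed
      moreover have "sq_pts c {i, j} \<subseteq> (\<Union>A\<in>{A. card A = 2}. sq_pts c A)"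
        using that by (intro UN_upper) simp
      ultimately show False
        using out [of i] by (meson le_supI2 subset_trans)
    qed
  qed
  have "c $ e + c $ f \<noteq> swap_wt c e f" if "opp e f" for e f
  proof -
    have n: "src e \<noteq> src f" "tgt e \<noteq> tgt f"
      using that by (auto simp: opp_def)
    consider "tgt e = src f" | "tgt f = src e" | "tgt e \<noteq> src f" "tgt f \<noteq> src e"
      by blast
    then show ?thesis
    proof cases
      case 1
      then show ?thesis
        using strict [of "src e" "src f" "tgt f"] n wt_src_tgt [of c e] wt_src_tgt [of c f]
        by (auto simp: swap_wt_def)
    next
      case 2
      then show ?thesis
        using strict [of "src f" "src e" "tgt e"] n wt_src_tgt [of c e] wt_src_tgt [of c f]
        by (auto simp: swap_wt_def)
    next
      case 3
      then have "distinct [src e, src f, tgt e, tgt f]"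
        using n by auto
      then show ?thesis
        using sq [of "src e" "src f" "tgt e" "tgt f"] by (simp add: swap_wt_def)
    qed
  qed
  with tri show ?thesis
    by (simp add: generic_def)
qed

lemma clique_cong:
  assumes "\<And>e f. noncrossing c e f \<longleftrightarrow> noncrossing c' e f"
  shows "clique c X \<longleftrightarrow> clique c' X"
  using assms by (simp add: clique_def)

text \<open>Both numbers of vertices count the trees that are cliques, and these agree.\<close>

lemma maximal_generic_noncrossing:
  assumes "maximal_polytrope c" "generic c'" "\<And>e f. noncrossing c e f \<longleftrightarrow> noncrossing c' e f"
  shows "maximal_polytrope c'"
proof -
  have "card {y. y extreme_point_of polytrope c'} = card {\<tau>. tree \<tau> \<and> clique c' \<tau>}"
    by (rule bij_betw_same_card [OF bij_betw_extreme_trees [OF assms(2)]])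
  also have "{\<tau>. tree \<tau> \<and> clique c' \<tau>} = {\<tau>. tree \<tau> \<and> clique c \<tau>}"
    using clique_cong [OF assms(3)] by simp
  also have "card \<dots> = card {y. y extreme_point_of polytrope c}"
    by (rule bij_betw_same_card [symmetric, OF bij_betw_extreme_trees [OF maximal_generic [OF assms(1)]]])
  finally show ?thesis
    using assms(1,2) aff_dim_generic [OF assms(2)]
    by (simp add: maximal_polytrope_def polytrope_region_iff generic_triangle)
qed

section \<open>Initial forms\<close>

definition monom_val :: "monom \<Rightarrow> real ^ offdiag \<Rightarrow> real" where
  "monom_val m a = (\<Prod>e\<in>UNIV. (a $ e) ^ Poly_Mapping.lookup m e)"

lemma eval_mpoly_superset:
  assumes "finite M" "Poly_Mapping.keys f \<subseteq> M"
  shows "eval_mpoly f a = (\<Sum>m\<in>M. Poly_Mapping.lookup f m * monom_val m a)"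
  unfolding eval_mpoly_def monom_val_def
  by (rule sum.mono_neutral_left) (use assms in \<open>auto simp: in_keys_iff\<close>)

lemma eval_mpoly_add: "eval_mpoly (f + g) a = eval_mpoly f a + eval_mpoly g a"
proof -
  let ?M = "Poly_Mapping.keys f \<union> Poly_Mapping.keys g"
  have "eval_mpoly (f + g) a = (\<Sum>m\<in>?M. Poly_Mapping.lookup (f + g) m * monom_val m a)"
    by (rule eval_mpoly_superset) (simp_all add: Poly_Mapping.keys_add)
  also have "\<dots> = (\<Sum>m\<in>?M. Poly_Mapping.lookup f m * monom_val m a) +
      (\<Sum>m\<in>?M. Poly_Mapping.lookup g m * monom_val m a)"
    by (simp add: lookup_add distrib_right sum.distrib)
  also have "\<dots> = eval_mpoly f a + eval_mpoly g a"
    by (simp add: eval_mpoly_superset [of ?M])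
  finally show ?thesis .
qed

lemma eval_mpoly_zero [simp]: "eval_mpoly 0 a = 0"
  by (simp add: eval_mpoly_def)

lemma eval_mpoly_single [simp]: "eval_mpoly (Poly_Mapping.single m k) a = k * monom_val m a"
  by (subst eval_mpoly_superset [of "{m}"]) auto

lemma eval_mpoly_sum: "eval_mpoly (\<Sum>x\<in>X. f x) a = (\<Sum>x\<in>X. eval_mpoly (f x) a)"
  by (induction X rule: infinite_finite_induct) (simp_all add: eval_mpoly_add)

lemma eval_mpoly_minus: "eval_mpoly (f - g) a = eval_mpoly f a - eval_mpoly g a"
  using eval_mpoly_add [of "f - g" g a] by simp

lemma monom_val_add: "monom_val (m + m') a = monom_val m a * monom_val m' a"
  by (simp add: monom_val_def lookup_add power_add prod.distrib)

lemma monom_val_zero [simp]: "monom_val 0 a = 1"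
  by (simp add: monom_val_def)

lemma monom_val_single [simp]: "monom_val (Poly_Mapping.single e n) a = (a $ e) ^ n"
proof -
  have "(a $ e') ^ (if e = e' then n else 0) = (if e = e' then (a $ e') ^ n else 1)" for e'
    by simp
  then show ?thesis
    by (simp add: monom_val_def lookup_single when_def)
qed

lemma mpoly_sum_monomials: "(\<Sum>m\<in>Poly_Mapping.keys f. Poly_Mapping.single m (Poly_Mapping.lookup f m)) = f"
  for f :: mpoly
  by (rule poly_mapping_eqI) (simp add: lookup_sum lookup_single when_def in_keys_iff)

lemma eval_mpoly_mult: "eval_mpoly (f * g) a = eval_mpoly f a * eval_mpoly g a"
proof -
  have "f * g = (\<Sum>m\<in>Poly_Mapping.keys f. \<Sum>m'\<in>Poly_Mapping.keys g.
      Poly_Mapping.single (m + m') (Poly_Mapping.lookup f m * Poly_Mapping.lookup g m'))"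
    by (subst (1) mpoly_sum_monomials [of f, symmetric], subst (1) mpoly_sum_monomials [of g, symmetric])
      (simp only: sum_product mult_single)
  then have "eval_mpoly (f * g) a = (\<Sum>m\<in>Poly_Mapping.keys f. \<Sum>m'\<in>Poly_Mapping.keys g.
      Poly_Mapping.lookup f m * monom_val m a * (Poly_Mapping.lookup g m' * monom_val m' a))"
    by (simp add: eval_mpoly_sum monom_val_add mult_ac)
  also have "\<dots> = eval_mpoly f a * eval_mpoly g a"
    by (simp only: eval_mpoly_superset [OF finite_keys subset_refl] sum_product)
  finally show ?thesis .
qed

lemma eval_mpoly_one [simp]: "eval_mpoly 1 a = 1"
  using eval_mpoly_single [of 0 1 a] by simp

text \<open>Induction on the variables: for fixed values of the others, grouping by the exponent of
  the new variable gives a univariate polynomial with infinitely many roots, so each group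
  vanishes.\<close>

lemma monomials_independent:
  fixes k :: "('v \<Rightarrow> nat) \<Rightarrow> real"
  assumes "finite E" "finite M" "\<And>e. infinite (S e)"
    and "\<And>m m'. m \<in> M \<Longrightarrow> m' \<in> M \<Longrightarrow> (\<And>e. e \<in> E \<Longrightarrow> m e = m' e) \<Longrightarrow> m = m'"
    and "\<And>a. (\<And>e. a e \<in> S e) \<Longrightarrow> (\<Sum>m\<in>M. k m * (\<Prod>e\<in>E. a e ^ m e)) = 0"
    and "m \<in> M"
  shows "k m = 0"
  using assms(1,2,4-)
proof (induction E arbitrary: M m rule: finite_induct)
  case empty
  have "M = {m}"
    using empty.prems by auto
  moreover have "\<exists>t. t \<in> S e" for e
    using assms(3) [of e] by (metis finite.emptyI ex_in_conv)
  then obtain a where "\<And>e. a e \<in> S e"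
    by metis
  ultimately show ?case
    using empty.prems(3) [of a] by simp
next
  case (insert x E)
  define n where "n = Max ((\<lambda>m. m x) ` M)"
  define N where "N i = {m' \<in> M. m' x = i}" for i
  have "k m = 0" if mN: "m \<in> N i" and le: "i \<le> n" for i
  proof (rule insert.IH)
    show "finite (N i)"
      using insert.prems(1) by (simp add: N_def)
    show "m1 = m2" if "m1 \<in> N i" "m2 \<in> N i" "\<And>e. e \<in> E \<Longrightarrow> m1 e = m2 e" for m1 m2
      using that by (intro insert.prems(2)) (auto simp: N_def)
    show "m \<in> N i" by (rule mN)
    show "(\<Sum>m\<in>N i. k m * (\<Prod>e\<in>E. a e ^ m e)) = 0" if a: "\<And>e. a e \<in> S e" for a
    proof -
      define c where "c j = (\<Sum>m\<in>N j. k m * (\<Prod>e\<in>E. a e ^ m e))" for j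
      have "(\<Sum>j\<le>n. c j * t ^ j) = 0" if t: "t \<in> S x" for t
      proof -
        have "(\<Sum>j\<le>n. c j * t ^ j) = (\<Sum>j\<le>n. \<Sum>m\<in>N j. k m * (t ^ m x * (\<Prod>e\<in>E. a e ^ m e)))"
          unfolding c_def sum_distrib_right by (intro sum.cong) (auto simp: N_def)
        also have "\<dots> = (\<Sum>m\<in>M. k m * (t ^ m x * (\<Prod>e\<in>E. a e ^ m e)))"
          unfolding N_def using insert.prems(1)
          by (intro sum.group) (auto simp: n_def)
        also have "\<dots> = (\<Sum>m\<in>M. k m * (\<Prod>e\<in>insert x E. (a(x := t)) e ^ m e))"
        proof (intro sum.cong refl)
          fix m
          have "(\<Prod>e\<in>E. a e ^ m e) = (\<Prod>e\<in>E. (a(x := t)) e ^ m e)"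
            using insert.hyps(2) by (intro prod.cong) auto
          then show "k m * (t ^ m x * (\<Prod>e\<in>E. a e ^ m e)) = k m * (\<Prod>e\<in>insert x E. (a(x := t)) e ^ m e)"
            using insert.hyps by simp
        qed
        also have "\<dots> = 0"
          using a t by (intro insert.prems(3)) simp
        finally show ?thesis .
      qed
      then have "S x \<subseteq> {t. (\<Sum>j\<le>n. c j * t ^ j) = 0}"
        by blast
      then have "infinite {t. (\<Sum>j\<le>n. c j * t ^ j) = 0}"
        using assms(3) finite_subset by blast
      then have "c i = 0"
        using polyfun_finite_roots [of c n] le by blast
      then show ?thesis
        by (simp add: c_def)
    qed
  qed
  moreover have "m \<in> N (m x)" "m x \<le> n"
    using insert.prems(1,4) by (auto simp: N_def n_def)
  ultimately show ?case by blast
qed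

lemma eval_mpoly_eq_zero:
  assumes "open S" "S \<noteq> {}" "\<And>a. a \<in> S \<Longrightarrow> eval_mpoly f a = 0"
  shows "f = 0"
proof -
  obtain x0 where "x0 \<in> S"
    using assms(2) by blast
  then obtain l u where lu: "x0 \<in> box l u" "box l u \<subseteq> S"
    using assms(1) open_contains_box by meson
  let ?M = "Poly_Mapping.lookup ` Poly_Mapping.keys f"
  define k where "k m = Poly_Mapping.lookup f (Poly_Mapping.Abs_poly_mapping m)" for m
  have k: "k (Poly_Mapping.lookup m) = Poly_Mapping.lookup f m" for m
    by (simp add: k_def)
  have "k (Poly_Mapping.lookup m) = 0" if "m \<in> Poly_Mapping.keys f" for m
  proof (rule monomials_independent [where E = UNIV and M = ?M and S = "\<lambda>e. {l $ e <..< u $ e}"])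
    show "infinite {l $ e<..<u $ e}" for e
    proof -
      have "l $ e < x0 $ e" "x0 $ e < u $ e"
        using lu(1) by (auto simp: mem_box_cart)
      then show ?thesis
        by (intro infinite_Ioo) simp
    qed
    show "(\<Sum>m\<in>?M. k m * (\<Prod>e\<in>UNIV. a e ^ m e)) = 0" if a: "\<And>e. a e \<in> {l $ e<..<u $ e}" for a
    proof -
      have "(\<chi> e. a e) \<in> box l u"
        using a by (simp add: mem_box_cart)
      then have "eval_mpoly f (\<chi> e. a e) = 0"
        using lu(2) assms(3) by blast
      moreover have "inj_on Poly_Mapping.lookup (Poly_Mapping.keys f)"
        by (metis inj_onI poly_mapping.lookup_inject)
      ultimately show ?thesis
        by (simp add: eval_mpoly_def sum.reindex k)
    qed
  qed (use that in auto)
  then show ?thesis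
    by (metis k not_in_keys_iff_lookup_eq_zero poly_mapping_eqI lookup_zero)
qed

section \<open>Zeros of the ideal on the torus and their limits\<close>

interpretation mpoly_module: module "(*) :: mpoly \<Rightarrow> mpoly \<Rightarrow> mpoly"
  by unfold_locales (simp_all add: algebra_simps)

lemma ideal_generated_vanish:
  assumes "\<And>f. f \<in> B \<Longrightarrow> eval_mpoly f a = 0" "f \<in> ideal_generated B"
  shows "eval_mpoly f a = 0"
proof -
  have "module.span (*) B \<subseteq> {f. eval_mpoly f a = 0}"
    using assms(1) by (intro mpoly_module.span_minimal mpoly_module.subspaceI)
      (auto simp: eval_mpoly_add eval_mpoly_mult)
  then show ?thesis
    using assms(2) by (auto simp: ideal_generated_def)
qed

lemma eval_var: "i \<noteq> j \<Longrightarrow> eval_mpoly (var i j) a = a $ edge i j"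
  by (simp add: var_def edge_def)

text \<open>The points x_ij = t_i / t_j with t_i = exp v_i > 0, at which all generators of the ideal
  vanish. The logarithmic parametrization turns monomials into exponentials of linear forms.\<close>

definition torus_pt :: "real ^ 4 \<Rightarrow> real ^ offdiag" where
  "torus_pt v = (\<chi> e. exp (v $ src e - v $ tgt e))"

lemma polytrope_ideal_torus:
  assumes "f \<in> polytrope_ideal"
  shows "eval_mpoly f (torus_pt v) = 0"
  by (rule ideal_generated_vanish [OF _ assms [unfolded polytrope_ideal_def]])
    (auto simp: eval_mpoly_minus eval_mpoly_mult eval_var torus_pt_def simp flip: exp_add)

lemma monom_val_torus_pt:
  "monom_val m (torus_pt v) = exp (\<Sum>e\<in>UNIV. (v $ src e - v $ tgt e) * real (Poly_Mapping.lookup m e))"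
  by (simp add: monom_val_def torus_pt_def exp_sum mult.commute flip: exp_of_nat_mult)

definition max_weight_keys :: "real ^ offdiag \<Rightarrow> mpoly \<Rightarrow> monom set" where
  "max_weight_keys c f =
     {m \<in> Poly_Mapping.keys f. \<forall>m'\<in>Poly_Mapping.keys f. weight c m' \<le> weight c m}"

lemma initial_form_eq:
  "initial_form c f = (\<Sum>m\<in>max_weight_keys c f. Poly_Mapping.single m (Poly_Mapping.lookup f m))"
  by (simp add: initial_form_def max_weight_keys_def)

lemma finite_max_weight_keys [simp]: "finite (max_weight_keys c f)"
  by (simp add: max_weight_keys_def)

lemma lookup_initial_form:
  "Poly_Mapping.lookup (initial_form c f) m = (if m \<in> max_weight_keys c f then Poly_Mapping.lookup f m else 0)"
  by (simp add: initial_form_eq lookup_sum lookup_single when_def)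

lemma keys_initial_form: "Poly_Mapping.keys (initial_form c f) = max_weight_keys c f"
proof -
  have "m \<in> max_weight_keys c f \<Longrightarrow> Poly_Mapping.lookup f m \<noteq> 0" for m
    by (simp add: max_weight_keys_def in_keys_iff)
  then show ?thesis
    by (auto simp: in_keys_iff [where s = "initial_form c f"] lookup_initial_form split: if_splits)
qed

definition limit_pt :: "real ^ offdiag \<Rightarrow> real ^ 4 \<Rightarrow> real ^ 4 \<Rightarrow> real ^ offdiag" where
  "limit_pt c y u = (\<chi> e. if e \<in> tight c y then exp (u $ src e - u $ tgt e) else 0)"

text \<open>
  A point \<open>y\<close> of the polytrope gives the curve with coordinates
  \<open>exp (L (y_i - y_j) + u_i - u_j)\<close> on the torus. Rescaled by \<open>exp (- L c_ij)\<close>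
  it tends to \<^const>\<open>limit_pt\<close> as \<open>L\<close> grows, and only the terms of maximal weight survive.
\<close>

lemma initial_form_limit_pt:
  assumes f: "f \<in> polytrope_ideal" and y: "y \<in> polytrope c"
  shows "eval_mpoly (initial_form c f) (limit_pt c y u) = 0"
proof (cases "f = 0")
  case True
  then show ?thesis by (simp add: initial_form_def)
next
  case False
  let ?K = "Poly_Mapping.keys f"
  define W where "W = Max (weight c ` ?K)"
  have "weight c ` ?K \<noteq> {}"
    using False by simp
  have W: "weight c m \<le> W" if "m \<in> ?K" for m
    unfolding W_def using that by (intro Max_ge) auto
  have maxW: "m \<in> max_weight_keys c f \<longleftrightarrow> weight c m = W" if "m \<in> ?K" for m
  proof
    assume "m \<in> max_weight_keys c f"
    then have "W \<le> weight c m"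
      using False unfolding W_def by (intro Max.boundedI) (auto simp: max_weight_keys_def)
    then show "weight c m = W"
      using W [OF that] by simp
  next
    assume "weight c m = W"
    then show "m \<in> max_weight_keys c f"
      using W that by (simp add: max_weight_keys_def)
  qed
  define g where "g v m = (\<Sum>e\<in>UNIV. (v $ src e - v $ tgt e) * real (Poly_Mapping.lookup m e))" for v :: "real ^ 4" and m :: monom
  have g_lin: "g (L *\<^sub>R y + u) m = L * g y m + g u m" for L m
    unfolding g_def sum_distrib_left sum.distrib [symmetric]
    by (rule sum.cong) (simp_all add: algebra_simps)
  \<comment> \<open>\<open>g y m\<close> is the growth rate of the monomial along the curve. It
    equals the weight minus the slacks of the variables of m, counted with multiplicity.\<close>
  have g_le: "g y m \<le> weight c m" for m
    unfolding g_def weight_def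
    by (intro sum_mono mult_right_mono) (use y in \<open>auto simp: polytrope_def\<close>)
  have g_eq: "g y m = weight c m \<longleftrightarrow> Poly_Mapping.keys m \<subseteq> tight c y" for m
  proof -
    define h where "h e = (c $ e - (y $ src e - y $ tgt e)) * real (Poly_Mapping.lookup m e)" for e
    have "weight c m - g y m = (\<Sum>e\<in>UNIV. h e)"
      by (simp add: weight_def g_def h_def sum_subtractf left_diff_distrib)
    moreover have "h e \<ge> 0" for e
      using y by (simp add: h_def polytrope_def)
    ultimately have "g y m = weight c m \<longleftrightarrow> (\<forall>e. h e = 0)"
      using sum_nonneg_eq_0_iff [of UNIV h] by auto
    moreover have "h e = 0 \<longleftrightarrow> (e \<in> Poly_Mapping.keys m \<longrightarrow> e \<in> tight c y)" for e
      by (auto simp: h_def tight_def in_keys_iff)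
    ultimately show ?thesis
      by (simp add: subset_iff)
  qed
  have lim: "((\<lambda>L. Poly_Mapping.lookup f m * exp (L * (g y m - W) + g u m)) \<longlongrightarrow>
      (if m \<in> max_weight_keys c f then Poly_Mapping.lookup f m * monom_val m (limit_pt c y u) else 0)) at_top"
    if m: "m \<in> ?K" for m
  proof (cases "g y m = W")
    case True
    then have w: "weight c m = W" "g y m = weight c m"
      using g_le [of m] W [OF m] by auto
    then have sub: "Poly_Mapping.keys m \<subseteq> tight c y"
      using g_eq [of m] w by simp
    have "monom_val m (limit_pt c y u) = (\<Prod>e\<in>UNIV. exp (u $ src e - u $ tgt e) ^ Poly_Mapping.lookup m e)"
    proof -
      have "e \<in> tight c y \<or> Poly_Mapping.lookup m e = 0" for e
        using sub by (auto simp: in_keys_iff subset_iff)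
      then have "(limit_pt c y u $ e) ^ Poly_Mapping.lookup m e =
          exp (u $ src e - u $ tgt e) ^ Poly_Mapping.lookup m e" for e
        by (cases "e \<in> tight c y") (auto simp: limit_pt_def dest: meta_spec [of _ e])
      then show ?thesis
        by (simp add: monom_val_def)
    qed
    also have "\<dots> = exp (g u m)"
      using monom_val_torus_pt [of m u] by (simp add: monom_val_def torus_pt_def g_def)
    finally show ?thesis
      using True w maxW [OF m] by simp
  next
    case False
    then have less: "g y m - W < 0"
      using g_le [of m] W [OF m] by simp
    \<comment> \<open>A term of maximal weight whose rate is below W contains a variable with
      positive slack, and there the limit point has coordinate 0.\<close>
    have "(if m \<in> max_weight_keys c f then Poly_Mapping.lookup f m * monom_val m (limit_pt c y u) else 0) = 0"
    proof (cases "m \<in> max_weight_keys c f")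
      case True
      then have "\<not> Poly_Mapping.keys m \<subseteq> tight c y"
        using False maxW [OF m] g_eq [of m] by simp
      then obtain e where "e \<in> Poly_Mapping.keys m" "e \<notin> tight c y"
        by blast
      then have "monom_val m (limit_pt c y u) = 0"
        unfolding monom_val_def by (intro prod_zero) (auto simp: limit_pt_def in_keys_iff intro!: exI [of _ e])
      then show ?thesis by simp
    qed simp
    moreover have "((\<lambda>L. Poly_Mapping.lookup f m * exp (L * (g y m - W) + g u m)) \<longlongrightarrow> 0) at_top"
      using less by (intro tendsto_mult_right_zero) real_asymp
    ultimately show ?thesis
      by (simp only:)
  qed
  \<comment> \<open>The common factor exp (- L W) multiplies the whole sum, which therefore stays a
    multiple of the value of f on the torus.\<close>
  have "(\<Sum>m\<in>?K. Poly_Mapping.lookup f m * exp (L * (g y m - W) + g u m)) = 0" for L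
  proof -
    have "(\<Sum>m\<in>?K. Poly_Mapping.lookup f m * exp (L * (g y m - W) + g u m)) =
        exp (- L * W) * eval_mpoly f (torus_pt (L *\<^sub>R y + u))"
      unfolding eval_mpoly_superset [OF finite_keys subset_refl] monom_val_torus_pt sum_distrib_left
        g_def [symmetric] g_lin
      by (rule sum.cong) (simp_all add: algebra_simps flip: exp_add)
    then show ?thesis
      by (simp add: polytrope_ideal_torus [OF f])
  qed
  moreover have "((\<lambda>L. \<Sum>m\<in>?K. Poly_Mapping.lookup f m * exp (L * (g y m - W) + g u m)) \<longlongrightarrow>
      (\<Sum>m\<in>?K. if m \<in> max_weight_keys c f then Poly_Mapping.lookup f m * monom_val m (limit_pt c y u) else 0)) at_top"
    using lim by (rule tendsto_sum)
  ultimately have "(\<Sum>m\<in>?K. if m \<in> max_weight_keys c f then Poly_Mapping.lookup f m * monom_val m (limit_pt c y u) else 0) = 0"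
    by (simp add: tendsto_const_iff)
  moreover have "eval_mpoly (initial_form c f) (limit_pt c y u) =
      (\<Sum>m\<in>?K. if m \<in> max_weight_keys c f then Poly_Mapping.lookup f m * monom_val m (limit_pt c y u) else 0)"
    by (subst eval_mpoly_superset [of ?K]) (auto simp: keys_initial_form lookup_initial_form max_weight_keys_def intro!: sum.cong)
  ultimately show ?thesis by simp
qed

section \<open>Initial ideals and tropical types\<close>

text \<open>
  On a tree of tight edges the coordinates of a limit point are arbitrary positive numbers, which
  separates the monomials supported on the tree.
\<close>

lemma initial_form_keys_not_clique:
  assumes c: "generic c" and f: "f \<in> polytrope_ideal" and m: "m \<in> Poly_Mapping.keys (initial_form c f)"
  shows "\<not> clique c (Poly_Mapping.keys m)"
proof
  assume "clique c (Poly_Mapping.keys m)"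
  then obtain \<tau> where \<tau>: "tree \<tau>" "clique c \<tau>" "Poly_Mapping.keys m \<subseteq> \<tau>"
    by (rule clique_tree [OF c])
  obtain y where y: "y \<in> polytrope c" "\<tau> \<subseteq> tight c y"
    by (rule tree_feasible [OF generic_triangle [OF c] \<tau>(1,2)])
  have ty: "tight c y = \<tau>"
    by (rule tight_tree_eq [OF c y(1) \<tau>(1) y(2)])
  define g where "g = initial_form c f"
  \<comment> \<open>The part of the initial form supported on the tree. All other terms vanish at
    limit points, whose coordinates off the tree are 0, while on the tree the coordinates can be
    made equal to those of any positive a.\<close>
  define h where "h = (\<Sum>m\<in>{m \<in> Poly_Mapping.keys g. Poly_Mapping.keys m \<subseteq> \<tau>}.
      Poly_Mapping.single m (Poly_Mapping.lookup g m))"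
  have "h = 0"
  proof (rule eval_mpoly_eq_zero)
    show "open {a :: real ^ offdiag. \<forall>e. 0 < a $ e}"
    proof -
      have "open (\<Inter>e\<in>UNIV. {a :: real ^ offdiag. 0 < a $ e})"
        by (intro open_INT ballI open_Collect_less continuous_intros) simp
      then show ?thesis
        by (simp add: Collect_all_eq)
    qed
    show "{a :: real ^ offdiag. \<forall>e. 0 < a $ e} \<noteq> {}"
      by (auto intro!: exI [of _ 1])
    fix a :: "real ^ offdiag" assume a: "a \<in> {a. \<forall>e. 0 < a $ e}"
    obtain u :: "real ^ 4" where u: "\<And>e. e \<in> \<tau> \<Longrightarrow> u $ src e - u $ tgt e = ln (a $ e)"
      using tree_free [OF \<tau>(1), of "\<lambda>e. ln (a $ e)"] by metis
    have z: "limit_pt c y u $ e = (if e \<in> \<tau> then a $ e else 0)" for e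
      using a by (simp add: limit_pt_def ty u)
    have mv: "monom_val m (limit_pt c y u) = (if Poly_Mapping.keys m \<subseteq> \<tau> then monom_val m a else 0)" for m
    proof (cases "Poly_Mapping.keys m \<subseteq> \<tau>")
      case True
      then have "e \<in> \<tau> \<or> Poly_Mapping.lookup m e = 0" for e
        by (auto simp: in_keys_iff subset_iff)
      then have "(limit_pt c y u $ e) ^ Poly_Mapping.lookup m e = (a $ e) ^ Poly_Mapping.lookup m e" for e
        by (cases "e \<in> \<tau>") (auto simp: z dest: meta_spec [of _ e])
      then show ?thesis
        using True by (simp add: monom_val_def)
    next
      case False
      then obtain e where "e \<in> Poly_Mapping.keys m" "e \<notin> \<tau>"
        by blast
      then have "monom_val m (limit_pt c y u) = 0"
        unfolding monom_val_def by (intro prod_zero) (auto simp: z in_keys_iff intro!: exI [of _ e])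
      then show ?thesis
        using False by simp
    qed
    have "eval_mpoly h a = (\<Sum>m\<in>{m \<in> Poly_Mapping.keys g. Poly_Mapping.keys m \<subseteq> \<tau>}.
        Poly_Mapping.lookup g m * monom_val m a)"
      by (simp add: h_def eval_mpoly_sum)
    also have "\<dots> = (\<Sum>m\<in>Poly_Mapping.keys g. Poly_Mapping.lookup g m * monom_val m (limit_pt c y u))"
      by (rule sum.mono_neutral_cong_left) (auto simp: mv)
    also have "\<dots> = eval_mpoly g (limit_pt c y u)"
      by (simp add: eval_mpoly_superset [OF finite_keys subset_refl])
    also have "\<dots> = 0"
      unfolding g_def by (rule initial_form_limit_pt [OF f y(1)])
    finally show "eval_mpoly h a = 0" .
  qed
  moreover have "Poly_Mapping.lookup h m = Poly_Mapping.lookup g m"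
    using \<tau>(3) by (simp add: h_def lookup_sum lookup_single when_def in_keys_iff)
  ultimately show False
    using m by (simp add: g_def in_keys_iff)
qed

text \<open>Reading x_ii as 1 matches the zero diagonal of \<open>wt\<close>, so that the binomials
  x_ij x_kl - x_il x_kj include both kinds of generators.\<close>

definition xmonom :: "4 \<Rightarrow> 4 \<Rightarrow> monom" where
  "xmonom i j = (if i = j then 0 else Poly_Mapping.single (edge i j) 1)"

abbreviation mono_poly :: "monom \<Rightarrow> mpoly" where
  "mono_poly m \<equiv> Poly_Mapping.single m 1"

lemma mono_xmonom: "mono_poly (xmonom i j) = (if i = j then 1 else var i j)"
  by (simp add: xmonom_def var_def edge_def)

lemma mono_add: "mono_poly (m + m') = mono_poly m * mono_poly m'"
  by (simp add: mult_single)

lemma mult_diff_mult_diff: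
  fixes p q :: "'a :: comm_ring"
  shows "p * (q * r - s) - q * (p * r - t) = t * q - p * s"
  by (simp add: algebra_simps)

lemma swap_binomial_mem:
  assumes "i \<noteq> j" "k \<noteq> l" "i \<noteq> k" "j \<noteq> l"
  shows "mono_poly (xmonom i j + xmonom k l) - mono_poly (xmonom i l + xmonom k j) \<in> polytrope_ideal"
proof -
  have inverse: "var i j * var j i - 1 \<in> polytrope_ideal" if "i \<noteq> j" for i j
    unfolding polytrope_ideal_def ideal_generated_def
    by (rule mpoly_module.span_base, rule UnI1, rule CollectI, rule exI [of _ i], rule exI [of _ j])
      (simp add: that)
  have path: "var i j * var j k - var i k \<in> polytrope_ideal" if "i \<noteq> j" "j \<noteq> k" "i \<noteq> k" for i j k
    unfolding polytrope_ideal_def ideal_generated_def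
    by (rule mpoly_module.span_base, rule UnI2, rule CollectI, rule exI [of _ i], rule exI [of _ j],
        rule exI [of _ k]) (simp add: that)
  consider "i = l" "k = j" | "i = l" "k \<noteq> j" | "i \<noteq> l" "k = j" | "i \<noteq> l" "k \<noteq> j"
    by blast
  then show ?thesis
  proof cases
    case 1
    then show ?thesis
      using inverse [of i j] assms unfolding mono_add mono_xmonom by simp
  next
    case 2
    then show ?thesis
      using path [of k l j] assms unfolding mono_add mono_xmonom by (simp add: mult.commute)
  next
    case 3
    then show ?thesis
      using path [of i j l] assms unfolding mono_add mono_xmonom by simp
  next
    case 4
    \<comment> \<open>The monomial x_il x_kl x_lj contracts in two ways, to x_il x_kj and to x_kl
      x_ij; the difference of the two contractions is the swap binomial.\<close>
    have "var k l * var l j - var k j \<in> polytrope_ideal" "var i l * var l j - var i j \<in> polytrope_ideal"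
      using 4 assms by (auto intro!: path)
    then have "var i l * (var k l * var l j - var k j) \<in> polytrope_ideal"
      "var k l * (var i l * var l j - var i j) \<in> polytrope_ideal"
      unfolding polytrope_ideal_def ideal_generated_def
      by (auto intro: mpoly_module.span_scale)
    then have "var i l * (var k l * var l j - var k j) - var k l * (var i l * var l j - var i j) \<in> polytrope_ideal"
      unfolding polytrope_ideal_def ideal_generated_def by (rule mpoly_module.span_diff)
    also have "var i l * (var k l * var l j - var k j) - var k l * (var i l * var l j - var i j) =
        var i j * var k l - var i l * var k j"
      by (rule mult_diff_mult_diff)
    finally show ?thesis
      using 4 assms unfolding mono_add mono_xmonom by simp
  qed
qed

lemma weight_xmonom: "weight c (xmonom i j + xmonom k l) = wt c i j + wt c k l"
  by (auto simp: weight_def xmonom_def wt_def lookup_add lookup_single when_def distrib_left sum.distrib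
      if_distrib [of real] if_distrib [of "(*) _"] cong: if_cong)

lemma initial_form_binomial:
  assumes "weight c m' < weight c m"
  shows "initial_form c (mono_poly m - mono_poly m') = mono_poly m"
proof -
  have ne: "m \<noteq> m'"
    using assms by auto
  then have k: "Poly_Mapping.keys (mono_poly m - mono_poly m') = {m, m'}"
    by (auto simp: in_keys_iff lookup_minus lookup_single when_def split: if_splits)
  then have "max_weight_keys c (mono_poly m - mono_poly m') = {m}"
    using assms by (auto simp: max_weight_keys_def)
  then show ?thesis
    using ne by (simp add: initial_form_eq lookup_minus lookup_single)
qed

lemma not_noncrossing_less:
  assumes "generic c" "\<not> noncrossing c e f"
  shows "opp e f" "swap_wt c e f < c $ e + c $ f"
  using assms genericD [OF assms(1), of e f] by (auto simp: noncrossing_def)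

text \<open>A crossing pair in the support is the initial term of its swap binomial, and its product
  divides the monomial.\<close>

lemma mono_not_clique_mem:
  assumes c: "generic c" and m: "\<not> clique c (Poly_Mapping.keys m)"
  shows "mono_poly m \<in> initial_ideal c polytrope_ideal"
proof -
  obtain e f where ef: "e \<in> Poly_Mapping.keys m" "f \<in> Poly_Mapping.keys m" "\<not> noncrossing c e f"
    using m by (auto simp: clique_def)
  note opp = not_noncrossing_less [OF c ef(3)]
  let ?q = "xmonom (src e) (tgt e) + xmonom (src f) (tgt f)"
  let ?q' = "xmonom (src e) (tgt f) + xmonom (src f) (tgt e)"
  have "mono_poly ?q = initial_form c (mono_poly ?q - mono_poly ?q')"
    using opp(2) by (intro initial_form_binomial [symmetric]) (simp add: weight_xmonom swap_wt_def)
  moreover have "mono_poly ?q - mono_poly ?q' \<in> polytrope_ideal"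
    by (rule swap_binomial_mem) (use opp(1) in \<open>auto simp: opp_def\<close>)
  ultimately have "mono_poly ?q \<in> initial_ideal c polytrope_ideal"
    unfolding initial_ideal_def ideal_generated_def by (auto intro!: mpoly_module.span_base)
  moreover have "m = (m - ?q) + ?q"
  proof (rule poly_mapping_eqI)
    fix x
    \<comment> \<open>Opposite edges are distinct, so each occurs in the product with exponent
      one.\<close>
    have "Poly_Mapping.lookup ?q x \<le> Poly_Mapping.lookup m x"
      using ef(1,2) opp(1) by (auto simp: xmonom_def lookup_add lookup_single when_def in_keys_iff opp_def)
    then show "Poly_Mapping.lookup m x = Poly_Mapping.lookup (m - ?q + ?q) x"
      by (simp add: lookup_add lookup_minus)
  qed
  then have "mono_poly m = mono_poly (m - ?q) * mono_poly ?q"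
    by (metis mono_add)
  ultimately show ?thesis
    unfolding initial_ideal_def ideal_generated_def
    by (simp add: mpoly_module.span_scale)
qed

text \<open>Swap binomials give one inclusion. For the other, every term of an initial form already
  has a support that is not a clique, so no division with remainder is involved.\<close>

lemma initial_ideal_eq:
  assumes c: "generic c"
  shows "initial_ideal c polytrope_ideal = ideal_generated (mono_poly ` {m. \<not> clique c (Poly_Mapping.keys m)})"
proof
  let ?N = "mono_poly ` {m. \<not> clique c (Poly_Mapping.keys m)}"
  show "ideal_generated ?N \<subseteq> initial_ideal c polytrope_ideal"
    using mono_not_clique_mem [OF c] unfolding ideal_generated_def initial_ideal_def
    by (intro mpoly_module.span_minimal mpoly_module.subspace_span) auto
  have "initial_form c f \<in> ideal_generated ?N" if f: "f \<in> polytrope_ideal" for f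
  proof -
    let ?g = "initial_form c f"
    have "(\<Sum>m\<in>Poly_Mapping.keys ?g. Poly_Mapping.single 0 (Poly_Mapping.lookup ?g m) * mono_poly m) \<in> ideal_generated ?N"
      unfolding ideal_generated_def
      by (intro mpoly_module.span_sum mpoly_module.span_scale mpoly_module.span_base imageI)
        (use initial_form_keys_not_clique [OF c f] in blast)
    also have "(\<Sum>m\<in>Poly_Mapping.keys ?g. Poly_Mapping.single 0 (Poly_Mapping.lookup ?g m) * mono_poly m) = ?g"
      by (simp add: mult_single mpoly_sum_monomials)
    finally show ?thesis .
  qed
  then show "initial_ideal c polytrope_ideal \<subseteq> ideal_generated ?N"
    unfolding initial_ideal_def ideal_generated_def
    by (intro mpoly_module.span_minimal mpoly_module.subspace_span) auto
qed

lemma initial_ideal_cong: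
  assumes "generic c" "generic c'" "\<And>e f. noncrossing c e f \<longleftrightarrow> noncrossing c' e f"
  shows "initial_ideal c polytrope_ideal = initial_ideal c' polytrope_ideal"
  unfolding initial_ideal_eq [OF assms(1)] initial_ideal_eq [OF assms(2)]
  using clique_cong [OF assms(3)] by simp

text \<open>If e and f are noncrossing for c, some point of the polytrope has both tight. Its limit
  point is a zero of the initial ideal of c at which x_e x_f takes the value 1, so this monomial
  cannot lie in the ideal.\<close>

lemma initial_ideal_noncrossing:
  assumes c: "generic c" "generic c'"
    and eq: "initial_ideal c polytrope_ideal = initial_ideal c' polytrope_ideal"
    and ef: "noncrossing c e f"
  shows "noncrossing c' e f"
proof (rule ccontr)
  assume no: "\<not> noncrossing c' e f"
  let ?m = "Poly_Mapping.single e 1 + Poly_Mapping.single f (1 :: nat)"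
  have keys: "Poly_Mapping.keys ?m = {e, f}"
    by (auto simp: in_keys_iff lookup_add lookup_single when_def split: if_splits)
  have "mono_poly ?m \<in> initial_ideal c' polytrope_ideal"
    by (rule mono_not_clique_mem [OF c(2)]) (use no in \<open>unfold clique_def keys, blast\<close>)
  then have mem: "mono_poly ?m \<in> initial_ideal c polytrope_ideal"
    by (simp add: eq)
  have "clique c {e, f}"
    using ef noncrossing_sym [of c e f] by (simp add: clique_def)
  then obtain \<tau> where \<tau>: "tree \<tau>" "clique c \<tau>" "{e, f} \<subseteq> \<tau>"
    by (rule clique_tree [OF c(1)])
  obtain y where y: "y \<in> polytrope c" "\<tau> \<subseteq> tight c y"
    by (rule tree_feasible [OF generic_triangle [OF c(1)] \<tau>(1,2)])
  have "eval_mpoly (mono_poly ?m) (limit_pt c y 0) = 0"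
    using initial_form_limit_pt [OF _ y(1)]
    by (intro ideal_generated_vanish [OF _ mem [unfolded initial_ideal_def]]) auto
  moreover have "e \<in> tight c y" "f \<in> tight c y"
    using \<tau>(3) y(2) by auto
  ultimately show False
    by (simp add: monom_val_add limit_pt_def)
qed

section \<open>Tropical types as open conditions on the weights\<close>

lemma same_tropical_type_iff:
  assumes "maximal_polytrope c"
  shows "same_tropical_type c c' \<longleftrightarrow> generic c' \<and> (\<forall>e f. noncrossing c e f \<longleftrightarrow> noncrossing c' e f)"
proof -
  have c: "generic c"
    using assms by (rule maximal_generic)
  show ?thesis
  proof
    assume same: "same_tropical_type c c'"
    then have c': "generic c'"
      by (simp add: same_tropical_type_def maximal_generic)
    have eq: "initial_ideal c polytrope_ideal = initial_ideal c' polytrope_ideal"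
      using same by (simp add: same_tropical_type_def)
    show "generic c' \<and> (\<forall>e f. noncrossing c e f \<longleftrightarrow> noncrossing c' e f)"
      using initial_ideal_noncrossing [OF c c' eq] initial_ideal_noncrossing [OF c' c eq [symmetric]] c' by blast
  next
    assume "generic c' \<and> (\<forall>e f. noncrossing c e f \<longleftrightarrow> noncrossing c' e f)"
    then have c': "generic c'" and comp: "\<And>e f. noncrossing c e f \<longleftrightarrow> noncrossing c' e f"
      by auto
    show "same_tropical_type c c'"
      unfolding same_tropical_type_def
      using assms maximal_generic_noncrossing [OF assms c' comp] initial_ideal_cong [OF c c' comp] by blast
  qed
qed

lemma open_same_type:
  assumes c: "generic c"
  obtains S where "open S" "c \<in> S" "\<And>c'. c' \<in> S \<Longrightarrow> generic c' \<and> (\<forall>e f. noncrossing c e f \<longleftrightarrow> noncrossing c' e f)"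
proof -
  define D where "D c e f = swap_wt c e f - (c $ e + c $ f)" for c :: "real ^ offdiag" and e f
  define S where "S = (\<Inter>p\<in>{(e, f). opp e f}. case p of (e, f) \<Rightarrow>
      if noncrossing c e f then {c'. 0 < D c' e f} else {c'. D c' e f < 0})"
  have "continuous_on UNIV (\<lambda>c'. wt c' i j)" for i j
    by (cases "i = j") (auto simp: wt_def intro!: continuous_intros)
  then have "continuous_on UNIV (\<lambda>c'. D c' e f)" for e f
    unfolding D_def swap_wt_def by (intro continuous_intros) auto
  then have "open S"
    unfolding S_def by (intro open_INT) (auto intro!: open_Collect_less continuous_intros)
  moreover have "c \<in> S"
    using not_noncrossing_less [OF c] by (force simp: S_def D_def noncrossing_def)
  moreover have "generic c' \<and> (\<forall>e f. noncrossing c e f \<longleftrightarrow> noncrossing c' e f)" if S: "c' \<in> S" for c'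
  proof -
    have S': "if noncrossing c e f then 0 < D c' e f else D c' e f < 0" if "opp e f" for e f
      using S that by (force simp: S_def split: if_splits)
    have comp: "noncrossing c e f \<longleftrightarrow> noncrossing c' e f" for e f
      using S' [of e f] by (auto simp: noncrossing_def D_def split: if_splits)
    \<comment> \<open>The path from i over j to k crosses at c. Its strict inequality is inherited
      by c' and is the triangle inequality there.\<close>
    have "wt c' i k \<le> wt c' i j + wt c' j k" for i j k
    proof (cases "i = j \<or> j = k")
      case False
      then have opp: "opp (edge i j) (edge j k)"
        by (auto simp: opp_def)
      have "\<not> noncrossing c (edge i j) (edge j k)"
        using noncrossing_no_path [OF generic_triangle [OF c], of "edge i j" "edge j k"] False by auto
      then have "D c' (edge i j) (edge j k) < 0"
        using S' [OF opp] by simp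
      then show ?thesis
        using False by (simp add: D_def swap_wt_def) (simp add: wt_def)
    qed auto
    then have "generic c'"
      using S' by (fastforce simp: generic_def triangle_ineqs_def D_def split: if_splits)
    with comp show ?thesis by blast
  qed
  ultimately show thesis ..
qed

lemma volume_polynomial_eqI:
  assumes c: "maximal_polytrope c"
    and F: "\<And>c'. generic c' \<Longrightarrow> (\<forall>e f. noncrossing c e f \<longleftrightarrow> noncrossing c' e f) \<Longrightarrow> eval_mpoly F c' = fact 3 * polytrope_volume c'"
  shows "volume_polynomial c = F"
  unfolding volume_polynomial_def
proof (rule the_equality)
  show "is_volume_polynomial c F"
    using F by (simp add: is_volume_polynomial_def same_tropical_type_iff [OF c])
  fix G assume G: "is_volume_polynomial c G"
  obtain S where S: "open S" "c \<in> S" "\<And>c'. c' \<in> S \<Longrightarrow> generic c' \<and> (\<forall>e f. noncrossing c e f \<longleftrightarrow> noncrossing c' e f)"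
    using open_same_type [OF maximal_generic [OF c]] by metis
  have "G - F = 0"
  proof (rule eval_mpoly_eq_zero [OF S(1)])
    fix a assume "a \<in> S"
    then have a: "generic a" "\<forall>e f. noncrossing c e f \<longleftrightarrow> noncrossing a e f"
      using S(3) by auto
    then have "same_tropical_type c a"
      by (simp add: same_tropical_type_iff [OF c])
    then show "eval_mpoly (G - F) a = 0"
      using G F [OF a] by (simp add: is_volume_polynomial_def eval_mpoly_minus)
  qed (use S(2) in auto)
  then show "G = F" by simp
qed

section \<open>Volumes of corners\<close>

text \<open>Reorders coordinates so that the one to be sliced comes first. Permuting coordinates
  preserves Lebesgue measure, so one integral serves all corners of the same kind.\<close>

definition coord3 :: "3 \<Rightarrow> 3 \<Rightarrow> 3 \<Rightarrow> real \<times> real \<times> real \<Rightarrow> real ^ 3" where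
  "coord3 i j k = (\<lambda>(x, y, z). \<chi> p. if p = i then x else if p = j then y else z)"

lemma distinct_cases_3:
  fixes i j k :: 3
  assumes "distinct [i, j, k]"
  shows "UNIV = {i, j, k}"
proof -
  have "card {i, j, k} = card (UNIV :: 3 set)"
    using assms by simp
  then show ?thesis
    using card_subset_eq [OF finite subset_UNIV, of "{i, j, k}"] by simp
qed

lemma coord3_nth [simp]:
  assumes "distinct [i, j, k]"
  shows "coord3 i j k (x, y, z) $ i = x" "coord3 i j k (x, y, z) $ j = y" "coord3 i j k (x, y, z) $ k = z"
  using assms by (auto simp: coord3_def)

lemma forall_distinct_3:
  fixes i j k :: 3
  assumes "distinct [i, j, k]"
  shows "(\<forall>p. P p) \<longleftrightarrow> P i \<and> P j \<and> P k"
proof -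
  have "(\<forall>p\<in>{i, j, k}. P p) \<longleftrightarrow> P i \<and> P j \<and> P k"
    by blast
  then show ?thesis
    unfolding distinct_cases_3 [OF assms, symmetric] by simp
qed

lemma continuous_coord3: "continuous_on UNIV (coord3 i j k)"
proof -
  have "continuous_on UNIV (\<lambda>w. coord3 i j k w $ p)" for p
    by (cases "p = i"; cases "p = j") (auto simp: coord3_def split_def intro!: continuous_intros)
  then have "continuous_on UNIV (\<lambda>w. \<chi> p. coord3 i j k w $ p)"
    by (rule continuous_on_vec_lambda)
  then show ?thesis by simp
qed

lemma prod_Basis_vec:
  fixes f :: "real ^ 'n \<Rightarrow> real"
  shows "(\<Prod>b\<in>(Basis :: (real ^ 'n) set). f b) = (\<Prod>i\<in>UNIV. f (axis i 1))"
proof -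
  have B: "(Basis :: (real ^ 'n) set) = range (\<lambda>i. axis i 1)"
    by (auto simp: Basis_vec_def)
  have "inj (\<lambda>i. axis i 1 :: real ^ 'n)"
    by (auto simp: inj_def axis_eq_axis)
  then show ?thesis
    unfolding B by (subst prod.reindex) (simp_all add: o_def)
qed

lemma emeasure_Times_lborel:
  assumes "A \<in> sets borel" "B \<in> sets borel"
  shows "emeasure lborel (A \<times> B) = emeasure lborel (A :: real set) * emeasure lborel (B :: ('a :: euclidean_space) set)"
  using assms by (subst lborel_prod [symmetric]) (simp add: lborel.emeasure_pair_measure_Times)

lemma lborel_coord3:
  assumes d: "distinct [i, j, k]"
  shows "lborel = distr lborel borel (coord3 i j k)"
proof (rule lborel_eqI)
  fix l u :: "real ^ 3"
  assume le: "\<And>b. b \<in> Basis \<Longrightarrow> l \<bullet> b \<le> u \<bullet> b"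
  have le': "l $ p \<le> u $ p" for p
    using le [of "axis p 1"] by (simp add: inner_axis axis_in_Basis_iff)
  have "coord3 i j k -` box l u = {l $ i<..<u $ i} \<times> {l $ j<..<u $ j} \<times> {l $ k<..<u $ k}"
    using d by (auto simp: mem_box_cart forall_distinct_3 [OF d])
  then have "emeasure (distr lborel borel (coord3 i j k)) (box l u) =
      emeasure (lborel \<Otimes>\<^sub>M (lborel \<Otimes>\<^sub>M lborel)) ({l $ i<..<u $ i} \<times> {l $ j<..<u $ j} \<times> {l $ k<..<u $ k})"
    using borel_measurable_continuous_onI [OF continuous_coord3 [of i j k]]
    by (subst emeasure_distr) (auto simp: lborel_prod)
  also have "\<dots> = ennreal ((u $ i - l $ i) * ((u $ j - l $ j) * (u $ k - l $ k)))"
  proof -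
    have "{l $ j<..<u $ j} \<times> {l $ k<..<u $ k} \<in> sets borel"
      by (intro borel_open open_Times) auto
    then show ?thesis
      using le' by (simp add: lborel_prod emeasure_Times_lborel ennreal_mult)
  qed
  also have "(u $ i - l $ i) * ((u $ j - l $ j) * (u $ k - l $ k)) = (\<Prod>b\<in>Basis. (u - l) \<bullet> b)"
    using d by (simp add: prod_Basis_vec inner_axis distinct_cases_3 [OF d])
  finally show "emeasure (distr lborel borel (coord3 i j k)) (box l u) = (\<Prod>b\<in>Basis. (u - l) \<bullet> b)" .
qed simp

lemma emeasure_coord3:
  assumes "distinct [i, j, k]" "S \<in> sets borel"
  shows "emeasure lborel S = emeasure lborel (coord3 i j k -` S)"
proof -
  have "emeasure lborel S = emeasure (distr lborel borel (coord3 i j k)) S"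
    using lborel_coord3 [OF assms(1)] by simp
  also have "\<dots> = emeasure lborel (coord3 i j k -` S)"
    using borel_measurable_continuous_onI [OF continuous_coord3 [of i j k]] assms(2)
    by (subst emeasure_distr) auto
  finally show ?thesis .
qed

section \<open>Integration by slices\<close>

lemma emeasure_slices:
  fixes S :: "(real \<times> 'a :: euclidean_space) set"
  assumes S: "S \<in> sets borel" and "p \<le> q"
    and slice: "\<And>x. x \<in> {p..q} \<Longrightarrow> emeasure lborel {w. (x, w) \<in> S} = ennreal (g x)"
    and empty: "\<And>x w. (x, w) \<in> S \<Longrightarrow> x \<in> {p..q}"
    and F: "\<And>x. DERIV F x :> g x" and g: "g \<in> borel_measurable borel" "\<And>x. x \<in> {p..q} \<Longrightarrow> 0 \<le> g x"
  shows "emeasure lborel S = ennreal (F q - F p)"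
proof -
  have "emeasure lborel S = emeasure (lborel \<Otimes>\<^sub>M lborel) S"
    by (simp add: lborel_prod)
  also have "\<dots> = (\<integral>\<^sup>+x. emeasure lborel (Pair x -` S) \<partial>lborel)"
    by (intro lborel.emeasure_pair_measure_alt) (use S in \<open>simp only: lborel_prod sets_lborel\<close>)
  also have "\<dots> = (\<integral>\<^sup>+x. ennreal (g x) * indicator {p..q} x \<partial>lborel)"
  proof (rule nn_integral_cong)
    fix x
    have "Pair x -` S = {w. (x, w) \<in> S}"
      by auto
    moreover have "{w. (x, w) \<in> S} = {}" if "x \<notin> {p..q}"
      using empty that by blast
    ultimately show "emeasure lborel (Pair x -` S) = ennreal (g x) * indicator {p..q} x"
      using slice [of x] by (cases "x \<in> {p..q}") auto
  qed
  also have "\<dots> = ennreal (F q - F p)"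
    using assms by (intro nn_integral_FTC_Icc) auto
  finally show ?thesis .
qed

lemma emeasure_corner_triangle:
  fixes u b d :: real
  assumes "d \<le> u + b"
  shows "emeasure lborel {(x, y). x \<le> u \<and> - b \<le> y \<and> y < x - d} = ennreal ((u + b - d)\<^sup>2 / 2)"
proof -
  let ?S = "{(x, y). x \<le> u \<and> - b \<le> y \<and> y < x - d}"
  have "emeasure lborel ?S = ennreal ((u + b - d)\<^sup>2 / 2 - ((d - b) + b - d)\<^sup>2 / 2)"
  proof (rule emeasure_slices [where p = "d - b" and q = u and g = "\<lambda>x. x + b - d" and F = "\<lambda>x. (x + b - d)\<^sup>2 / 2"])
    have "?S = {w. fst w \<le> u} \<inter> {w. - b \<le> snd w} \<inter> {w. snd w < fst w - d}"
      by auto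
    also have "\<dots> \<in> sets borel"
      by (intro sets.Int borel_closed borel_open closed_Collect_le open_Collect_less continuous_intros)
    finally show "?S \<in> sets borel" .
    fix x assume x: "x \<in> {d - b..u}"
    then have "{w. (x, w) \<in> ?S} = {- b..<x - d}"
      by auto
    then show "emeasure lborel {w. (x, w) \<in> ?S} = ennreal (x + b - d)"
      using x by (simp add: algebra_simps)
  qed (use assms in \<open>auto intro!: derivative_eq_intros\<close>)
  then show ?thesis by simp
qed

text \<open>The integral of (A - t) (B - t) over t from 0 to min A B: the slices are rectangles
  whose sides shrink at equal speed until the shorter one vanishes.\<close>

definition corner_vol :: "real \<Rightarrow> real \<Rightarrow> real" where
  "corner_vol A B = (min A B)\<^sup>2 * max A B / 2 - (min A B) ^ 3 / 6"

lemma corner_vol_nonneg: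
  assumes "0 \<le> A" "0 \<le> B"
  shows "0 \<le> corner_vol A B"
proof -
  have "(min A B)\<^sup>2 * min A B \<le> (min A B)\<^sup>2 * max A B"
    by (intro mult_left_mono) auto
  moreover have "0 \<le> (min A B) ^ 3"
    using assms by simp
  ultimately show ?thesis
    by (simp add: corner_vol_def power2_eq_square power3_eq_cube)
qed

lemma emeasure_source_corner:
  fixes u b b' d d' :: real
  assumes "d \<le> u + b" "d' \<le> u + b'"
  shows "emeasure lborel {(x, y, z). x \<le> u \<and> - b \<le> y \<and> y < x - d \<and> - b' \<le> z \<and> z < x - d'} =
    ennreal (corner_vol (u + b - d) (u + b' - d'))"
proof -
  let ?S = "{(x, y, z). x \<le> u \<and> - b \<le> y \<and> y < x - d \<and> - b' \<le> z \<and> z < x - d'}"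
  let ?F = "\<lambda>x. x ^ 3 / 3 + (b - d + (b' - d')) * x\<^sup>2 / 2 + (b - d) * (b' - d') * x"
  \<comment> \<open>At this value of x the shorter side of the rectangular slice becomes
    zero.\<close>
  let ?p = "max (d - b) (d' - b')"
  have "emeasure lborel ?S = ennreal (?F u - ?F ?p)"
  proof (rule emeasure_slices [where p = ?p and q = u and F = ?F and g = "\<lambda>x. (x + b - d) * (x + b' - d')"])
    have "?S = {w. fst w \<le> u} \<inter> {w. - b \<le> fst (snd w)} \<inter> {w. fst (snd w) < fst w - d} \<inter>
        {w. - b' \<le> snd (snd w)} \<inter> {w. snd (snd w) < fst w - d'}"
      by auto
    also have "\<dots> \<in> sets borel"
      by (intro sets.Int borel_closed borel_open closed_Collect_le open_Collect_less continuous_intros)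
    finally show "?S \<in> sets borel" .
    fix x assume x: "x \<in> {?p..u}"
    then have eq: "{w. (x, w) \<in> ?S} = {- b..<x - d} \<times> {- b'..<x - d'}"
      by auto
    show "emeasure lborel {w. (x, w) \<in> ?S} = ennreal ((x + b - d) * (x + b' - d'))"
    proof -
      have "emeasure lborel {- b..<x - d} = ennreal (x + b - d)"
        "emeasure lborel {- b'..<x - d'} = ennreal (x + b' - d')"
        using x by (simp_all add: algebra_simps)
      moreover have "0 \<le> x + b - d" "0 \<le> x + b' - d'"
        using x by auto
      ultimately show ?thesis
        using eq by (simp add: emeasure_Times_lborel ennreal_mult del: emeasure_lborel_Ico)
    qed
  next
    show "DERIV ?F x :> (x + b - d) * (x + b' - d')" for x
      by (auto intro!: derivative_eq_intros simp: power2_eq_square field_simps)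
  qed (use assms in \<open>auto intro!: mult_nonneg_nonneg\<close>)
  also have "?F u - ?F ?p = corner_vol (u + b - d) (u + b' - d')"
  proof (cases "d - b \<le> d' - b'")
    case True
    then have "?p = d' - b'" "min (u + b - d) (u + b' - d') = u + b' - d'" "max (u + b - d) (u + b' - d') = u + b - d"
      by auto
    then show ?thesis
      by (simp add: corner_vol_def power2_eq_square power3_eq_cube field_simps)
  next
    case False
    then have "?p = d - b" "min (u + b - d) (u + b' - d') = u + b - d" "max (u + b - d) (u + b' - d') = u + b' - d'"
      by auto
    then show ?thesis
      by (simp add: corner_vol_def power2_eq_square power3_eq_cube field_simps)
  qed
  finally show ?thesis .
qed

text \<open>The mirror image of the source corner: the shared coordinate enters with the opposite
  sign, so the rectangles shrink as it grows.\<close>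

lemma emeasure_sink_corner:
  fixes b u u' d d' :: real
  assumes "d \<le> u + b" "d' \<le> u' + b"
  shows "emeasure lborel {(x, y, z). - b \<le> x \<and> y \<le> u \<and> d + x < y \<and> z \<le> u' \<and> d' + x < z} =
    ennreal (corner_vol (u + b - d) (u' + b - d'))"
proof -
  let ?S = "{(x, y, z). - b \<le> x \<and> y \<le> u \<and> d + x < y \<and> z \<le> u' \<and> d' + x < z}"
  let ?F = "\<lambda>x. x ^ 3 / 3 - (u - d + (u' - d')) * x\<^sup>2 / 2 + (u - d) * (u' - d') * x"
  let ?q = "min (u - d) (u' - d')"
  have "emeasure lborel ?S = ennreal (?F ?q - ?F (- b))"
  proof (rule emeasure_slices [where p = "- b" and q = ?q and F = ?F and g = "\<lambda>x. (u - d - x) * (u' - d' - x)"])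
    have "?S = {w. - b \<le> fst w} \<inter> {w. fst (snd w) \<le> u} \<inter> {w. d + fst w < fst (snd w)} \<inter>
        {w. snd (snd w) \<le> u'} \<inter> {w. d' + fst w < snd (snd w)}"
      by auto
    also have "\<dots> \<in> sets borel"
      by (intro sets.Int borel_closed borel_open closed_Collect_le open_Collect_less continuous_intros)
    finally show "?S \<in> sets borel" .
    fix x assume x: "x \<in> {- b..?q}"
    then have eq: "{w. (x, w) \<in> ?S} = {d + x<..u} \<times> {d' + x<..u'}"
      by auto
    show "emeasure lborel {w. (x, w) \<in> ?S} = ennreal ((u - d - x) * (u' - d' - x))"
    proof -
      have "emeasure lborel {d + x<..u} = ennreal (u - d - x)"
        "emeasure lborel {d' + x<..u'} = ennreal (u' - d' - x)"
        using x by (simp_all add: algebra_simps)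
      moreover have "0 \<le> u - d - x" "0 \<le> u' - d' - x"
        using x by auto
      ultimately show ?thesis
        using eq by (simp add: emeasure_Times_lborel ennreal_mult del: emeasure_lborel_Ioc)
    qed
  next
    show "DERIV ?F x :> (u - d - x) * (u' - d' - x)" for x
      by (auto intro!: derivative_eq_intros simp: power2_eq_square field_simps)
  qed (use assms in \<open>auto intro!: mult_nonneg_nonneg\<close>)
  also have "?F ?q - ?F (- b) = corner_vol (u + b - d) (u' + b - d')"
  proof (cases "u' - d' \<le> u - d")
    case True
    then have "?q = u' - d'" "min (u + b - d) (u' + b - d') = u' + b - d'" "max (u + b - d) (u' + b - d') = u + b - d"
      by auto
    then show ?thesis
      by (simp add: corner_vol_def power2_eq_square power3_eq_cube field_simps)
  next
    case False
    then have "?q = u - d" "min (u + b - d) (u' + b - d') = u + b - d" "max (u + b - d) (u' + b - d') = u' + b - d'"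
      by auto
    then show ?thesis
      by (simp add: corner_vol_def power2_eq_square power3_eq_cube field_simps)
  qed
  finally show ?thesis .
qed

section \<open>Volume of the polytrope\<close>

text \<open>A nonempty strict order on three elements has one relation, or two with a common source
  or sink, or is a chain with three relations and one pair of each kind. In every case 1 minus the
  relations plus these pairs is 0.\<close>

lemma violation_count:
  assumes "\<not> (p12 \<and> p21)" "\<not> (p13 \<and> p31)" "\<not> (p23 \<and> p32)"
    and "p12 \<and> p23 \<longrightarrow> p13" "p13 \<and> p32 \<longrightarrow> p12" "p21 \<and> p13 \<longrightarrow> p23"
    and "p23 \<and> p31 \<longrightarrow> p21" "p31 \<and> p12 \<longrightarrow> p32" "p32 \<and> p21 \<longrightarrow> p31"
  shows "of_bool (\<not> p12 \<and> \<not> p21 \<and> \<not> p13 \<and> \<not> p31 \<and> \<not> p23 \<and> \<not> p32) =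
    (1 :: real) - (of_bool p12 + of_bool p21 + of_bool p13 + of_bool p31 + of_bool p23 + of_bool p32) +
    (of_bool (p12 \<and> p13) + of_bool (p21 \<and> p23) + of_bool (p31 \<and> p32)) +
    (of_bool (p21 \<and> p31) + of_bool (p12 \<and> p32) + of_bool (p13 \<and> p23))"
  by (insert assms, cases p12; cases p21; cases p13; cases p31; cases p23; cases p32;
      simp only: simp_thms of_bool_eq; simp?)

text \<open>The assumptions are triangle inequalities, those with u and b passing through vertex 4.
  By \<open>upper\<close> and \<open>lower\<close>, a point that violates the cut i, j satisfies v_i
  \<ge> - b_i and v_j \<le> u_j automatically, so only two faces of the box bound the violated piece
  in these coordinates. By \<open>cut\<close> the side lengths are nonnegative.\<close>

locale box_cuts =
  fixes u b :: "3 \<Rightarrow> real" and d :: "3 \<Rightarrow> 3 \<Rightarrow> real"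
  assumes d_refl: "d i i = 0"
    and d_trans: "d i k \<le> d i j + d j k"
    and cut: "d i j \<le> u i + b j"
    and upper: "u i \<le> d i j + u j"
    and lower: "b j \<le> b i + d i j"
begin

definition box_set :: "(real ^ 3) set" where
  "box_set = cbox (\<chi> i. - b i) (\<chi> i. u i)"

definition viol :: "3 \<Rightarrow> 3 \<Rightarrow> (real ^ 3) set" where
  "viol i j = {v \<in> box_set. d i j < v $ i - v $ j}"

definition body :: "(real ^ 3) set" where
  "body = {v \<in> box_set. \<forall>i j. v $ i - v $ j \<le> d i j}"

lemma mem_box_set: "v \<in> box_set \<longleftrightarrow> (\<forall>i. - b i \<le> v $ i \<and> v $ i \<le> u i)"
  by (simp add: box_set_def mem_box_cart)

lemma box_nonneg: "0 \<le> u i + b i"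
  using cut [of i i] by (simp add: d_refl)

lemma viol_borel [measurable]: "viol i j \<in> sets borel"
proof -
  have "viol i j = box_set \<inter> {v. d i j < v $ i - v $ j}"
    by (auto simp: viol_def)
  also have "\<dots> \<in> sets borel"
    unfolding box_set_def
    by (intro sets.Int borel_closed closed_cbox borel_open open_Collect_less continuous_intros)
  finally show ?thesis .
qed

lemma viol_subset: "viol i j \<subseteq> box_set"
  by (auto simp: viol_def)

lemma measure_viol:
  assumes ijk: "distinct [i, j, k]"
  shows "measure lborel (viol i j) = (u i + b j - d i j)\<^sup>2 / 2 * (u k + b k)"
proof -
  have kij: "distinct [k, i, j]"
    using ijk by auto
  let ?T = "{(x, y). x \<le> u i \<and> - b j \<le> y \<and> y < x - d i j}"
  have "coord3 k i j -` viol i j = {- b k..u k} \<times> ?T"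
  proof (intro set_eqI)
    fix w :: "real \<times> real \<times> real"
    obtain z x y where w: "w = (z, x, y)"
      by (cases w) auto
    show "w \<in> coord3 k i j -` viol i j \<longleftrightarrow> w \<in> {- b k..u k} \<times> ?T"
      using kij upper [of i j] lower [of j i]
      by (auto simp: w viol_def mem_box_set forall_distinct_3 [OF kij])
  qed
  moreover have "?T \<in> sets borel"
  proof -
    have "?T = {w. fst w \<le> u i} \<inter> {w. - b j \<le> snd w} \<inter> {w. snd w < fst w - d i j}"
      by auto
    also have "\<dots> \<in> sets borel"
      by (intro sets.Int borel_closed borel_open closed_Collect_le open_Collect_less continuous_intros)
    finally show ?thesis .
  qed
  ultimately have "emeasure lborel (viol i j) = ennreal (u k + b k) * ennreal ((u i + b j - d i j)\<^sup>2 / 2)"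
    using emeasure_coord3 [OF kij viol_borel [of i j]] box_nonneg [of k] emeasure_corner_triangle [OF cut [of i j]]
    by (simp add: emeasure_Times_lborel)
  also have "\<dots> = ennreal ((u i + b j - d i j)\<^sup>2 / 2 * (u k + b k))"
    using box_nonneg [of k] by (simp add: mult.commute flip: ennreal_mult)
  finally show ?thesis
    using box_nonneg [of k] by (simp add: measure_def)
qed

lemma measure_source:
  assumes ijk: "distinct [i, j, k]"
  shows "measure lborel (viol i j \<inter> viol i k) = corner_vol (u i + b j - d i j) (u i + b k - d i k)"
proof -
  have "coord3 i j k -` (viol i j \<inter> viol i k) =
      {(x, y, z). x \<le> u i \<and> - b j \<le> y \<and> y < x - d i j \<and> - b k \<le> z \<and> z < x - d i k}"
  proof (intro set_eqI)
    fix w :: "real \<times> real \<times> real"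
    obtain x y z where w: "w = (x, y, z)"
      by (cases w) auto
    show "w \<in> coord3 i j k -` (viol i j \<inter> viol i k) \<longleftrightarrow>
        w \<in> {(x, y, z). x \<le> u i \<and> - b j \<le> y \<and> y < x - d i j \<and> - b k \<le> z \<and> z < x - d i k}"
      using ijk upper [of i j] upper [of i k] lower [of j i] lower [of k i]
      by (auto simp: w viol_def mem_box_set forall_distinct_3 [OF ijk])
  qed
  then have "emeasure lborel (viol i j \<inter> viol i k) = ennreal (corner_vol (u i + b j - d i j) (u i + b k - d i k))"
    using emeasure_coord3 [OF ijk, of "viol i j \<inter> viol i k"] emeasure_source_corner [OF cut [of i j] cut [of i k]]
    by simp
  moreover have "0 \<le> corner_vol (u i + b j - d i j) (u i + b k - d i k)"
    using cut [of i j] cut [of i k] by (intro corner_vol_nonneg) auto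
  ultimately show ?thesis
    by (simp add: measure_def)
qed

lemma measure_sink:
  assumes ijk: "distinct [i, j, k]"
  shows "measure lborel (viol j i \<inter> viol k i) = corner_vol (u j + b i - d j i) (u k + b i - d k i)"
proof -
  have "coord3 i j k -` (viol j i \<inter> viol k i) =
      {(x, y, z). - b i \<le> x \<and> y \<le> u j \<and> d j i + x < y \<and> z \<le> u k \<and> d k i + x < z}"
  proof (intro set_eqI)
    fix w :: "real \<times> real \<times> real"
    obtain x y z where w: "w = (x, y, z)"
      by (cases w) auto
    show "w \<in> coord3 i j k -` (viol j i \<inter> viol k i) \<longleftrightarrow>
        w \<in> {(x, y, z). - b i \<le> x \<and> y \<le> u j \<and> d j i + x < y \<and> z \<le> u k \<and> d k i + x < z}"
      using ijk upper [of j i] upper [of k i] lower [of i j] lower [of i k]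
      by (auto simp: w viol_def mem_box_set forall_distinct_3 [OF ijk])
  qed
  then have "emeasure lborel (viol j i \<inter> viol k i) = ennreal (corner_vol (u j + b i - d j i) (u k + b i - d k i))"
    using emeasure_coord3 [OF ijk, of "viol j i \<inter> viol k i"] emeasure_sink_corner [OF cut [of j i] cut [of k i]]
    by simp
  moreover have "0 \<le> corner_vol (u j + b i - d j i) (u k + b i - d k i)"
    using cut [of j i] cut [of k i] by (intro corner_vol_nonneg) auto
  ultimately show ?thesis
    by (simp add: measure_def)
qed

lemma measure_box: "measure lborel box_set = (\<Prod>i\<in>UNIV. u i + b i)"
proof -
  have "box_set \<noteq> {}"
    using box_nonneg by (auto simp: box_set_def interval_eq_empty_cart not_less) (smt (verit))
  then show ?thesis
    by (simp add: box_set_def content_cbox_cart)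
qed

lemma body_borel: "body \<in> sets borel"
proof -
  have "v \<in> body \<longleftrightarrow> v \<in> box_set \<and> (\<forall>i j. v \<notin> viol i j)" for v
    by (cases "v \<in> box_set") (auto simp: body_def viol_def not_less)
  then have "body = box_set - (\<Union>i. \<Union>j. viol i j)"
    by (intro set_eqI) simp
  also have "\<dots> \<in> sets borel"
    by (intro sets.Diff sets.finite_UN) (auto simp: box_set_def)
  finally show ?thesis .
qed

lemma viol_trans: "v \<in> viol i j \<Longrightarrow> v \<in> viol j k \<Longrightarrow> v \<in> viol i k"
  using d_trans [of i k j] by (auto simp: viol_def)

lemma viol_asym: "v \<in> viol i j \<Longrightarrow> v \<notin> viol j i"
  using d_trans [of i i j] by (auto simp: viol_def d_refl)

lemma indicator_body:
  "indicator body v = (indicator box_set v :: real) -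
    (indicator (viol 1 2) v + indicator (viol 2 1) v + indicator (viol 1 3) v + indicator (viol 3 1) v +
     indicator (viol 2 3) v + indicator (viol 3 2) v) +
    (indicator (viol 1 2 \<inter> viol 1 3) v + indicator (viol 2 1 \<inter> viol 2 3) v + indicator (viol 3 1 \<inter> viol 3 2) v) +
    (indicator (viol 2 1 \<inter> viol 3 1) v + indicator (viol 1 2 \<inter> viol 3 2) v + indicator (viol 1 3 \<inter> viol 2 3) v)"
proof (cases "v \<in> box_set")
  case False
  then show ?thesis
    by (simp add: body_def viol_def indicator_def)
next
  case True
  let ?p = "\<lambda>i j. v \<in> viol i j"
  have asym: "\<not> (?p i j \<and> ?p j i)" for i j
    using viol_asym [of v i j] by simp
  have trans: "?p i j \<and> ?p j k \<longrightarrow> ?p i k" for i j k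
    using viol_trans [of v i j k] by simp
  have "v \<in> body \<longleftrightarrow> (\<forall>i j. \<not> ?p i j)"
    using True by (auto simp: body_def viol_def not_less)
  also have "\<dots> \<longleftrightarrow> \<not> ?p 1 2 \<and> \<not> ?p 2 1 \<and> \<not> ?p 1 3 \<and> \<not> ?p 3 1 \<and> \<not> ?p 2 3 \<and> \<not> ?p 3 2"
    using viol_asym [of v 1 1] viol_asym [of v 2 2] viol_asym [of v 3 3] by (auto simp: forall_3)
  finally have "indicator body v = of_bool (\<not> ?p 1 2 \<and> \<not> ?p 2 1 \<and> \<not> ?p 1 3 \<and> \<not> ?p 3 1 \<and> \<not> ?p 2 3 \<and> \<not> ?p 3 2)"
    by (simp add: indicator_def)
  also have "\<dots> = (1 :: real) - (of_bool (?p 1 2) + of_bool (?p 2 1) + of_bool (?p 1 3) + of_bool (?p 3 1) +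
        of_bool (?p 2 3) + of_bool (?p 3 2)) +
      (of_bool (?p 1 2 \<and> ?p 1 3) + of_bool (?p 2 1 \<and> ?p 2 3) + of_bool (?p 3 1 \<and> ?p 3 2)) +
      (of_bool (?p 2 1 \<and> ?p 3 1) + of_bool (?p 1 2 \<and> ?p 3 2) + of_bool (?p 1 3 \<and> ?p 2 3))"
    by (rule violation_count) (rule asym trans)+
  finally show ?thesis
    using True by (simp add: indicator_def)
qed

lemma measure_body:
  "measure lborel body = (u 1 + b 1) * (u 2 + b 2) * (u 3 + b 3) -
    ((u 1 + b 2 - d 1 2)\<^sup>2 / 2 * (u 3 + b 3) + (u 2 + b 1 - d 2 1)\<^sup>2 / 2 * (u 3 + b 3) +
     (u 1 + b 3 - d 1 3)\<^sup>2 / 2 * (u 2 + b 2) + (u 3 + b 1 - d 3 1)\<^sup>2 / 2 * (u 2 + b 2) +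
     (u 2 + b 3 - d 2 3)\<^sup>2 / 2 * (u 1 + b 1) + (u 3 + b 2 - d 3 2)\<^sup>2 / 2 * (u 1 + b 1)) +
    (corner_vol (u 1 + b 2 - d 1 2) (u 1 + b 3 - d 1 3) + corner_vol (u 2 + b 1 - d 2 1) (u 2 + b 3 - d 2 3) +
     corner_vol (u 3 + b 1 - d 3 1) (u 3 + b 2 - d 3 2)) +
    (corner_vol (u 2 + b 1 - d 2 1) (u 3 + b 1 - d 3 1) + corner_vol (u 1 + b 2 - d 1 2) (u 3 + b 2 - d 3 2) +
     corner_vol (u 1 + b 3 - d 1 3) (u 2 + b 3 - d 2 3))"
proof -
  have int: "integrable lborel (indicator S :: real ^ 3 \<Rightarrow> real)" if "S \<in> sets borel" "S \<subseteq> box_set" for S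
  proof (rule integrable_real_indicator)
    have "bounded S"
      using that(2) bounded_cbox bounded_subset unfolding box_set_def by blast
    then show "emeasure lborel S < \<infinity>"
      by (rule emeasure_bounded_finite)
  qed (use that in simp)
  have iv: "integrable lborel (indicator (viol i j) :: real ^ 3 \<Rightarrow> real)"
    "integrable lborel (indicator (viol i j \<inter> viol k l) :: real ^ 3 \<Rightarrow> real)" for i j k l
    by (intro int sets.Int viol_borel le_infI1 viol_subset)+
  have ib: "integrable lborel (indicator box_set :: real ^ 3 \<Rightarrow> real)"
    by (intro int) (auto simp: box_set_def)
  have box: "measure lborel box_set = (u 1 + b 1) * (u 2 + b 2) * (u 3 + b 3)"
    unfolding measure_box UNIV_3 by simp
  have ds: "distinct [1, 2, 3 :: 3]" "distinct [1, 3, 2 :: 3]" "distinct [2, 1, 3 :: 3]"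
    "distinct [2, 3, 1 :: 3]" "distinct [3, 1, 2 :: 3]" "distinct [3, 2, 1 :: 3]"
    by simp_all
  have m: "integral\<^sup>L lborel (indicator S :: real ^ 3 \<Rightarrow> real) = measure lborel S" for S
    by simp
  have "measure lborel body = (\<integral>v. indicator body v \<partial>lborel)"
    by simp
  also have "\<dots> = measure lborel box_set -
    (measure lborel (viol 1 2) + measure lborel (viol 2 1) + measure lborel (viol 1 3) + measure lborel (viol 3 1) +
     measure lborel (viol 2 3) + measure lborel (viol 3 2)) +
    (measure lborel (viol 1 2 \<inter> viol 1 3) + measure lborel (viol 2 1 \<inter> viol 2 3) + measure lborel (viol 3 1 \<inter> viol 3 2)) +
    (measure lborel (viol 2 1 \<inter> viol 3 1) + measure lborel (viol 1 2 \<inter> viol 3 2) + measure lborel (viol 1 3 \<inter> viol 2 3))"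
    unfolding indicator_body using iv ib
    by (simp only: m Bochner_Integration.integral_add Bochner_Integration.integral_diff
        Bochner_Integration.integrable_add Bochner_Integration.integrable_diff)
  finally show ?thesis
    by (simp only: box measure_viol [OF ds(1)] measure_viol [OF ds(3)] measure_viol [OF ds(2)]
        measure_viol [OF ds(5)] measure_viol [OF ds(4)] measure_viol [OF ds(6)] measure_source [OF ds(1)]
        measure_source [OF ds(3)] measure_source [OF ds(5)] measure_sink [OF ds(1)] measure_sink [OF ds(3)]
        measure_sink [OF ds(5)])
qed

end

section \<open>The volume as a formula in the weights\<close>

definition low :: "3 \<Rightarrow> 4" where
  "low i = (if i = 1 then 1 else if i = 2 then 2 else 3)"

lemma low_simps [simp]: "low 1 = 1" "low 2 = 2" "low 3 = 3"
  by (simp_all add: low_def)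

lemma polytrope_volume_eq:
  assumes tri: "triangle_ineqs c"
  shows "polytrope_volume c =
    (let w = wt c;
         A = (\<lambda>i j. w i 4 + w 4 j - w i j)
     in (w 1 4 + w 4 1) * (w 2 4 + w 4 2) * (w 3 4 + w 4 3) -
       ((A 1 2)\<^sup>2 / 2 * (w 3 4 + w 4 3) + (A 2 1)\<^sup>2 / 2 * (w 3 4 + w 4 3) +
        (A 1 3)\<^sup>2 / 2 * (w 2 4 + w 4 2) + (A 3 1)\<^sup>2 / 2 * (w 2 4 + w 4 2) +
        (A 2 3)\<^sup>2 / 2 * (w 1 4 + w 4 1) + (A 3 2)\<^sup>2 / 2 * (w 1 4 + w 4 1)) +
       (corner_vol (A 1 2) (A 1 3) + corner_vol (A 2 1) (A 2 3) + corner_vol (A 3 1) (A 3 2)) +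
       (corner_vol (A 2 1) (A 3 1) + corner_vol (A 1 2) (A 3 2) + corner_vol (A 1 3) (A 2 3)))"
proof -
  interpret box_cuts "\<lambda>i. wt c (low i) 4" "\<lambda>i. wt c 4 (low i)" "\<lambda>i j. wt c (low i) (low j)"
    by unfold_locales (simp, (rule triangleD [OF tri])+)
  let ?f = "\<lambda>y :: real ^ 4. vector [y $ 1, y $ 2, y $ 3] :: real ^ 3"
  have f: "?f y $ i = y $ low i" for y i
    using exhaust_3 [of i] by (auto simp: vector_3)
  have "?f ` polytrope c = body"
  proof
    show "?f ` polytrope c \<subseteq> body"
    proof safe
      fix y assume y: "y \<in> polytrope c"
      have le: "y $ i - y $ j \<le> wt c i j" for i j
        using y by (simp add: polytrope_iff)
      have "y $ 4 = 0"
        using y by (simp add: polytrope_iff)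
      then have "- wt c 4 (low i) \<le> y $ low i \<and> y $ low i \<le> wt c (low i) 4" for i
        using le [of 4 "low i"] le [of "low i" 4] by simp
      then show "?f y \<in> body"
        by (simp add: body_def mem_box_set f le)
    qed
    show "body \<subseteq> ?f ` polytrope c"
    proof
      fix v assume v: "v \<in> body"
      define y :: "real ^ 4" where "y = vector [v $ 1, v $ 2, v $ 3, 0]"
      have y: "y $ 1 = v $ 1" "y $ 2 = v $ 2" "y $ 3 = v $ 3" "y $ 4 = 0"
        by (simp_all add: y_def vector_def)
      have box: "- wt c 4 (low i) \<le> v $ i" "v $ i \<le> wt c (low i) 4"
        and diff: "v $ i - v $ j \<le> wt c (low i) (low j)" for i j
        using v by (auto simp: body_def mem_box_set)
      have "\<forall>i j. y $ i - y $ j \<le> wt c i j"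
        unfolding forall_4 y
        using box [of 1] box [of 2] box [of 3] diff [of 1 2] diff [of 2 1] diff [of 1 3] diff [of 3 1]
          diff [of 2 3] diff [of 3 2] by simp
      then have "y \<in> polytrope c"
        by (simp add: polytrope_iff y)
      moreover have "v = ?f y"
        by (simp add: vec_eq_iff forall_3 y vector_3)
      ultimately show "v \<in> ?f ` polytrope c"
        by blast
    qed
  qed
  then have "polytrope_volume c = measure lborel body"
    using body_borel by (simp add: polytrope_volume_def)
  then show ?thesis
    by (simp add: measure_body Let_def)
qed

section \<open>The central subdivision\<close>

lemma root_vec_inner: "u \<bullet> root_vec e = u $ src e - u $ tgt e"
  by (simp add: root_vec_def inner_diff_right inner_axis)

lemma root_vec_nth: "root_vec e $ i = (if i = src e then 1 else if i = tgt e then -1 else 0)"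
  by (auto simp: root_vec_def axis_def)

lemma root_vec_inj: "root_vec e = root_vec f \<longleftrightarrow> e = f"
proof
  assume eq: "root_vec e = root_vec f"
  have "root_vec e $ src f = 1" "root_vec e $ tgt f = -1"
    unfolding eq by (simp_all add: root_vec_nth)
  then have "src e = src f" "tgt e = tgt f"
    by (auto simp: root_vec_nth split: if_splits)
  then show "e = f"
    by (simp add: offdiag_eq_iff)
qed simp

lemma inj_root_vec: "inj root_vec"
  by (simp add: inj_def root_vec_inj)

lemma root_vec_neq_0 [simp]: "root_vec e \<noteq> 0"
proof
  assume "root_vec e = 0"
  then have "root_vec e $ src e = 0"
    by simp
  then show False
    by (simp add: root_vec_nth)
qed

text \<open>Each dual vector reads off one coefficient of a linear relation. An indexed family is
  used so that roots of a tree and their lifts are both covered.\<close>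

lemma affine_independent_dual:
  fixes r :: "'i \<Rightarrow> 'v :: euclidean_space"
  assumes "finite I" and dual: "\<And>i. i \<in> I \<Longrightarrow> \<exists>u. \<forall>j\<in>I. u \<bullet> r j = (if j = i then 1 else 0)"
  shows "\<not> affine_dependent (insert 0 (r ` I))"
proof -
  have "independent (r ` I)"
  proof (rule real_vector.independent_if_scalars_zero)
    fix a x assume sum: "(\<Sum>v\<in>r ` I. a v *\<^sub>R v) = 0" and "x \<in> r ` I"
    then obtain i where i: "i \<in> I" "x = r i"
      by blast
    obtain u where u: "\<And>j. j \<in> I \<Longrightarrow> u \<bullet> r j = (if j = i then 1 else 0)"
      using dual [OF i(1)] by blast
    have inner: "u \<bullet> v = (if v = x then 1 else 0)" if v: "v \<in> r ` I" for v
    proof -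
      obtain j where j: "j \<in> I" "v = r j"
        using v by blast
      then show ?thesis
        using u [OF j(1)] u [OF i(1)] i(2) by (auto split: if_splits)
    qed
    have "0 = u \<bullet> (\<Sum>v\<in>r ` I. a v *\<^sub>R v)"
      by (simp add: sum)
    also have "\<dots> = (\<Sum>v\<in>r ` I. a v * (u \<bullet> v))"
      by (simp add: inner_sum_right)
    also have "\<dots> = (\<Sum>v\<in>r ` I. if v = x then a v else 0)"
      by (rule sum.cong) (simp_all add: inner)
    also have "\<dots> = a x"
      using assms(1) \<open>x \<in> r ` I\<close> by simp
    finally show "a x = 0" by simp
  qed (use assms in simp)
  moreover have "0 \<notin> r ` I"
  proof
    assume "0 \<in> r ` I"
    then obtain i where "i \<in> I" "r i = 0"
      by auto
    then show False
      using dual [of i] by fastforce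
  qed
  ultimately show ?thesis
    by (simp add: affine_dependent_iff_dependent)
qed

lemma tree_dual:
  assumes "tree \<tau>" "e \<in> \<tau>"
  obtains u :: "real ^ 4" where "\<forall>f\<in>\<tau>. u \<bullet> root_vec f = (if f = e then 1 else 0)"
proof (rule tree_free [OF assms(1), of "\<lambda>f. if f = e then 1 else 0"])
  fix u :: "real ^ 4"
  assume "\<And>f. f \<in> \<tau> \<Longrightarrow> u $ src f - u $ tgt f = (if f = e then 1 else 0)"
  then show thesis
    by (intro that [of u] ballI) (simp only: root_vec_inner)
qed

lemma affine_independent_tree:
  assumes "tree \<tau>"
  shows "\<not> affine_dependent (insert 0 (root_vec ` \<tau>))"
proof (rule affine_independent_dual)
  fix e assume "e \<in> \<tau>"
  then show "\<exists>u. \<forall>f\<in>\<tau>. u \<bullet> root_vec f = (if f = e then 1 else 0)"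
    by (rule tree_dual [OF assms]) (rule exI)
qed (rule finite)

lemma affine_independent_clique:
  assumes "generic c" "clique c X" "A \<subseteq> insert 0 (root_vec ` X)"
  shows "\<not> affine_dependent A"
proof -
  obtain \<tau> where \<tau>: "tree \<tau>" "clique c \<tau>" "X \<subseteq> \<tau>"
    by (rule clique_tree [OF assms(1,2)])
  have "A \<subseteq> insert 0 (root_vec ` \<tau>)"
    using assms(3) \<tau>(3) by blast
  then show ?thesis
    by (rule affine_independent_subset [OF affine_independent_tree [OF \<tau>(1)]])
qed

section \<open>Lifted roots and lower faces\<close>

definition lift :: "real ^ offdiag \<Rightarrow> offdiag \<Rightarrow> (real ^ 4) \<times> real" where
  "lift c e = (root_vec e, c $ e)"

lemma lifted_polytope_eq: "lifted_polytope c = convex hull (insert 0 (range (lift c)))"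
  by (simp add: lifted_polytope_def lift_def zero_prod_def)

lemma compact_vertices: "compact (insert 0 (range (lift c)))"
  by (rule finite_imp_compact) simp

text \<open>A lifted root for i \<noteq> j and the lifted origin for i = j, so that both members of
  a swapped pair are points of the lifted polytope in every case.\<close>

definition lift2 :: "real ^ offdiag \<Rightarrow> 4 \<Rightarrow> 4 \<Rightarrow> (real ^ 4) \<times> real" where
  "lift2 c i j = (axis i 1 - axis j 1, wt c i j)"

lemma lift2_mem: "lift2 c i j \<in> lifted_polytope c"
proof -
  have "lift2 c i j \<in> insert 0 (range (lift c))"
  proof (cases "i = j")
    case True
    then show ?thesis
      by (simp add: lift2_def zero_prod_def)
  next
    case False
    then have "lift2 c i j = lift c (edge i j)"
      by (simp add: lift2_def lift_def root_vec_def wt_def)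
    then show ?thesis by simp
  qed
  then show ?thesis
    unfolding lifted_polytope_eq by (rule hull_inc)
qed

lemma lift_inj: "lift c e = lift c f \<longleftrightarrow> e = f"
  by (auto simp: lift_def root_vec_inj)

text \<open>
  In a lower face no two lifted vertices can be swapped for a lower pair with the same sum.
\<close>

lemma lower_face_clique:
  assumes "generic c"
    and F: "F \<subseteq> lower_hull (lifted_polytope c)" "F = convex hull S" "S \<subseteq> insert 0 (range (lift c))"
  shows "clique c {e. lift c e \<in> S}"
proof (rule ccontr)
  assume "\<not> ?thesis"
  then obtain e f where ef: "lift c e \<in> S" "lift c f \<in> S" "\<not> noncrossing c e f"
    by (auto simp: clique_def)
  then have opp: "opp e f" and "c $ e + c $ f \<ge> swap_wt c e f"
    by (auto simp: noncrossing_def)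
  then have less: "swap_wt c e f < c $ e + c $ f"
    using genericD [OF assms(1) opp] by simp
  have "e \<noteq> f"
    using opp by (auto simp: opp_def)
  then have ne: "lift c e \<noteq> lift c f"
    by (simp add: lift_inj)
  have fin: "finite S"
    by (rule finite_subset [OF F(3)]) simp
  define n where "n = real (card S)"
  have n: "n > 0"
    using fin ef(1) by (auto simp: n_def card_gt_0_iff)
  define g where "g v = (if v = lift c e then lift2 c (src e) (tgt f)
      else if v = lift c f then lift2 c (src f) (tgt e) else v)" for v
  \<comment> \<open>The barycentre lies in the face. Exchanging two of its summands for the swapped
    pair keeps the base point and lowers the height, which contradicts minimality.\<close>
  define p where "p = (\<Sum>v\<in>S. (1 / n) *\<^sub>R v)"
  define q where "q = (\<Sum>v\<in>S. (1 / n) *\<^sub>R g v)"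
  have one: "(\<Sum>v\<in>S. 1 / n) = 1"
    using n by (simp add: n_def)
  have "p \<in> F"
    unfolding p_def F(2) using fin n one
    by (intro convex_sum convex_convex_hull) (auto intro: hull_inc)
  then have low: "\<And>h'. (fst p, h') \<in> lifted_polytope c \<Longrightarrow> snd p \<le> h'"
    using F(1) by (cases p) (auto simp: lower_hull_def)
  have "g v \<in> lifted_polytope c" if "v \<in> S" for v
    using that F(3) lift2_mem unfolding g_def lifted_polytope_eq by (auto intro: hull_inc)
  then have q: "q \<in> lifted_polytope c"
    unfolding q_def using fin n one
    by (intro convex_sum) (auto simp: lifted_polytope_def convex_convex_hull)
  have S: "S = insert (lift c e) (insert (lift c f) (S - {lift c e, lift c f}))"
    using ef by auto
  have "(\<Sum>v\<in>S. g v - v) = (g (lift c e) - lift c e) + (g (lift c f) - lift c f)"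
    using fin ne by (subst S) (simp add: g_def)
  also have "\<dots> = (0, swap_wt c e f - (c $ e + c $ f))"
  proof -
    have "g (lift c e) = lift2 c (src e) (tgt f)" "g (lift c f) = lift2 c (src f) (tgt e)"
      using ne by (simp_all add: g_def)
    then show ?thesis
      by (simp add: lift2_def lift_def root_vec_def swap_wt_def)
  qed
  finally have "q - p = (1 / n) *\<^sub>R (0, swap_wt c e f - (c $ e + c $ f))"
    by (simp add: q_def p_def sum_subtractf flip: scaleR_sum_right scaleR_diff_right)
  then have "q = (fst p, snd p + (1 / n) * (swap_wt c e f - (c $ e + c $ f)))"
    by (simp add: algebra_simps prod_eq_iff)
  then have "snd p \<le> snd p + (1 / n) * (swap_wt c e f - (c $ e + c $ f))"
    using q by (intro low) simp
  moreover have "(1 / n) * (swap_wt c e f - (c $ e + c $ f)) < 0"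
    using n less by (intro mult_pos_neg) auto
  ultimately show False by simp
qed

lemma lift_affine_independent:
  assumes "tree \<tau>"
  shows "\<not> affine_dependent (insert 0 (lift c ` \<tau>))"
proof (rule affine_independent_dual)
  fix e assume "e \<in> \<tau>"
  obtain u :: "real ^ 4" where u: "\<forall>f\<in>\<tau>. u \<bullet> root_vec f = (if f = e then 1 else 0)"
    by (rule tree_dual [OF assms \<open>e \<in> \<tau>\<close>])
  show "\<exists>u. \<forall>f\<in>\<tau>. u \<bullet> lift c f = (if f = e then 1 else 0)"
    by (rule exI [of _ "(u, 0)"]) (simp add: lift_def u)
qed (rule finite)

text \<open>The vertex y with this tree as tight set gives the supporting functional: height minus y
  \<bullet> x. On a lifted root it is the slack of an inequality of the polytrope, hence
  nonnegative, and zero exactly on the tree.\<close>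

lemma tree_face:
  assumes c: "generic c" and \<tau>: "tree \<tau>" "clique c \<tau>"
  shows "convex hull (insert 0 (lift c ` \<tau>)) face_of lifted_polytope c"
    and "convex hull (insert 0 (lift c ` \<tau>)) \<subseteq> lower_hull (lifted_polytope c)"
proof -
  obtain y where y: "y \<in> polytrope c" "\<tau> \<subseteq> tight c y"
    by (rule tree_feasible [OF generic_triangle [OF c] \<tau>])
  have ty: "tight c y = \<tau>"
    by (rule tight_tree_eq [OF c y(1) \<tau>(1) y(2)])
  let ?Q = "lifted_polytope c" and ?V = "insert 0 (range (lift c))"
  let ?a = "(- y, 1 :: real)"
  have lift: "?a \<bullet> lift c e = c $ e - (y $ src e - y $ tgt e)" for e
    by (simp add: lift_def root_vec_inner)
  have "?V \<subseteq> {x. 0 \<le> ?a \<bullet> x}"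
    using y(1) lift by (auto simp: polytrope_def simp del: inner_Pair)
  then have ge: "0 \<le> ?a \<bullet> x" if "x \<in> ?Q" for x
    using hull_minimal [of ?V "{x. 0 \<le> ?a \<bullet> x}" convex] convex_halfspace_ge [of 0 ?a] that
    unfolding lifted_polytope_eq by blast
  have face: "(?Q \<inter> {x. ?a \<bullet> x = 0}) face_of ?Q"
    using ge by (intro face_of_Int_supporting_hyperplane_ge) (auto simp: lifted_polytope_def convex_convex_hull)
  then obtain S where S: "S \<subseteq> ?V" "?Q \<inter> {x. ?a \<bullet> x = 0} = convex hull S"
    unfolding lifted_polytope_eq by (rule face_of_convex_hull_subset [OF compact_vertices])
  have zero_iff: "?a \<bullet> lift c e = 0 \<longleftrightarrow> e \<in> \<tau>" for e
    unfolding lift using ty by (auto simp: tight_def)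
  have "S \<subseteq> insert 0 (lift c ` \<tau>)"
  proof
    fix v assume v: "v \<in> S"
    then have "?a \<bullet> v = 0"
      using hull_inc [OF v, of convex] S(2) by blast
    with v S(1) zero_iff show "v \<in> insert 0 (lift c ` \<tau>)"
      by auto
  qed
  then have "?Q \<inter> {x. ?a \<bullet> x = 0} \<subseteq> convex hull (insert 0 (lift c ` \<tau>))"
    unfolding S(2) by (rule hull_mono)
  moreover have "convex hull (insert 0 (lift c ` \<tau>)) \<subseteq> ?Q"
    unfolding lifted_polytope_eq by (rule hull_mono) auto
  moreover have "convex hull (insert 0 (lift c ` \<tau>)) \<subseteq> {x. ?a \<bullet> x = 0}"
    by (rule hull_minimal) (use zero_iff in \<open>auto simp: convex_hyperplane simp del: inner_Pair\<close>)
  ultimately have eq: "convex hull (insert 0 (lift c ` \<tau>)) = ?Q \<inter> {x. ?a \<bullet> x = 0}"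
    by blast
  show "convex hull (insert 0 (lift c ` \<tau>)) face_of ?Q"
    using face unfolding eq .
  show "convex hull (insert 0 (lift c ` \<tau>)) \<subseteq> lower_hull ?Q"
  proof
    fix p assume "p \<in> convex hull (insert 0 (lift c ` \<tau>))"
    then have p: "p \<in> ?Q" "?a \<bullet> p = 0"
      unfolding eq by auto
    obtain x h where xh: "p = (x, h)"
      by (cases p)
    \<comment> \<open>Over a fixed base point the functional is the height up to a constant, so its
      zeros are lowest points.\<close>
    have "h \<le> h'" if "(x, h') \<in> ?Q" for h'
      using ge [OF that] p(2) by (simp add: xh)
    then show "p \<in> lower_hull ?Q"
      using p(1) by (simp add: lower_hull_def xh)
  qed
qed

text \<open>The vertices of a lower face form a clique, possibly with the origin. Conversely a
  clique extends to a tree, whose lift with the origin spans a simplex that is a lower face, and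
  every subset of the vertices of a simplex spans a face.\<close>

lemma cell_iff:
  assumes c: "generic c"
  shows "E \<in> central_subdivision c \<longleftrightarrow>
    (\<exists>X A. clique c X \<and> A \<subseteq> insert 0 (root_vec ` X) \<and> A \<noteq> {} \<and> E = convex hull A)"
proof
  assume "E \<in> central_subdivision c"
  then obtain F where F: "F face_of lifted_polytope c" "F \<noteq> {}" "F \<subseteq> lower_hull (lifted_polytope c)" "E = fst ` F"
    by (auto simp: central_subdivision_def)
  obtain S where S: "S \<subseteq> insert 0 (range (lift c))" "F = convex hull S"
    using F(1) unfolding lifted_polytope_eq
    by (rule face_of_convex_hull_subset [OF compact_vertices])
  let ?X = "{e. lift c e \<in> S}"
  have "clique c ?X"
    by (rule lower_face_clique [OF c F(3) S(2,1)])
  moreover have "fst ` S \<subseteq> insert 0 (root_vec ` ?X)"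
  proof
    fix x assume "x \<in> fst ` S"
    then obtain v where v: "v \<in> S" "x = fst v"
      by blast
    then consider "v = 0" | e where "v = lift c e"
      using S(1) by blast
    then show "x \<in> insert 0 (root_vec ` ?X)"
      by cases (use v in \<open>auto simp: lift_def\<close>)
  qed
  moreover have "fst ` S \<noteq> {}"
    using F(2) S(2) by auto
  moreover have "E = convex hull (fst ` S)"
    unfolding F(4) S(2) by (rule convex_hull_linear_image [OF linear_fst])
  ultimately show "\<exists>X A. clique c X \<and> A \<subseteq> insert 0 (root_vec ` X) \<and> A \<noteq> {} \<and> E = convex hull A"
    by blast
next
  assume "\<exists>X A. clique c X \<and> A \<subseteq> insert 0 (root_vec ` X) \<and> A \<noteq> {} \<and> E = convex hull A"
  then obtain X A where XA: "clique c X" "A \<subseteq> insert 0 (root_vec ` X)" "A \<noteq> {}" "E = convex hull A"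
    by blast
  obtain \<tau> where \<tau>: "tree \<tau>" "clique c \<tau>" "X \<subseteq> \<tau>"
    by (rule clique_tree [OF c XA(1)])
  let ?V = "insert 0 (lift c ` \<tau>)"
  define S where "S = {v \<in> ?V. fst v \<in> A}"
  have A: "A = fst ` S"
  proof
    show "A \<subseteq> fst ` S"
    proof
      fix x assume x: "x \<in> A"
      then consider "x = 0" | e where "e \<in> \<tau>" "x = root_vec e"
        using XA(2) \<tau>(3) by blast
      then show "x \<in> fst ` S"
      proof cases
        case 1
        then show ?thesis
          using x by (intro image_eqI [of _ _ 0]) (auto simp: S_def)
      next
        case (2 e)
        then show ?thesis
          using x by (intro image_eqI [of _ _ "lift c e"]) (auto simp: S_def lift_def)
      qed
    qed
  qed (auto simp: S_def)
  have "S \<subseteq> ?V"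
    by (auto simp: S_def)
  then have "convex hull S face_of convex hull ?V"
    by (subst face_of_convex_hull_affine_independent [OF lift_affine_independent [OF \<tau>(1)]]) blast
  then have "convex hull S face_of lifted_polytope c"
    using tree_face(1) [OF c \<tau>(1,2)] face_of_trans by blast
  moreover have "convex hull S \<noteq> {}"
    using A XA(3) by auto
  moreover have "convex hull S \<subseteq> lower_hull (lifted_polytope c)"
    using tree_face(2) [OF c \<tau>(1,2)] hull_mono [of S ?V convex] by (auto simp: S_def)
  moreover have "E = fst ` (convex hull S)"
    unfolding XA(4) A by (rule convex_hull_linear_image [OF linear_fst, symmetric])
  ultimately show "E \<in> central_subdivision c"
    by (auto simp: central_subdivision_def)
qed

lemma convex_hull_affine_independent_inj:
  fixes A B :: "'v :: euclidean_space set"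
  assumes "\<not> affine_dependent A" "\<not> affine_dependent B" "convex hull A = convex hull B"
  shows "A = B"
  using extreme_point_of_convex_hull_affine_independent [OF assms(1)]
    extreme_point_of_convex_hull_affine_independent [OF assms(2)] assms(3) by auto

text \<open>Affinely independent sets are recovered from their hulls as the extreme points, so a set
  describing the cell must be B itself.\<close>

lemma hull_mem_central_subdivision:
  assumes "generic c" "\<not> affine_dependent B"
  shows "convex hull B \<in> central_subdivision c \<longleftrightarrow>
    B \<noteq> {} \<and> (\<exists>X. clique c X \<and> B \<subseteq> insert 0 (root_vec ` X))"
proof
  assume "convex hull B \<in> central_subdivision c"
  then obtain X A where XA: "clique c X" "A \<subseteq> insert 0 (root_vec ` X)" "A \<noteq> {}" "convex hull B = convex hull A"
    unfolding cell_iff [OF assms(1)] by blast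
  have "B = A"
    by (rule convex_hull_affine_independent_inj [OF assms(2) affine_independent_clique [OF assms(1) XA(1,2)] XA(4)])
  then show "B \<noteq> {} \<and> (\<exists>X. clique c X \<and> B \<subseteq> insert 0 (root_vec ` X))"
    using XA by blast
next
  assume "B \<noteq> {} \<and> (\<exists>X. clique c X \<and> B \<subseteq> insert 0 (root_vec ` X))"
  then show "convex hull B \<in> central_subdivision c"
    unfolding cell_iff [OF assms(1)] by blast
qed

section \<open>Triangles, edges and degrees of the triangulation\<close>

lemma root_vec_image_subset: "root_vec ` Y \<subseteq> insert 0 (root_vec ` X) \<longleftrightarrow> Y \<subseteq> X"
proof -
  have "root_vec ` Y \<subseteq> insert 0 (root_vec ` X) \<longleftrightarrow> root_vec ` Y \<subseteq> root_vec ` X"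
    by (auto simp: subset_iff)
  then show ?thesis
    by (simp add: inj_image_subset_iff [OF inj_root_vec])
qed

lemma clique_subset: "clique c X \<Longrightarrow> Y \<subseteq> X \<Longrightarrow> clique c Y"
  by (auto simp: clique_def)

lemma triangle_cell_iff:
  assumes c: "generic c" and d: "e \<noteq> f" "e \<noteq> g" "f \<noteq> g"
  shows "2 simplex (convex hull {root_vec e, root_vec f, root_vec g}) \<and>
      convex hull {root_vec e, root_vec f, root_vec g} \<in> central_subdivision c \<longleftrightarrow>
    noncrossing c e f \<and> noncrossing c e g \<and> noncrossing c f g"
proof -
  let ?R = "root_vec ` {e, f, g}"
  have R: "{root_vec e, root_vec f, root_vec g} = ?R"
    by simp
  have card: "card ?R = 3"
    using d by (simp add: card_image root_vec_inj)
  have cl: "clique c {e, f, g} \<longleftrightarrow> noncrossing c e f \<and> noncrossing c e g \<and> noncrossing c f g"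
    by (auto simp: clique_def noncrossing_sym)
  have "2 simplex (convex hull ?R) \<and> convex hull ?R \<in> central_subdivision c \<longleftrightarrow> clique c {e, f, g}"
  proof
    assume "clique c {e, f, g}"
    moreover from this have "\<not> affine_dependent ?R"
      by (rule affine_independent_clique [OF c]) auto
    ultimately show "2 simplex (convex hull ?R) \<and> convex hull ?R \<in> central_subdivision c"
      using card hull_mem_central_subdivision [OF c, of ?R]
      by (auto simp: simplex_def simp del: image_insert intro!: exI [of _ ?R] exI [of _ "{e, f, g}"])
  next
    assume *: "2 simplex (convex hull ?R) \<and> convex hull ?R \<in> central_subdivision c"
    then obtain C where C: "\<not> affine_dependent C" "card C = 3" "convex hull ?R = convex hull C"
      by (auto simp: simplex_def simp del: image_insert)
    \<comment> \<open>The vertices of the simplex are extreme points of the hull, hence among the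
      three roots; equal cardinality then makes the roots affinely independent.\<close>
    have "x \<in> ?R" if "x \<in> C" for x
    proof -
      have "x extreme_point_of convex hull ?R"
        using that C(1,3) extreme_point_of_convex_hull_affine_independent by auto
      then show ?thesis
        by (rule extreme_point_of_convex_hull)
    qed
    then have "C = ?R"
      using card C(2) by (intro card_subset_eq) auto
    then have "\<exists>X. clique c X \<and> ?R \<subseteq> insert 0 (root_vec ` X)"
      using * hull_mem_central_subdivision [OF c, of ?R] C(1) by blast
    then show "clique c {e, f, g}"
      unfolding root_vec_image_subset using clique_subset by blast
  qed
  then show ?thesis
    unfolding R cl .
qed

lemma segment_cell_iff:
  assumes c: "generic c"
  shows "closed_segment (root_vec e) (root_vec f) \<in> central_subdivision c \<longleftrightarrow> noncrossing c e f"
proof -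
  have "closed_segment (root_vec e) (root_vec f) = convex hull (root_vec ` {e, f})"
    by (simp add: segment_convex_hull)
  moreover have "convex hull (root_vec ` {e, f}) \<in> central_subdivision c \<longleftrightarrow> (\<exists>X. clique c X \<and> {e, f} \<subseteq> X)"
    using hull_mem_central_subdivision [OF c, of "root_vec ` {e, f}"] unfolding root_vec_image_subset
    by auto
  moreover have "(\<exists>X. clique c X \<and> {e, f} \<subseteq> X) \<longleftrightarrow> noncrossing c e f"
    using noncrossing_sym [of c e f] by (auto simp: clique_def intro!: exI [of _ "{e, f}"])
  ultimately show ?thesis by simp
qed

lemma adjacent_iff:
  assumes c: "generic c"
  shows "adjacent (central_subdivision c) (root_vec e) (root_vec f) \<longleftrightarrow> e \<noteq> f \<and> noncrossing c e f"
  by (simp add: adjacent_def segment_cell_iff [OF c] root_vec_inj)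

text \<open>An edge at e corresponds to its other endpoint. The summand 1 is the edge to the origin;
  all others lead to noncrossing roots.\<close>

lemma deg_eq:
  assumes c: "generic c"
  shows "deg (central_subdivision c) (root_vec e) = 1 + card {f. f \<noteq> e \<and> noncrossing c e f}"
proof -
  let ?N = "{f. f \<noteq> e \<and> noncrossing c e f}"
  let ?h = "\<lambda>v. convex hull {root_vec e, v}"
  have cells: "{E \<in> central_subdivision c. aff_dim E = 1 \<and> root_vec e extreme_point_of E} =
      ?h ` (insert 0 (root_vec ` ?N))"
  proof (intro set_eqI iffI)
    fix E assume E: "E \<in> {E \<in> central_subdivision c. aff_dim E = 1 \<and> root_vec e extreme_point_of E}"
    then obtain X A where XA: "clique c X" "A \<subseteq> insert 0 (root_vec ` X)" "E = convex hull A"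
      using cell_iff [OF c] by blast
    have ind: "\<not> affine_dependent A"
      by (rule affine_independent_clique [OF c XA(1,2)])
    have "card A = 2"
      using E XA(3) aff_dim_affine_independent [OF ind] by (simp add: aff_dim_convex_hull)
    moreover have eA: "root_vec e \<in> A"
      using E XA(3) extreme_point_of_convex_hull_affine_independent [OF ind] by simp
    ultimately obtain v where v: "A = {root_vec e, v}" "v \<noteq> root_vec e"
      by (auto simp: card_2_iff)
    have "v \<in> insert 0 (root_vec ` ?N)"
    proof (cases "v = 0")
      case False
      then obtain f where "f \<in> X" "v = root_vec f"
        using XA(2) v(1) by auto
      moreover have "e \<in> X"
        using XA(2) eA by (auto simp: root_vec_inj)
      ultimately have "f \<in> ?N"
        using XA(1) v(2) by (auto simp: clique_def)
      with \<open>v = root_vec f\<close> show ?thesis by blast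
    qed simp
    then show "E \<in> ?h ` (insert 0 (root_vec ` ?N))"
      using XA(3) v(1) by blast
  next
    fix E assume "E \<in> ?h ` (insert 0 (root_vec ` ?N))"
    then obtain v where v: "v \<in> insert 0 (root_vec ` ?N)" "E = convex hull {root_vec e, v}"
      by blast
    have ne: "v \<noteq> root_vec e"
      using v(1) by (auto simp: root_vec_inj)
    have "\<exists>X. clique c X \<and> e \<in> X \<and> v \<in> insert 0 (root_vec ` X)"
    proof (cases "v = 0")
      case True
      then show ?thesis
        by (intro exI [of _ "{e}"]) (simp add: clique_def)
    next
      case False
      then obtain f where f: "v = root_vec f" "noncrossing c e f"
        using v(1) by auto
      then show ?thesis
        using noncrossing_sym [of c e f] by (intro exI [of _ "{e, f}"]) (simp add: clique_def)
    qed
    then obtain X where X: "clique c X" "e \<in> X" "v \<in> insert 0 (root_vec ` X)"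
      by blast
    have "E \<in> central_subdivision c"
      unfolding v(2) using X by (subst hull_mem_central_subdivision [OF c]) auto
    moreover have "aff_dim E = 1"
      unfolding v(2) using ne by (simp add: aff_dim_convex_hull aff_dim_affine_independent)
    moreover have "root_vec e extreme_point_of E"
      unfolding v(2) by (subst extreme_point_of_convex_hull_affine_independent) auto
    ultimately show "E \<in> {E \<in> central_subdivision c. aff_dim E = 1 \<and> root_vec e extreme_point_of E}"
      by simp
  qed
  have inj: "inj_on ?h (insert 0 (root_vec ` ?N))"
  proof (rule inj_onI)
    fix v w assume vw: "v \<in> insert 0 (root_vec ` ?N)" "w \<in> insert 0 (root_vec ` ?N)" "?h v = ?h w"
    have "{root_vec e, v} = {root_vec e, w}"
      by (rule convex_hull_affine_independent_inj [OF _ _ vw(3)]) simp_all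
    moreover have "v \<noteq> root_vec e" "w \<noteq> root_vec e"
      using vw(1,2) by (auto simp: root_vec_inj)
    ultimately show "v = w"
      by (auto simp: doubleton_eq_iff)
  qed
  have card: "card (insert 0 (root_vec ` ?N)) = 1 + card ?N"
    by (subst card_insert_disjoint) (auto simp: card_image root_vec_inj inj_on_def)
  show ?thesis
    unfolding deg_def cells card_image [OF inj] card ..
qed

section \<open>Square facets\<close>

definition sq :: "4 \<Rightarrow> 4 \<Rightarrow> 4 \<Rightarrow> 4 \<Rightarrow> offdiag set" where
  "sq i j k l = {edge i k, edge i l, edge j k, edge j l}"

lemma card_sq:
  assumes "distinct [i, j, k, l]"
  shows "card (sq i j k l) = 4"
  using assms by (simp add: sq_def edge_eq_iff)

lemma mem_sq_iff:
  assumes d: "distinct [i, j, k, l]"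
  shows "e \<in> sq i j k l \<longleftrightarrow> src e \<in> {i, j} \<and> tgt e \<in> {k, l}"
proof
  assume "e \<in> sq i j k l"
  then show "src e \<in> {i, j} \<and> tgt e \<in> {k, l}"
    using d by (auto simp: sq_def)
next
  assume "src e \<in> {i, j} \<and> tgt e \<in> {k, l}"
  then have "edge (src e) (tgt e) \<in> sq i j k l"
    by (elim conjE insertE emptyE; simp only: sq_def insert_iff simp_thms)
  then show "e \<in> sq i j k l"
    by simp
qed

section \<open>Faces and vertices of the root polytope\<close>

lemma convex_FP4: "convex FP4"
  by (simp add: FP4_def convex_convex_hull)

lemma polytope_FP4: "polytope FP4"
  by (simp add: FP4_def polytope_convex_hull)

lemma card_root_vec_image: "card (root_vec ` X) = card X"
  by (rule card_image) (rule inj_on_subset [OF inj_root_vec subset_UNIV])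

lemma root_vec_mem_FP4: "root_vec e \<in> FP4"
  unfolding FP4_def by (rule hull_inc) simp

lemma FP4_le:
  assumes "\<And>e. a \<bullet> root_vec e \<le> b" "x \<in> FP4"
  shows "a \<bullet> x \<le> b"
proof -
  have "FP4 \<subseteq> {x. a \<bullet> x \<le> b}"
    unfolding FP4_def by (rule hull_minimal) (use assms(1) in \<open>auto simp: convex_halfspace_le\<close>)
  then show ?thesis
    using assms(2) by blast
qed

lemma FP4_face:
  assumes "\<And>e. a \<bullet> root_vec e \<le> b"
  shows "(FP4 \<inter> {x. a \<bullet> x = b}) face_of FP4"
  using FP4_le [OF assms] by (intro face_of_Int_supporting_hyperplane_le convex_FP4)

lemma face_of_FP4_eq_hull:
  assumes "S face_of FP4"
  shows "S = convex hull (root_vec ` {e. root_vec e \<in> S})"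
proof -
  have "compact (range root_vec)"
    by (rule finite_imp_compact) simp
  then obtain R where R: "R \<subseteq> range root_vec" "S = convex hull R"
    using assms unfolding FP4_def by (rule face_of_convex_hull_subset)
  have "R \<subseteq> root_vec ` {e. root_vec e \<in> S}"
    using R hull_subset [of R convex] by auto
  then have "S \<subseteq> convex hull (root_vec ` {e. root_vec e \<in> S})"
    unfolding R(2) by (rule hull_mono)
  moreover have "convex hull (root_vec ` {e. root_vec e \<in> S}) \<subseteq> S"
    by (rule hull_minimal) (use assms in \<open>auto simp: face_of_imp_convex\<close>)
  ultimately show ?thesis by blast
qed

lemma root_vec_inner_root_vec: "root_vec e \<bullet> root_vec f \<le> 2" "root_vec e \<bullet> root_vec f = 2 \<longleftrightarrow> e = f"
proof -
  have "root_vec e \<bullet> root_vec f = root_vec e $ src f - root_vec e $ tgt f"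
    by (rule root_vec_inner)
  moreover have "root_vec e $ src f \<le> 1" "root_vec e $ tgt f \<ge> -1"
    "root_vec e $ src f = 1 \<longleftrightarrow> src e = src f" "root_vec e $ tgt f = -1 \<longleftrightarrow> tgt e = tgt f"
    by (auto simp: root_vec_nth)
  ultimately show "root_vec e \<bullet> root_vec f \<le> 2" "root_vec e \<bullet> root_vec f = 2 \<longleftrightarrow> e = f"
    unfolding offdiag_eq_iff by linarith+
qed

text \<open>All roots have squared length 2, so the inner product with a root attains its maximum at
  that root only.\<close>

lemma root_vec_extreme: "root_vec e extreme_point_of FP4"
proof -
  let ?S = "FP4 \<inter> {x. root_vec e \<bullet> x = 2}"
  have face: "?S face_of FP4"
    by (rule FP4_face) (rule root_vec_inner_root_vec)
  have "{f. root_vec f \<in> ?S} = {e}"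
    using root_vec_mem_FP4 by (auto simp: root_vec_inner_root_vec)
  then have "?S = {root_vec e}"
    using face_of_FP4_eq_hull [OF face] by simp
  with face show ?thesis
    by (simp add: face_of_singleton)
qed

lemma extreme_points_face:
  assumes "S face_of FP4"
  shows "{v. v extreme_point_of S} = root_vec ` {e. root_vec e \<in> S}"
proof
  show "root_vec ` {e. root_vec e \<in> S} \<subseteq> {v. v extreme_point_of S}"
    using extreme_point_of_face [OF assms] root_vec_extreme by auto
  show "{v. v extreme_point_of S} \<subseteq> root_vec ` {e. root_vec e \<in> S}"
  proof
    fix v assume "v \<in> {v. v extreme_point_of S}"
    then have v: "v extreme_point_of S"
      by simp
    show "v \<in> root_vec ` {e. root_vec e \<in> S}"
      by (rule extreme_point_of_convex_hull) (use v face_of_FP4_eq_hull [OF assms] in simp)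
  qed
qed

section \<open>The six squares and their diagonals\<close>

definition sq_face :: "4 \<Rightarrow> 4 \<Rightarrow> 4 \<Rightarrow> 4 \<Rightarrow> (real ^ 4) set" where
  "sq_face i j k l = convex hull (root_vec ` sq i j k l)"

lemma sq_face_props:
  assumes d: "distinct [i, j, k, l]"
  shows "sq_face i j k l face_of FP4" "root_vec e \<in> sq_face i j k l \<longleftrightarrow> e \<in> sq i j k l"
    "0 \<notin> sq_face i j k l"
proof -
  \<comment> \<open>On roots the functional x_i + x_j takes its maximum 1 exactly on the edges from
    {i, j} to {k, l}.\<close>
  let ?a = "axis i 1 + axis j 1 :: real ^ 4"
  let ?S = "FP4 \<inter> {x. ?a \<bullet> x = 1}"
  have U: "UNIV = {i, j, k, l}"
    by (rule distinct_cases_4 [OF d])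
  have a: "?a \<bullet> root_vec e = (if src e \<in> {i, j} then 1 else 0) - (if tgt e \<in> {i, j} then 1 else 0)" for e
    using d by (auto simp: root_vec_inner axis_def)
  have "?a \<bullet> root_vec e \<le> 1" for e
    unfolding a by simp
  then have face: "?S face_of FP4"
    by (rule FP4_face)
  have mem: "root_vec e \<in> ?S \<longleftrightarrow> e \<in> sq i j k l" for e
  proof -
    have "tgt e \<notin> {i, j} \<longleftrightarrow> tgt e \<in> {k, l}"
      using UNIV_I [of "tgt e"] d unfolding U by auto
    then show ?thesis
      unfolding mem_sq_iff [OF d] using a [of e] root_vec_mem_FP4 [of e] by auto
  qed
  have S: "sq_face i j k l = ?S"
    using face_of_FP4_eq_hull [OF face] unfolding mem Collect_mem_eq sq_face_def by (rule sym)
  show "sq_face i j k l face_of FP4" "root_vec e \<in> sq_face i j k l \<longleftrightarrow> e \<in> sq i j k l"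
    "0 \<notin> sq_face i j k l"
    unfolding S using face mem by auto
qed

lemma zero_mem_FP4: "0 \<in> FP4"
proof -
  have "(1 / 2) *\<^sub>R root_vec (edge 1 2) + (1 / 2) *\<^sub>R root_vec (edge 2 1) \<in> FP4"
    by (intro convexD convex_FP4 root_vec_mem_FP4) auto
  moreover have "(1 / 2) *\<^sub>R root_vec (edge 1 2) + (1 / 2) *\<^sub>R root_vec (edge 2 1) = 0"
    by (simp add: root_vec_def flip: scaleR_add_right)
  ultimately show ?thesis by simp
qed

lemma aff_dim_FP4: "aff_dim FP4 = 3"
proof -
  let ?H = "{x :: real ^ 4. 1 \<bullet> x = 0}"
  have "FP4 \<subseteq> ?H"
    unfolding FP4_def by (rule hull_minimal) (auto simp: root_vec_inner convex_hyperplane)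
  then have "aff_dim FP4 \<le> aff_dim ?H"
    by (rule aff_dim_subset)
  also have "aff_dim ?H = 3"
    by (subst aff_dim_hyperplane) auto
  finally have le: "aff_dim FP4 \<le> 3" .
  let ?B = "insert 0 (root_vec ` outstar 1)"
  have "card ?B = 4"
    using card_tree [OF tree_outstar [of 1]]
    by (subst card_insert_disjoint) (auto simp: card_root_vec_image)
  then have "aff_dim ?B = 3"
    using aff_dim_affine_independent [OF affine_independent_tree [OF tree_outstar [of 1]]] by simp
  moreover have "?B \<subseteq> FP4"
    using root_vec_mem_FP4 zero_mem_FP4 by auto
  ultimately have "3 \<le> aff_dim FP4"
    using aff_dim_subset by metis
  with le show ?thesis by simp
qed

lemma square_facet_sq_face:
  assumes d: "distinct [i, j, k, l]"
  shows "square_facet (sq_face i j k l)"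
proof -
  let ?S = "sq_face i j k l"
  note props = sq_face_props [OF d]
  have "?S \<noteq> FP4"
    using props(3) zero_mem_FP4 by blast
  then have lt: "aff_dim ?S < 3"
    using face_of_aff_dim_lt [OF convex_FP4 props(1)] aff_dim_FP4 by simp
  let ?B = "root_vec ` zpath i j k l"
  have "\<not> affine_dependent ?B"
    by (rule affine_independent_subset [OF affine_independent_tree [OF tree_zpath [OF d]]]) blast
  moreover have "card ?B = 3"
    using card_tree [OF tree_zpath [OF d]] by (simp add: card_root_vec_image)
  ultimately have "aff_dim ?B = 2"
    using aff_dim_affine_independent [of ?B] by simp
  moreover have "?B \<subseteq> ?S"
    using props(2) by (auto simp: zpath_def sq_def)
  ultimately have "2 \<le> aff_dim ?S"
    using aff_dim_subset by metis
  with lt have "aff_dim ?S = 2"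
    by simp
  moreover have "?S \<noteq> {}"
    using props(2) [of "edge i k"] by (auto simp: sq_def)
  moreover have "card {v. v extreme_point_of ?S} = 4"
    unfolding extreme_points_face [OF props(1)] using card_sq [OF d] props(2)
    by (simp add: card_root_vec_image)
  ultimately show ?thesis
    using props(1) by (simp add: square_facet_def facet_of_def aff_dim_FP4)
qed

text \<open>Let a \<bullet> x = b expose the face. Its roots are the pairs (p,q) whose difference
  a_p - a_q attains the maximum b. Four roots do not fit into a star of three edges, which forces
  a_i = a_j and a_k = a_l, so all edges of the square belong to the face.\<close>

lemma square_facet_unique:
  assumes d: "distinct [i, j, k, l]" and S: "square_facet S"
    and e: "e \<in> {edge i l, edge j k, edge j l}" "root_vec e \<in> S" and f: "root_vec (edge i k) \<in> S"
  shows "S = sq_face i j k l"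
proof -
  have face: "S face_of FP4" and four: "card {v. v extreme_point_of S} = 4"
    using S by (auto simp: square_facet_def facet_of_def)
  define X where "X = {e. root_vec e \<in> S}"
  have cardX: "card X = 4"
    using four unfolding extreme_points_face [OF face] X_def [symmetric]
    by (simp add: card_root_vec_image)
  have "S exposed_face_of FP4"
    using exposed_face_of_polyhedron [OF polytope_imp_polyhedron [OF polytope_FP4]] face by simp
  then obtain a b where ab: "FP4 \<subseteq> {x. a \<bullet> x \<le> b}" "S = FP4 \<inter> {x. a \<bullet> x = b}"
    by (auto simp: exposed_face_of_def)
  have X: "e \<in> X \<longleftrightarrow> a $ src e - a $ tgt e = b" for e
    using root_vec_mem_FP4 [of e] by (simp add: X_def ab(2) root_vec_inner)
  have le: "a $ p - a $ q \<le> b" if "p \<noteq> q" for p q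
    using root_vec_mem_FP4 [of "edge p q"] ab(1) that by (auto simp: root_vec_inner)
  \<comment> \<open>With b = 0 all a_p agree and every root lies in the face; the six roots at i
    alone are already too many.\<close>
  have "b \<noteq> 0"
  proof
    assume "b = 0"
    then have "a $ p = a $ q" for p q
      using le [of p q] le [of q p] by (cases "p = q") auto
    then have "outstar i \<union> instar i \<subseteq> X"
      using X \<open>b = 0\<close> by auto
    moreover have "outstar i \<inter> instar i = {}"
      by (auto simp: outstar_def instar_def)
    then have "card (outstar i \<union> instar i) = 6"
      using card_tree [of "outstar i"] card_tree [of "instar i"] by (simp add: card_Un_disjoint)
    ultimately show False
      using card_mono [of X "outstar i \<union> instar i"] cardX by simp
  qed
  moreover have "0 \<le> b"
    using le [of i j] le [of j i] d by auto
  ultimately have b: "0 < b"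
    by simp
  have ik: "a $ i - a $ k = b"
    using f X [of "edge i k"] d by (simp add: X_def)
  have U: "p \<in> {i, j, k, l}" for p
    using distinct_cases_4 [OF d] by auto
  have ineq: "a $ i - a $ l \<le> b" "a $ j - a $ k \<le> b" "a $ j - a $ l \<le> b" "a $ i - a $ j \<le> b" "a $ l - a $ k \<le> b"
    using d by (auto intro!: le)
  have "a $ j = a $ i \<and> a $ l = a $ k"
  proof -
    consider "e = edge i l" | "e = edge j k" | "e = edge j l"
      using e(1) by blast
    then show ?thesis
    proof cases
      case 1
      then have il: "a $ i - a $ l = b"
        using e(2) X [of "edge i l"] d by (simp add: X_def)
      have "a $ j = a $ i"
      proof (rule ccontr)
        assume ne: "a $ j \<noteq> a $ i"
        have "X \<subseteq> outstar i"
        proof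
          fix g assume "g \<in> X"
          then have "a $ src g - a $ tgt g = b"
            by (simp add: X)
          then have "src g = i"
            using U [of "src g"] U [of "tgt g"] ik il ineq b ne by auto
          then show "g \<in> outstar i"
            by (simp add: outstar_def)
        qed
        then show False
          using card_mono [of "outstar i" X] cardX card_tree [of "outstar i"] by simp
      qed
      then show ?thesis
        using ik il by simp
    next
      case 2
      then have jk: "a $ j - a $ k = b"
        using e(2) X [of "edge j k"] d by (simp add: X_def)
      have "a $ l = a $ k"
      proof (rule ccontr)
        assume ne: "a $ l \<noteq> a $ k"
        have "X \<subseteq> instar k"
        proof
          fix g assume "g \<in> X"
          then have "a $ src g - a $ tgt g = b"
            by (simp add: X)
          then have "tgt g = k"
            using U [of "src g"] U [of "tgt g"] ik jk ineq b ne by auto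
          then show "g \<in> instar k"
            by (simp add: instar_def)
        qed
        then show False
          using card_mono [of "instar k" X] cardX card_tree [of "instar k"] by simp
      qed
      then show ?thesis
        using ik jk by simp
    next
      case 3
      then have "a $ j - a $ l = b"
        using e(2) X [of "edge j l"] d by (simp add: X_def)
      then show ?thesis
        using ik ineq by auto
    qed
  qed
  then have "sq i j k l \<subseteq> X"
    using X ik d by (auto simp: sq_def)
  then have "sq i j k l = X"
    using cardX card_sq [OF d] by (intro card_subset_eq) auto
  then show ?thesis
    using face_of_FP4_eq_hull [OF face] by (simp add: sq_face_def X_def)
qed

lemma sq_face_side:
  assumes d: "distinct [i, j, k, l]" and pq: "p \<in> sq i j k l" "q \<in> sq i j k l" "p \<noteq> q" "\<not> opp p q"
  shows "closed_segment (root_vec p) (root_vec q) edge_of sq_face i j k l"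
proof -
  have face: "closed_segment (root_vec p) (root_vec q) face_of FP4"
  proof -
    \<comment> \<open>Two roots with a common endpoint in the same role have inner product 1, so
      their sum takes the value 2 + 1 = 3 on both, and less on all other roots.\<close>
    define a :: "real ^ 4" where "a = root_vec p + root_vec q"
    have a: "a \<bullet> root_vec e \<le> 3 \<and> (a \<bullet> root_vec e = 3 \<longleftrightarrow> e \<in> {p, q})" for e
    proof -
      have s: "src p = src q \<and> tgt p \<noteq> tgt q \<or> tgt p = tgt q \<and> src p \<noteq> src q"
        using pq(3,4) by (auto simp: opp_def offdiag_eq_iff)
      have nt: "src p \<noteq> tgt q" "src q \<noteq> tgt p"
        using pq(1,2) d by (auto simp: mem_sq_iff [OF d])
      have "a \<bullet> root_vec e = (root_vec p $ src e - root_vec p $ tgt e) + (root_vec q $ src e - root_vec q $ tgt e)"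
        by (simp add: a_def inner_add_left root_vec_inner)
      then show ?thesis
        using s nt src_neq_tgt [of e] src_neq_tgt [of p] src_neq_tgt [of q]
        by (auto simp: root_vec_nth offdiag_eq_iff)
    qed
    then have "{e. root_vec e \<in> FP4 \<inter> {x. a \<bullet> x = 3}} = {p, q}"
      using root_vec_mem_FP4 by auto
    moreover have f: "(FP4 \<inter> {x. a \<bullet> x = 3}) face_of FP4"
      using a by (intro FP4_face) simp
    ultimately show ?thesis
      using face_of_FP4_eq_hull [OF f] by (simp add: segment_convex_hull)
  qed
  moreover have "closed_segment (root_vec p) (root_vec q) \<subseteq> sq_face i j k l"
    using sq_face_props(2) [OF d] pq(1,2)
    by (intro closed_segment_subset) (auto simp: sq_face_def convex_convex_hull)
  ultimately have "closed_segment (root_vec p) (root_vec q) face_of sq_face i j k l"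
    using face_of_subset [OF _ _ face_of_imp_subset [OF sq_face_props(1) [OF d]]] by blast
  moreover have "aff_dim (closed_segment (root_vec p) (root_vec q)) = 1"
    using pq(3) by (simp add: segment_convex_hull aff_dim_convex_hull aff_dim_affine_independent root_vec_inj)
  ultimately show ?thesis
    by (simp add: edge_of_def)
qed

text \<open>The two diagonals cross at their midpoints. A face containing this midpoint would
  contain the endpoints of the other diagonal as well.\<close>

lemma sq_face_diagonal:
  assumes d: "distinct [i, j, k, l]"
  shows "\<not> closed_segment (root_vec (edge i k)) (root_vec (edge j l)) edge_of sq_face i j k l"
proof
  let ?E = "closed_segment (root_vec (edge i k)) (root_vec (edge j l))"
  let ?m = "midpoint (root_vec (edge i l)) (root_vec (edge j k))"
  note props = sq_face_props [OF d]
  assume "?E edge_of sq_face i j k l"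
  then have face: "?E face_of sq_face i j k l"
    by (simp add: edge_of_def)
  have "?m = midpoint (root_vec (edge i k)) (root_vec (edge j l))"
    using d by (simp add: midpoint_def root_vec_def)
  then have "?m \<in> ?E"
    by simp
  moreover have "?m \<in> open_segment (root_vec (edge i l)) (root_vec (edge j k))"
    using d by (simp add: midpoint_in_open_segment root_vec_inj edge_eq_iff)
  moreover have il: "root_vec (edge i l) \<in> sq_face i j k l" "root_vec (edge j k) \<in> sq_face i j k l"
    unfolding props(2) by (simp_all add: sq_def)
  ultimately have mem: "root_vec (edge i l) \<in> ?E"
    using face by (blast dest: face_ofD)
  have "root_vec (edge i l) extreme_point_of sq_face i j k l"
    using extreme_point_of_face [OF props(1)] root_vec_extreme il(1) by blast
  then have "root_vec (edge i l) extreme_point_of ?E"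
    using extreme_point_of_face [OF face] mem by blast
  then have "root_vec (edge i l) \<in> {root_vec (edge i k), root_vec (edge j l)}"
    by (simp add: extreme_point_of_segment)
  then show False
    using d by (auto simp: root_vec_inj edge_eq_iff)
qed

text \<open>Two vertices of the square whose segment is not a side are opposite, and only one
  diagonal ends at the root of (i,k). It is a cell exactly if its endpoints are noncrossing.\<close>

lemma triangulating_edge_iff:
  assumes c: "generic c" and d: "distinct [i, j, k, l]"
  shows "(\<exists>E. triangulating_edge (central_subdivision c) (sq_face i j k l) E \<and>
      root_vec (edge i k) extreme_point_of E) \<longleftrightarrow> noncrossing c (edge i k) (edge j l)"
proof
  note props = sq_face_props [OF d]
  assume "\<exists>E. triangulating_edge (central_subdivision c) (sq_face i j k l) E \<and> root_vec (edge i k) extreme_point_of E"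
  then obtain E x y where E: "E \<in> central_subdivision c" "root_vec (edge i k) extreme_point_of E"
    and xy: "x extreme_point_of sq_face i j k l" "y extreme_point_of sq_face i j k l" "x \<noteq> y"
      "E = closed_segment x y" "\<not> E edge_of sq_face i j k l"
    unfolding triangulating_edge_def by blast
  have "x \<in> root_vec ` sq i j k l" "y \<in> root_vec ` sq i j k l"
    using xy(1,2) extreme_points_face [OF props(1)] props(2) by auto
  then obtain p q where pq: "x = root_vec p" "y = root_vec q" "p \<in> sq i j k l" "q \<in> sq i j k l"
    by blast
  have "opp p q"
    using sq_face_side [OF d pq(3,4)] xy(3-5) pq(1,2) by auto
  have "edge i k = p \<or> edge i k = q"
    using E(2) unfolding xy(4) pq(1,2) by (simp add: extreme_point_of_segment root_vec_inj)
  moreover have "noncrossing c p q"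
    using E(1) unfolding xy(4) pq(1,2) segment_cell_iff [OF c] .
  moreover have "q = edge j l" if "p = edge i k"
    using that pq(4) \<open>opp p q\<close> d by (auto simp: sq_def opp_def)
  moreover have "p = edge j l" if "q = edge i k"
    using that pq(3) \<open>opp p q\<close> d by (auto simp: sq_def opp_def)
  ultimately show "noncrossing c (edge i k) (edge j l)"
    using noncrossing_sym [of c p q] by auto
next
  note props = sq_face_props [OF d]
  assume comp: "noncrossing c (edge i k) (edge j l)"
  let ?E = "closed_segment (root_vec (edge i k)) (root_vec (edge j l))"
  have "root_vec (edge i k) extreme_point_of sq_face i j k l" "root_vec (edge j l) extreme_point_of sq_face i j k l"
    using extreme_points_face [OF props(1)] props(2) by (auto simp: sq_def)
  moreover have "root_vec (edge i k) \<noteq> root_vec (edge j l)"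
    using d by (simp add: root_vec_inj edge_eq_iff)
  ultimately have "triangulating_edge (central_subdivision c) (sq_face i j k l) ?E"
    unfolding triangulating_edge_def
    using comp sq_face_diagonal [OF d] segment_cell_iff [OF c] by blast
  moreover have "root_vec (edge i k) extreme_point_of ?E"
    by (simp add: extreme_point_of_segment)
  ultimately show "\<exists>E. triangulating_edge (central_subdivision c) (sq_face i j k l) E \<and>
      root_vec (edge i k) extreme_point_of E"
    by blast
qed

text \<open>A path of two edges crosses, so no vertex is the head of one edge and the tail of the
  other. If the edges share an endpoint, a vertex is left over and takes the missing role in the
  square.\<close>

lemma noncrossing_in_square:
  assumes c: "generic c" and ef: "e \<noteq> f" "noncrossing c e f"
  obtains i j k l where "distinct [i, j, k, l]" "f = edge i k" "e \<in> {edge i l, edge j k, edge j l}"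
proof -
  have n: "tgt e \<noteq> src f" "tgt f \<noteq> src e"
    using noncrossing_no_path [OF generic_triangle [OF c]] ef(2) noncrossing_sym [of c e f] by auto
  consider "src e = src f" "tgt e \<noteq> tgt f" | "src e \<noteq> src f" "tgt e = tgt f" | "src e \<noteq> src f" "tgt e \<noteq> tgt f"
    using ef(1) by (auto simp: offdiag_eq_iff)
  then show thesis
  proof cases
    case 1
    obtain j where "j \<notin> {src f, tgt f, tgt e}"
      using ex_fourth by blast
    then have "distinct [src f, j, tgt f, tgt e]"
      using 1 n by auto
    moreover have "e = edge (src f) (tgt e)"
      using 1(1) by (simp flip: 1(1))
    ultimately show thesis
      by (intro that [of "src f" j "tgt f" "tgt e"]) auto
  next
    case 2
    obtain l where "l \<notin> {src f, tgt f, src e}"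
      using ex_fourth by blast
    then have "distinct [src f, src e, tgt f, l]"
      using 2 n by auto
    moreover have "e = edge (src e) (tgt f)"
      by (simp flip: 2(2))
    ultimately show thesis
      by (intro that [of "src f" "src e" "tgt f" l]) auto
  next
    case 3
    then have "distinct [src f, src e, tgt f, tgt e]"
      using n by auto
    then show thesis
      by (intro that [of "src f" "src e" "tgt f" "tgt e"]) auto
  qed
qed

section \<open>The volume polynomial\<close>

definition nbrs :: "real ^ offdiag \<Rightarrow> offdiag \<Rightarrow> offdiag set" where
  "nbrs c e = {f. f \<noteq> e \<and> noncrossing c e f}"

text \<open>
  In a square, the edge $(j,l)$ is opposite to $f = (i,k)$, and the condition says that $f$ is an
  endpoint of the triangulating edge.
\<close>

definition alpha2 :: "real ^ offdiag \<Rightarrow> offdiag \<Rightarrow> offdiag \<Rightarrow> real" where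
  "alpha2 c e f = (if \<exists>i j k l. distinct [i, j, k, l] \<and> f = edge i k \<and>
      e \<in> {edge i l, edge j k, edge j l} \<and> noncrossing c (edge i k) (edge j l) then -3 else 0)"

definition triples :: "real ^ offdiag \<Rightarrow> (offdiag \<times> offdiag \<times> offdiag) set" where
  "triples c = {(e, f, g). f \<in> nbrs c e \<and> g \<in> nbrs c e \<and> g \<in> nbrs c f}"

definition mon3 :: "offdiag \<Rightarrow> monom" where
  "mon3 e = Poly_Mapping.single e 3"

definition mon21 :: "offdiag \<Rightarrow> offdiag \<Rightarrow> monom" where
  "mon21 e f = Poly_Mapping.single e 2 + Poly_Mapping.single f 1"

definition mon111 :: "offdiag \<Rightarrow> offdiag \<Rightarrow> offdiag \<Rightarrow> monom" where
  "mon111 e f g = Poly_Mapping.single e 1 + Poly_Mapping.single f 1 + Poly_Mapping.single g 1"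

text \<open>The triples are ordered, so three pairwise noncrossing edges contribute 1 in each of
  their 3! orders, which makes the coefficient 6. The constant of the cubes is 6 rather than 7
  because the edge to the origin is not among the neighbours.\<close>

definition vol_mpoly :: "real ^ offdiag \<Rightarrow> mpoly" where
  "vol_mpoly c =
    (\<Sum>e\<in>UNIV. Poly_Mapping.single (mon3 e) (6 - real (card (nbrs c e)))) +
    (\<Sum>p\<in>{p. fst p \<noteq> snd p}. Poly_Mapping.single (mon21 (fst p) (snd p)) (alpha2 c (fst p) (snd p))) +
    (\<Sum>t\<in>triples c. Poly_Mapping.single (mon111 (fst t) (fst (snd t)) (snd (snd t))) 1)"

section \<open>Reading off the coefficients\<close>

lemma keys_mon: "Poly_Mapping.keys (mon3 e) = {e}" "Poly_Mapping.keys (mon21 e f) = {e, f}"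
    "Poly_Mapping.keys (mon111 e f g) = {e, f, g}"
  by (auto simp: mon3_def mon21_def mon111_def in_keys_iff lookup_add lookup_single when_def split: if_splits)

lemma mon3_eq_iff: "mon3 e = mon3 e0 \<longleftrightarrow> e = e0"
proof
  assume "mon3 e = mon3 e0"
  then have "Poly_Mapping.keys (mon3 e) = Poly_Mapping.keys (mon3 e0)"
    by simp
  then show "e = e0"
    by (simp add: keys_mon)
qed simp

lemma mon21_eq_iff:
  assumes "e \<noteq> f" "e0 \<noteq> f0"
  shows "mon21 e f = mon21 e0 f0 \<longleftrightarrow> e = e0 \<and> f = f0"
proof
  assume eq: "mon21 e f = mon21 e0 f0"
  have "Poly_Mapping.keys (mon21 e f) = Poly_Mapping.keys (mon21 e0 f0)"
    by (simp add: eq)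
  then have "{e, f} = {e0, f0}"
    by (simp add: keys_mon)
  moreover have "Poly_Mapping.lookup (mon21 e f) e0 = 2"
    unfolding eq using assms(2) by (simp add: mon21_def lookup_add lookup_single)
  then have "e = e0"
    by (auto simp: mon21_def lookup_add lookup_single when_def split: if_splits)
  ultimately show "e = e0 \<and> f = f0"
    using assms by (auto simp: doubleton_eq_iff)
qed simp

lemma mon111_eq_iff:
  assumes "e \<noteq> f" "e \<noteq> g" "f \<noteq> g"
  shows "mon111 e f g = mon111 e0 f0 g0 \<longleftrightarrow>
    (e, f, g) \<in> {(e0, f0, g0), (e0, g0, f0), (f0, e0, g0), (f0, g0, e0), (g0, e0, f0), (g0, f0, e0)}"
proof
  assume eq: "mon111 e f g = mon111 e0 f0 g0"
  have "Poly_Mapping.keys (mon111 e f g) = Poly_Mapping.keys (mon111 e0 f0 g0)"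
    by (simp add: eq)
  then have "{e, f, g} = {e0, f0, g0}"
    by (simp add: keys_mon)
  then have "e \<in> {e0, f0, g0}" "f \<in> {e0, f0, g0}" "g \<in> {e0, f0, g0}"
    by blast+
  then show "(e, f, g) \<in> {(e0, f0, g0), (e0, g0, f0), (f0, e0, g0), (f0, g0, e0), (g0, e0, f0), (g0, f0, e0)}"
    using assms by auto
qed (auto simp: mon111_def ac_simps)

lemma card_keys_mon:
  "card (Poly_Mapping.keys (mon3 e)) = 1"
  "e \<noteq> f \<Longrightarrow> card (Poly_Mapping.keys (mon21 e f)) = 2"
  "e \<noteq> f \<Longrightarrow> e \<noteq> g \<Longrightarrow> f \<noteq> g \<Longrightarrow> card (Poly_Mapping.keys (mon111 e f g)) = 3"
  by (simp_all add: keys_mon)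

lemma triplesD:
  assumes "t \<in> triples c"
  shows "fst t \<noteq> fst (snd t)" "fst t \<noteq> snd (snd t)" "fst (snd t) \<noteq> snd (snd t)"
  using assms by (auto simp: triples_def nbrs_def)

lemma lookup_vol_mpoly:
  "Poly_Mapping.lookup (vol_mpoly c) m =
    (\<Sum>e\<in>UNIV. if mon3 e = m then 6 - real (card (nbrs c e)) else 0) +
    (\<Sum>p\<in>{p. fst p \<noteq> snd p}. if mon21 (fst p) (snd p) = m then alpha2 c (fst p) (snd p) else 0) +
    (\<Sum>t\<in>triples c. if mon111 (fst t) (fst (snd t)) (snd (snd t)) = m then 1 else 0)"
  by (simp add: vol_mpoly_def lookup_add lookup_sum lookup_single when_def)

lemma sum_if_keys:
  assumes "\<And>x. x \<in> A \<Longrightarrow> card (Poly_Mapping.keys (M x)) = a" "card (Poly_Mapping.keys m) = b" "a \<noteq> b"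
  shows "(\<Sum>x\<in>A. if M x = m then h x else 0) = (0 :: real)"
  by (rule sum.neutral) (use assms in auto)

lemma sum_if_unique:
  fixes h :: "'x \<Rightarrow> real"
  assumes "finite A" "a \<in> A" "\<And>x. x \<in> A \<Longrightarrow> P x \<longleftrightarrow> x = a"
  shows "(\<Sum>x\<in>A. if P x then h x else 0) = h a"
proof -
  have "(\<Sum>x\<in>A. if P x then h x else 0) = (\<Sum>x\<in>A. if x = a then h x else 0)"
    by (rule sum.cong) (simp_all add: assms(3))
  then show ?thesis
    using assms by simp
qed

lemma lookup_vol_mpoly_3:
  "Poly_Mapping.lookup (vol_mpoly c) (mon3 e) = 6 - real (card (nbrs c e))"
proof -
  have "(\<Sum>p\<in>{p. fst p \<noteq> snd p}. if mon21 (fst p) (snd p) = mon3 e then alpha2 c (fst p) (snd p) else 0) = 0"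
    by (rule sum_if_keys [where a = 2, OF _ card_keys_mon(1)]) (simp_all add: card_keys_mon(2))
  moreover have "(\<Sum>t\<in>triples c. if mon111 (fst t) (fst (snd t)) (snd (snd t)) = mon3 e then 1 else 0) = (0 :: real)"
    by (rule sum_if_keys [where a = 3, OF _ card_keys_mon(1)]) (simp_all add: card_keys_mon(3) triplesD)
  moreover have "(\<Sum>e'\<in>UNIV. if mon3 e' = mon3 e then 6 - real (card (nbrs c e')) else 0) = 6 - real (card (nbrs c e))"
    by (rule sum_if_unique) (simp_all add: mon3_eq_iff)
  ultimately show ?thesis
    by (simp only: lookup_vol_mpoly)
qed

lemma lookup_vol_mpoly_21:
  assumes ne: "e \<noteq> f"
  shows "Poly_Mapping.lookup (vol_mpoly c) (mon21 e f) = alpha2 c e f"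
proof -
  have "(\<Sum>e'\<in>UNIV. if mon3 e' = mon21 e f then 6 - real (card (nbrs c e')) else 0) = 0"
    by (rule sum_if_keys [OF card_keys_mon(1) card_keys_mon(2) [OF ne]]) simp
  moreover have "(\<Sum>t\<in>triples c. if mon111 (fst t) (fst (snd t)) (snd (snd t)) = mon21 e f then 1 else 0) = (0 :: real)"
    by (rule sum_if_keys [where a = 3, OF _ card_keys_mon(2) [OF ne]]) (simp_all add: card_keys_mon(3) triplesD)
  moreover have "(\<Sum>p\<in>{p. fst p \<noteq> snd p}. if mon21 (fst p) (snd p) = mon21 e f then alpha2 c (fst p) (snd p) else 0) =
      alpha2 c (fst (e, f)) (snd (e, f))"
    by (rule sum_if_unique) (auto simp: mon21_eq_iff ne)
  ultimately show ?thesis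
    by (simp only: lookup_vol_mpoly) simp
qed

lemma lookup_vol_mpoly_111:
  assumes d: "e \<noteq> f" "e \<noteq> g" "f \<noteq> g"
  shows "Poly_Mapping.lookup (vol_mpoly c) (mon111 e f g) =
    (if noncrossing c e f \<and> noncrossing c e g \<and> noncrossing c f g then 6 else 0)"
proof -
  let ?P = "{(e, f, g), (e, g, f), (f, e, g), (f, g, e), (g, e, f), (g, f, e)}"
  have "(\<Sum>e'\<in>UNIV. if mon3 e' = mon111 e f g then 6 - real (card (nbrs c e')) else 0) = 0"
    by (rule sum_if_keys [OF card_keys_mon(1) card_keys_mon(3) [OF d]]) simp
  moreover have "(\<Sum>p\<in>{p. fst p \<noteq> snd p}. if mon21 (fst p) (snd p) = mon111 e f g then alpha2 c (fst p) (snd p) else 0) = 0"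
    by (rule sum_if_keys [where a = 2, OF _ card_keys_mon(3) [OF d]]) (simp_all add: card_keys_mon(2))
  moreover have "(\<Sum>t\<in>triples c. if mon111 (fst t) (fst (snd t)) (snd (snd t)) = mon111 e f g then 1 else 0) =
      (if noncrossing c e f \<and> noncrossing c e g \<and> noncrossing c f g then 6 else 0 :: real)"
  proof -
    have iff: "mon111 (fst t) (fst (snd t)) (snd (snd t)) = mon111 e f g \<longleftrightarrow> t \<in> ?P" if "t \<in> triples c" for t
      using mon111_eq_iff [OF triplesD [OF that]] by simp
    have "(\<Sum>t\<in>triples c. if mon111 (fst t) (fst (snd t)) (snd (snd t)) = mon111 e f g then 1 else 0) =
        (\<Sum>t\<in>triples c. if t \<in> ?P then 1 else 0 :: real)"
      by (rule sum.cong [OF refl]) (simp only: iff)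
    also have "\<dots> = real (card (triples c \<inter> ?P))"
      by (subst sum.inter_restrict [symmetric]) simp_all
    also have "triples c \<inter> ?P = (if noncrossing c e f \<and> noncrossing c e g \<and> noncrossing c f g then ?P else {})"
      using d noncrossing_sym [of c e f] noncrossing_sym [of c e g] noncrossing_sym [of c f g]
      by (auto simp: triples_def nbrs_def)
    also have "real (card \<dots>) = (if noncrossing c e f \<and> noncrossing c e g \<and> noncrossing c f g then 6 else 0)"
      using d by simp
    finally show ?thesis .
  qed
  ultimately show ?thesis
    by (simp only: lookup_vol_mpoly)
qed

section \<open>Grouping the polynomial by edges\<close>

lemma noncrossing_share:
  "src e = src f \<Longrightarrow> noncrossing c e f" "tgt e = tgt f \<Longrightarrow> noncrossing c e f"
  by (simp_all add: noncrossing_def opp_def)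

lemma noncrossing_swap:
  assumes "generic c" "distinct [i, j, k, l]"
  shows "noncrossing c (edge i l) (edge j k) \<longleftrightarrow> \<not> noncrossing c (edge i k) (edge j l)"
  using assms(2) genericD [OF assms(1), of "edge i l" "edge j k"]
  by (auto simp: noncrossing_def opp_def swap_wt_def wt_def)

lemma sum_edges:
  fixes h :: "offdiag \<Rightarrow> real"
  assumes d: "distinct [i, j, k, l]"
  shows "(\<Sum>e\<in>UNIV. h e) = h (edge i k) + h (edge i j) + h (edge i l) + h (edge j k) + h (edge l k) +
    h (edge j l) + h (edge l j) + h (edge k i) + h (edge k j) + h (edge k l) + h (edge j i) + h (edge l i)"
proof -
  let ?E = "[edge i k, edge i j, edge i l, edge j k, edge l k, edge j l, edge l j, edge k i, edge k j,
      edge k l, edge j i, edge l i]"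
  have "e \<in> set ?E" for e
  proof -
    have "src e \<in> {i, j, k, l}" "tgt e \<in> {i, j, k, l}"
      using distinct_cases_4 [OF d] by auto
    then have "edge (src e) (tgt e) \<in> set ?E"
      using src_neq_tgt [of e] by (elim insertE emptyE; simp)
    then show ?thesis by simp
  qed
  then have U: "UNIV = set ?E"
    by blast
  have dist: "distinct ?E"
  proof -
    have "i \<noteq> j" "j \<noteq> i" "i \<noteq> k" "k \<noteq> i" "i \<noteq> l" "l \<noteq> i" "j \<noteq> k" "k \<noteq> j" "j \<noteq> l" "l \<noteq> j" "k \<noteq> l" "l \<noteq> k"
      using d by auto
    then show ?thesis
      by (simp add: edge_eq_iff)
  qed
  have "(\<Sum>e\<in>UNIV. h e) = sum_list (map h ?E)"
    by (subst U) (rule sum.distinct_set_conv_list [OF dist])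
  then show ?thesis
    by simp
qed

text \<open>The edge (i,k) fixes i and k, and e, which differs from it, fixes j or l; the fourth
  vertex is the remaining one. So the existential quantifier in \<open>alpha2\<close> concerns one
  square only.\<close>

lemma alpha2_eq:
  assumes d: "distinct [i, j, k, l]" and e: "e \<in> {edge i l, edge j k, edge j l}"
  shows "alpha2 c e (edge i k) = (if noncrossing c (edge i k) (edge j l) then -3 else 0)"
proof -
  have "noncrossing c (edge i k) (edge j l)"
    if d': "distinct [i', j', k', l']" "edge i k = edge i' k'" "e \<in> {edge i' l', edge j' k', edge j' l'}"
      and comp: "noncrossing c (edge i' k') (edge j' l')" for i' j' k' l'
  proof -
    have ik: "i' = i" "k' = k"
      using d' d by (auto simp: edge_eq_iff)
    have U: "j' \<in> {i, j, k, l}" "l' \<in> {i, j, k, l}"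
      using distinct_cases_4 [OF d] by auto
    have "src e \<in> {i, j}" "tgt e \<in> {k, l}" "e \<noteq> edge i k"
      using e d by (auto simp: edge_eq_iff)
    moreover have "src e \<in> {i, j'}" "tgt e \<in> {k, l'}"
      using d' by (auto simp: ik)
    moreover have "src e \<noteq> i \<or> tgt e \<noteq> k"
      using calculation(3) by (metis edge_src_tgt)
    ultimately have "j' = j \<and> l' = l"
      using U d d'(1) unfolding ik by auto
    then show ?thesis
      using comp ik by simp
  qed
  then have "(\<exists>i' j' k' l'. distinct [i', j', k', l'] \<and> edge i k = edge i' k' \<and>
      e \<in> {edge i' l', edge j' k', edge j' l'} \<and> noncrossing c (edge i' k') (edge j' l')) \<longleftrightarrow>
    noncrossing c (edge i k) (edge j l)"
    using d e by metis
  then show ?thesis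
    by (simp only: alpha2_def)
qed

lemma alpha2_eq_0:
  assumes "e = f \<or> src e = tgt f \<or> tgt e = src f"
  shows "alpha2 c e f = 0"
proof -
  have "\<not> (distinct [i, j, k, l] \<and> f = edge i k \<and> e \<in> {edge i l, edge j k, edge j l})" for i j k l
    using assms by (auto simp: edge_eq_iff)
  then show ?thesis
    unfolding alpha2_def by (intro if_not_P) blast
qed

text \<open>A real-valued indicator, by which case distinctions on the triangulation become
  polynomial arithmetic.\<close>

definition adj :: "real ^ offdiag \<Rightarrow> offdiag \<Rightarrow> offdiag \<Rightarrow> real" where
  "adj c e f = of_bool (f \<in> nbrs c e)"

lemma sum_nbrs: "(\<Sum>f\<in>nbrs c e. h f) = (\<Sum>f\<in>UNIV. adj c e f * h f)"
proof -
  have "(\<Sum>f\<in>UNIV. adj c e f * h f) = (\<Sum>f\<in>UNIV. if f \<in> nbrs c e then h f else 0)"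
    by (rule sum.cong) (auto simp: adj_def)
  then show ?thesis
    by (simp flip: sum.inter_restrict)
qed

lemma card_nbrs: "real (card (nbrs c e)) = (\<Sum>f\<in>UNIV. adj c e f)"
  using sum_nbrs [where h = "\<lambda>_. 1"] by simp

lemma adj_self: "adj c e e = 0"
  by (simp add: adj_def nbrs_def)

lemma adj_share:
  "i \<noteq> k \<Longrightarrow> i \<noteq> l \<Longrightarrow> k \<noteq> l \<Longrightarrow> adj c (edge i k) (edge i l) = 1"
  "i \<noteq> k \<Longrightarrow> j \<noteq> k \<Longrightarrow> i \<noteq> j \<Longrightarrow> adj c (edge i k) (edge j k) = 1"
  by (simp_all add: adj_def nbrs_def noncrossing_share edge_eq_iff)

lemma adj_path:
  assumes "generic c" "i \<noteq> j" "j \<noteq> k"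
  shows "adj c (edge i j) (edge j k) = 0" "adj c (edge j k) (edge i j) = 0"
  using noncrossing_no_path [OF generic_triangle [OF assms(1)], of "edge i j" "edge j k"] assms
    noncrossing_sym [of c "edge i j" "edge j k"]
  by (auto simp: adj_def nbrs_def)

lemma adj_opp:
  assumes "distinct [i, j, k, l]"
  shows "adj c (edge i k) (edge j l) = of_bool (noncrossing c (edge i k) (edge j l))"
  using assms by (auto simp: adj_def nbrs_def edge_eq_iff)

lemma adj_sym: "adj c e f = adj c f e"
  using noncrossing_sym [of c e f] by (auto simp: adj_def nbrs_def)

lemma adj_swap:
  assumes "generic c" "distinct [i, j, k, l]"
  shows "adj c (edge i l) (edge j k) = 1 - adj c (edge i k) (edge j l)"
proof -
  have "distinct [i, j, l, k]"
    using assms(2) by auto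
  then show ?thesis
    using noncrossing_swap [OF assms] by (simp add: adj_opp [OF assms(2)] adj_opp)
qed

text \<open>The cofactor of x_e when each monomial with a square is charged to its linear factor and
  each ordered triple to its first entry. With this choice only edges in the squares through e are
  involved.\<close>

definition local_term :: "real ^ offdiag \<Rightarrow> real ^ offdiag \<Rightarrow> offdiag \<Rightarrow> real" where
  "local_term c x e = (6 - real (card (nbrs c e))) * (x $ e)\<^sup>2 +
    (\<Sum>e'\<in>UNIV. alpha2 c e' e * (x $ e')\<^sup>2) +
    (\<Sum>f\<in>nbrs c e. x $ f * (\<Sum>g\<in>nbrs c e \<inter> nbrs c f. x $ g))"

lemma eval_vol_mpoly: "eval_mpoly (vol_mpoly c) x = (\<Sum>e\<in>UNIV. x $ e * local_term c x e)"
proof -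
  have m: "monom_val (mon3 e) x = x $ e * (x $ e)\<^sup>2" "monom_val (mon21 e f) x = (x $ e)\<^sup>2 * x $ f"
    "monom_val (mon111 e f g) x = x $ e * (x $ f * x $ g)" for e f g
    by (simp_all add: mon3_def mon21_def mon111_def monom_val_add power2_eq_square power3_eq_cube)
  have "(\<Sum>p\<in>{p. fst p \<noteq> snd p}. alpha2 c (fst p) (snd p) * ((x $ fst p)\<^sup>2 * x $ snd p)) =
      (\<Sum>p\<in>UNIV \<times> UNIV. alpha2 c (fst p) (snd p) * ((x $ fst p)\<^sup>2 * x $ snd p))"
    by (rule sum.mono_neutral_left) (auto simp: alpha2_eq_0)
  also have "\<dots> = (\<Sum>e'\<in>UNIV. \<Sum>e\<in>UNIV. alpha2 c e' e * ((x $ e')\<^sup>2 * x $ e))"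
    by (simp only: sum.cartesian_product) (simp add: split_def)
  also have "\<dots> = (\<Sum>e\<in>UNIV. \<Sum>e'\<in>UNIV. alpha2 c e' e * ((x $ e')\<^sup>2 * x $ e))"
    by (rule sum.swap)
  also have "\<dots> = (\<Sum>e\<in>UNIV. x $ e * (\<Sum>e'\<in>UNIV. alpha2 c e' e * (x $ e')\<^sup>2))"
    by (simp add: sum_distrib_left mult_ac)
  finally have two: "(\<Sum>p\<in>{p. fst p \<noteq> snd p}. alpha2 c (fst p) (snd p) * ((x $ fst p)\<^sup>2 * x $ snd p)) = \<dots>" .
  have T: "triples c = (SIGMA e:UNIV. SIGMA f:nbrs c e. nbrs c e \<inter> nbrs c f)"
    by (auto simp: triples_def)
  have three: "(\<Sum>t\<in>triples c. x $ fst t * (x $ fst (snd t) * x $ snd (snd t))) =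
      (\<Sum>e\<in>UNIV. x $ e * (\<Sum>f\<in>nbrs c e. x $ f * (\<Sum>g\<in>nbrs c e \<inter> nbrs c f. x $ g)))"
  proof -
    have "(\<Sum>t\<in>triples c. x $ fst t * (x $ fst (snd t) * x $ snd (snd t))) =
        (\<Sum>e\<in>UNIV. \<Sum>s\<in>(SIGMA f:nbrs c e. nbrs c e \<inter> nbrs c f). x $ e * (x $ fst s * x $ snd s))"
      unfolding T by (subst sum.Sigma) (simp_all add: split_def)
    also have "\<dots> = (\<Sum>e\<in>UNIV. \<Sum>f\<in>nbrs c e. \<Sum>g\<in>nbrs c e \<inter> nbrs c f. x $ e * (x $ f * x $ g))"
      by (rule sum.cong [OF refl], subst sum.Sigma) (simp_all add: split_def)
    finally show ?thesis
      by (simp add: sum_distrib_left)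
  qed
  show ?thesis
    unfolding vol_mpoly_def eval_mpoly_add eval_mpoly_sum eval_mpoly_single m local_term_def
    using two three by (simp add: distrib_left sum.distrib mult_ac)
qed

text \<open>The edge (i,k) lies in two squares, where its opposite edges are (j,l) and (l,j); p and
  q record whether it ends the triangulating edge there. Four neighbours share an endpoint with it,
  so there are 4 + p + q of them, and 6 minus this number is the first coefficient.\<close>

lemma local_term_eq:
  assumes c: "generic c" and d: "distinct [i, j, k, l]"
  shows "local_term c x (edge i k) =
    (let p = adj c (edge i k) (edge j l); q = adj c (edge i k) (edge l j)
     in (2 - p - q) * (x $ edge i k)\<^sup>2 -
       3 * p * ((x $ edge i l)\<^sup>2 + (x $ edge j k)\<^sup>2 + (x $ edge j l)\<^sup>2) -
       3 * q * ((x $ edge i j)\<^sup>2 + (x $ edge l k)\<^sup>2 + (x $ edge l j)\<^sup>2) +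
       2 * (x $ edge i j * x $ edge i l + x $ edge j k * x $ edge l k +
         p * x $ edge j l * (x $ edge i l + x $ edge j k) + (1 - p) * x $ edge i l * x $ edge j k +
         q * x $ edge l j * (x $ edge i j + x $ edge l k) + (1 - q) * x $ edge i j * x $ edge l k))"
proof -
  have d': "distinct [i, l, k, j]"
    using d by auto
  have n: "i \<noteq> j" "j \<noteq> i" "i \<noteq> k" "k \<noteq> i" "i \<noteq> l" "l \<noteq> i" "j \<noteq> k" "k \<noteq> j" "j \<noteq> l" "l \<noteq> j" "k \<noteq> l" "l \<noteq> k"
    using d by auto
  define p where "p = adj c (edge i k) (edge j l)"
  define q where "q = adj c (edge i k) (edge l j)"
  note pq = p_def [symmetric] q_def [symmetric]
  have a: "adj c (edge i l) (edge j k) = 1 - p" "adj c (edge j k) (edge i l) = 1 - p"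
    "adj c (edge i j) (edge l k) = 1 - q" "adj c (edge l k) (edge i j) = 1 - q"
    using adj_swap [OF c d] adj_swap [OF c d'] adj_sym [of c "edge j k" "edge i l"]
      adj_sym [of c "edge l k" "edge i j"] by (simp_all add: p_def q_def)
  have idem: "p * p = p" "q * q = q"
    by (auto simp: p_def q_def adj_def)
  note table = a pq adj_self adj_share [OF n(3)] adj_share adj_path [OF c]
  have card: "real (card (nbrs c (edge i k))) = 4 + p + q"
    unfolding card_nbrs sum_edges [OF d] by (simp add: table n)
  have al: "alpha2 c e (edge i k) = -3 * p" if "e \<in> {edge i l, edge j k, edge j l}" for e
    using alpha2_eq [OF d that] by (simp add: p_def adj_opp [OF d])
  have al': "alpha2 c e (edge i k) = -3 * q" if "e \<in> {edge i j, edge l k, edge l j}" for e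
    using alpha2_eq [OF d' that] by (simp add: q_def adj_opp [OF d'])
  have sum2: "(\<Sum>e'\<in>UNIV. alpha2 c e' (edge i k) * (x $ e')\<^sup>2) =
      - 3 * p * ((x $ edge i l)\<^sup>2 + (x $ edge j k)\<^sup>2 + (x $ edge j l)\<^sup>2) -
       3 * q * ((x $ edge i j)\<^sup>2 + (x $ edge l k)\<^sup>2 + (x $ edge l j)\<^sup>2)"
    unfolding sum_edges [OF d] by (simp add: al al' alpha2_eq_0 n algebra_simps)
  have inner: "(\<Sum>g\<in>nbrs c (edge i k) \<inter> nbrs c f. x $ g) =
      adj c f (edge i j) * x $ edge i j + adj c f (edge i l) * x $ edge i l + adj c f (edge j k) * x $ edge j k +
      adj c f (edge l k) * x $ edge l k + p * adj c f (edge j l) * x $ edge j l + q * adj c f (edge l j) * x $ edge l j" for f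
  proof -
    have "(\<Sum>g\<in>nbrs c (edge i k) \<inter> nbrs c f. x $ g) =
        (\<Sum>g\<in>nbrs c (edge i k). if g \<in> nbrs c f then x $ g else 0)"
      by (simp add: sum.inter_restrict)
    also have "\<dots> = (\<Sum>g\<in>nbrs c (edge i k). adj c f g * x $ g)"
      by (rule sum.cong) (auto simp: adj_def)
    also have "\<dots> = (\<Sum>g\<in>UNIV. adj c (edge i k) g * (adj c f g * x $ g))"
      by (rule sum_nbrs)
    finally show ?thesis
      unfolding sum_edges [OF d] by (simp add: table n)
  qed
  have "(\<Sum>f\<in>nbrs c (edge i k). x $ f * (\<Sum>g\<in>nbrs c (edge i k) \<inter> nbrs c f. x $ g)) =
      2 * (x $ edge i j * x $ edge i l + x $ edge j k * x $ edge l k +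
         p * x $ edge j l * (x $ edge i l + x $ edge j k) + (1 - p) * x $ edge i l * x $ edge j k +
         q * x $ edge l j * (x $ edge i j + x $ edge l k) + (1 - q) * x $ edge i j * x $ edge l k)"
    unfolding sum_nbrs [of _ c] inner sum_edges [OF d] by (simp add: table n) (simp add: algebra_simps)
  then show ?thesis
    unfolding local_term_def card sum2 Let_def pq by (simp add: algebra_simps)
qed

section \<open>Comparison with the volume formula\<close>

definition corner_poly :: "real \<Rightarrow> real \<Rightarrow> real" where
  "corner_poly A B = A\<^sup>2 * B / 2 - A ^ 3 / 6"

text \<open>Minimum and maximum are traded for one indicator, so that both sides of the final
  comparison are polynomial.\<close>

lemma corner_vol_eq:
  "corner_vol A B = of_bool (A < B) * corner_poly A B + (1 - of_bool (A < B)) * corner_poly B A"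
proof (cases "A < B")
  case True
  then show ?thesis
    by (simp add: corner_vol_def corner_poly_def)
next
  case False
  then have "min A B = B" "max A B = A"
    by auto
  with False show ?thesis
    by (simp add: corner_vol_def corner_poly_def)
qed

lemma six_corner:
  "6 * (s * corner_poly A B + (1 - s) * corner_poly B A) =
    s * (3 * A * A * B - A * A * A) + (1 - s) * (3 * B * B * A - B * B * B)"
  by (simp add: corner_poly_def power2_eq_square power3_eq_cube field_simps)

lemma six_volume:
  fixes P :: real
  shows "6 * (P - (a1\<^sup>2 / 2 * b1 + a2\<^sup>2 / 2 * b2 + a3\<^sup>2 / 2 * b3 + a4\<^sup>2 / 2 * b4 +
        a5\<^sup>2 / 2 * b5 + a6\<^sup>2 / 2 * b6) + (c1 + c2 + c3) + (c4 + c5 + c6)) =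
    6 * P - 3 * (a1 * a1 * b1 + a2 * a2 * b2 + a3 * a3 * b3 + a4 * a4 * b4 + a5 * a5 * b5 + a6 * a6 * b6) +
    (6 * c1 + 6 * c2 + 6 * c3) + (6 * c4 + 6 * c5 + 6 * c6)"
  by (simp add: power2_eq_square algebra_simps)

text \<open>The weight c_ip cancels. What remains compares the two diagonals of the square with
  tails p, i and heads j, k.\<close>

lemma adj_source:
  assumes "distinct [p, i, j, k]"
  shows "of_bool (wt c i p + wt c p j - wt c i j < wt c i p + wt c p k - wt c i k) = adj c (edge p j) (edge i k)"
  using assms by (auto simp: adj_opp noncrossing_def opp_def swap_wt_def wt_def)

lemma adj_sink:
  assumes "distinct [p, i, j, k]"
  shows "of_bool (wt c j p + wt c p i - wt c j i < wt c k p + wt c p i - wt c k i) = adj c (edge j p) (edge k i)"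
  using assms by (auto simp: adj_opp noncrossing_def opp_def swap_wt_def wt_def)

lemma adj_square:
  assumes c: "generic c" and d: "distinct [i, j, k, l]"
  shows "adj c (edge j l) (edge i k) = adj c (edge i k) (edge j l)"
    "adj c (edge i l) (edge j k) = 1 - adj c (edge i k) (edge j l)"
    "adj c (edge j k) (edge i l) = 1 - adj c (edge i k) (edge j l)"
  using adj_swap [OF c d] adj_sym [of c "edge j k" "edge i l"] adj_sym [of c "edge j l" "edge i k"] by simp_all

lemma eval_vol_mpoly_eq_volume:
  assumes c: "generic c"
  shows "eval_mpoly (vol_mpoly c) c = 6 * polytrope_volume c"
proof -
  \<comment> \<open>One indicator per square; any other value of \<open>adj\<close> on opposite
    edges of a square equals it or is one minus it.\<close>
  define s1 where "s1 = adj c (edge 1 3) (edge 2 4)"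
  define s2 where "s2 = adj c (edge 1 2) (edge 3 4)"
  define s3 where "s3 = adj c (edge 1 2) (edge 4 3)"
  define s4 where "s4 = adj c (edge 2 1) (edge 3 4)"
  define s5 where "s5 = adj c (edge 2 1) (edge 4 3)"
  define s6 where "s6 = adj c (edge 3 1) (edge 4 2)"
  have d1234: "distinct [1, 2, 3, 4 :: 4]"
    and d1243: "distinct [1, 2, 4, 3 :: 4]"
    and d1324: "distinct [1, 3, 2, 4 :: 4]"
    and d1423: "distinct [1, 4, 2, 3 :: 4]"
    and d2134: "distinct [2, 1, 3, 4 :: 4]"
    and d2143: "distinct [2, 1, 4, 3 :: 4]"
    and d2314: "distinct [2, 3, 1, 4 :: 4]"
    and d2413: "distinct [2, 4, 1, 3 :: 4]"
    and d3124: "distinct [3, 1, 2, 4 :: 4]"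
    and d3142: "distinct [3, 1, 4, 2 :: 4]"
    and d3214: "distinct [3, 2, 1, 4 :: 4]"
    and d3412: "distinct [3, 4, 1, 2 :: 4]"
    and d4123: "distinct [4, 1, 2, 3 :: 4]"
    and d4132: "distinct [4, 1, 3, 2 :: 4]"
    and d4213: "distinct [4, 2, 1, 3 :: 4]"
    and d4312: "distinct [4, 3, 1, 2 :: 4]"
    by simp_all
  note sq =
    s1_def [symmetric] adj_square [OF c d1234, folded s1_def]
    s2_def [symmetric] adj_square [OF c d1324, folded s2_def]
    s3_def [symmetric] adj_square [OF c d1423, folded s3_def]
    s4_def [symmetric] adj_square [OF c d2314, folded s4_def]
    s5_def [symmetric] adj_square [OF c d2413, folded s5_def]
    s6_def [symmetric] adj_square [OF c d3412, folded s6_def]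
  note loc =
    local_term_eq [OF c d1324, of c, unfolded Let_def sq]
    local_term_eq [OF c d1234, of c, unfolded Let_def sq]
    local_term_eq [OF c d1243, of c, unfolded Let_def sq]
    local_term_eq [OF c d2314, of c, unfolded Let_def sq]
    local_term_eq [OF c d2134, of c, unfolded Let_def sq]
    local_term_eq [OF c d2143, of c, unfolded Let_def sq]
    local_term_eq [OF c d3214, of c, unfolded Let_def sq]
    local_term_eq [OF c d3124, of c, unfolded Let_def sq]
    local_term_eq [OF c d3142, of c, unfolded Let_def sq]
    local_term_eq [OF c d4213, of c, unfolded Let_def sq]
    local_term_eq [OF c d4123, of c, unfolded Let_def sq]
    local_term_eq [OF c d4132, of c, unfolded Let_def sq]
  have w: "wt c 1 2 = c $ edge 1 2" "wt c 1 3 = c $ edge 1 3" "wt c 1 4 = c $ edge 1 4"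
    "wt c 2 1 = c $ edge 2 1" "wt c 2 3 = c $ edge 2 3" "wt c 2 4 = c $ edge 2 4"
    "wt c 3 1 = c $ edge 3 1" "wt c 3 2 = c $ edge 3 2" "wt c 3 4 = c $ edge 3 4"
    "wt c 4 1 = c $ edge 4 1" "wt c 4 2 = c $ edge 4 2" "wt c 4 3 = c $ edge 4 3"
    by (simp_all add: wt_def)
  note corner =
    adj_source [OF d4123, of c, unfolded w sq] adj_sink [OF d4123, of c, unfolded w sq]
    adj_source [OF d4213, of c, unfolded w sq] adj_sink [OF d4213, of c, unfolded w sq]
    adj_source [OF d4312, of c, unfolded w sq] adj_sink [OF d4312, of c, unfolded w sq]
  have "eval_mpoly (vol_mpoly c) c = (\<Sum>e\<in>UNIV. c $ e * local_term c c e)"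
    by (rule eval_vol_mpoly)
  \<comment> \<open>After the denominators are cleared, both sides are polynomials in the twelve
    weights and the six indicators, and they agree identically in all of these variables.\<close>
  also have "\<dots> = 6 * polytrope_volume c"
    unfolding sum_edges [OF d1234] polytrope_volume_eq [OF generic_triangle [OF c]] Let_def loc
      corner_vol_eq w corner
    unfolding six_volume unfolding six_corner power2_eq_square
    by algebra
  finally show ?thesis .
qed

section \<open>Coefficients of the volume polynomial\<close>

text \<open>The coefficients see the weights through the noncrossing relation only, so the volume
  identity at any c' of the same type is an identity for the polynomial of c.\<close>

lemma vol_mpoly_cong:
  assumes comp: "\<forall>e f. noncrossing c e f \<longleftrightarrow> noncrossing c' e f"
  shows "vol_mpoly c = vol_mpoly c'"
proof -
  have n: "nbrs c e = nbrs c' e" for e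
    using comp by (simp add: nbrs_def)
  have t: "triples c = triples c'"
    by (simp add: triples_def n)
  have a: "alpha2 c = alpha2 c'"
    using comp by (simp add: alpha2_def fun_eq_iff)
  show ?thesis
    by (simp add: vol_mpoly_def n t a)
qed

lemma volume_polynomial_eq:
  assumes "maximal_polytrope c"
  shows "volume_polynomial c = vol_mpoly c"
proof (rule volume_polynomial_eqI [OF assms])
  fix c' assume c': "generic c'" "\<forall>e f. noncrossing c e f \<longleftrightarrow> noncrossing c' e f"
  show "eval_mpoly (vol_mpoly c) c' = fact 3 * polytrope_volume c'"
    using eval_vol_mpoly_eq_volume [OF c'(1)] by (simp add: vol_mpoly_cong [OF c'(2)] fact_numeral)
qed

theorem theorem1p2:
  fixes c :: "real ^ offdiag"
    and T :: "(real ^ 4) set set"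
    and \<alpha> :: "monom \<Rightarrow> real"
  assumes "maximal_polytrope c"
  defines "T \<equiv> central_subdivision c"
    and "\<alpha> \<equiv> Poly_Mapping.lookup (volume_polynomial c)"
  shows
    "(\<forall>e f g. e \<noteq> f \<and> e \<noteq> g \<and> f \<noteq> g \<longrightarrow>
        \<alpha> (Poly_Mapping.single e 1 + Poly_Mapping.single f 1 + Poly_Mapping.single g 1) =
          (if 2 simplex (convex hull {root_vec e, root_vec f, root_vec g}) \<and>
              convex hull {root_vec e, root_vec f, root_vec g} \<in> T
           then 6 else 0)) \<and>
     (\<forall>e f. e \<noteq> f \<longrightarrow>
        (\<alpha> (Poly_Mapping.single e 2 + Poly_Mapping.single f 1) \<noteq> 0 \<longrightarrow>
           adjacent T (root_vec e) (root_vec f)) \<and>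
        (adjacent T (root_vec e) (root_vec f) \<longrightarrow>
           (\<exists>!S. square_facet S \<and> root_vec e \<in> S \<and> root_vec f \<in> S) \<and>
           (\<forall>S. square_facet S \<and> root_vec e \<in> S \<and> root_vec f \<in> S \<longrightarrow>
              \<alpha> (Poly_Mapping.single e 2 + Poly_Mapping.single f 1) =
                (if \<exists>E. triangulating_edge T S E \<and> root_vec f extreme_point_of E
                 then -3 else 0)))) \<and>
     (\<forall>e. \<alpha> (Poly_Mapping.single e 3) = 7 - real (deg T (root_vec e)))"
proof -
  have c: "generic c"
    by (rule maximal_generic [OF assms(1)])
  have \<alpha>: "\<alpha> m = Poly_Mapping.lookup (vol_mpoly c) m" for m
    by (simp add: \<alpha>_def volume_polynomial_eq [OF assms(1)])
  show ?thesis
  proof (intro conjI allI impI)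
    fix e f g :: offdiag assume "e \<noteq> f \<and> e \<noteq> g \<and> f \<noteq> g"
    then have d: "e \<noteq> f" "e \<noteq> g" "f \<noteq> g"
      by auto
    show "\<alpha> (Poly_Mapping.single e 1 + Poly_Mapping.single f 1 + Poly_Mapping.single g 1) =
          (if 2 simplex (convex hull {root_vec e, root_vec f, root_vec g}) \<and>
              convex hull {root_vec e, root_vec f, root_vec g} \<in> T
           then 6 else 0)"
      unfolding \<alpha> T_def triangle_cell_iff [OF c d]
      using lookup_vol_mpoly_111 [OF d] unfolding mon111_def .
  next
    fix e f :: offdiag assume ne: "e \<noteq> f"
    have \<alpha>2: "\<alpha> (Poly_Mapping.single e 2 + Poly_Mapping.single f 1) = alpha2 c e f"
      unfolding \<alpha> using lookup_vol_mpoly_21 [OF ne] unfolding mon21_def .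
    show "adjacent T (root_vec e) (root_vec f)"
      if "\<alpha> (Poly_Mapping.single e 2 + Poly_Mapping.single f 1) \<noteq> 0"
    proof -
      have "alpha2 c e f \<noteq> 0"
        using that unfolding \<alpha>2 .
      then obtain i j k l where "distinct [i, j, k, l]" "f = edge i k" "e \<in> {edge i l, edge j k, edge j l}"
        "noncrossing c (edge i k) (edge j l)"
        unfolding alpha2_def by (auto split: if_splits)
      \<comment> \<open>In two of the three positions e shares an endpoint with f; in the third it
        is opposite to f, and the condition on the diagonal is the claim.\<close>
      then have "noncrossing c e f"
        using noncrossing_sym [of c "edge i k" "edge j l"] by (auto intro: noncrossing_share)
      then show ?thesis
        using ne by (simp add: T_def adjacent_iff [OF c])
    qed
    assume adj: "adjacent T (root_vec e) (root_vec f)"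
    then have comp: "noncrossing c e f"
      by (simp add: T_def adjacent_iff [OF c])
    obtain i j k l where d: "distinct [i, j, k, l]" and f: "f = edge i k" and e: "e \<in> {edge i l, edge j k, edge j l}"
      by (rule noncrossing_in_square [OF c ne comp])
    have mem: "root_vec e \<in> sq_face i j k l" "root_vec f \<in> sq_face i j k l"
      unfolding sq_face_props(2) [OF d] using e by (auto simp: sq_def f)
    have uniq: "S = sq_face i j k l" if "square_facet S \<and> root_vec e \<in> S \<and> root_vec f \<in> S" for S
      using square_facet_unique [OF d _ e, of S] that f by blast
    show "\<exists>!S. square_facet S \<and> root_vec e \<in> S \<and> root_vec f \<in> S"
      using square_facet_sq_face [OF d] mem uniq by blast
    fix S assume "square_facet S \<and> root_vec e \<in> S \<and> root_vec f \<in> S"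
    then have S: "S = sq_face i j k l"
      by (rule uniq)
    show "\<alpha> (Poly_Mapping.single e 2 + Poly_Mapping.single f 1) =
        (if \<exists>E. triangulating_edge T S E \<and> root_vec f extreme_point_of E then -3 else 0)"
      unfolding \<alpha>2 S T_def unfolding f triangulating_edge_iff [OF c d] by (rule alpha2_eq [OF d e])
  next
    fix e :: offdiag
    show "\<alpha> (Poly_Mapping.single e 3) = 7 - real (deg T (root_vec e))"
      unfolding \<alpha> T_def deg_eq [OF c]
      using lookup_vol_mpoly_3 [of c e] by (simp add: mon3_def nbrs_def)
  qed
qed

end
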